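(* Let $A$ be a finite dimensional $\Omega$-algebra over a field $F$, let $A^*$ be the dual $\Omega^*$-algebra, and let $V\subseteq\mathrm{End}_F(A^* )$ be a unital subalgebra. Then there is a bialgebra isomorphism $${}_\square\mathcal{B}(A^*,V)\cong{}_\square\mathcal{B}(A,V^{\#})^{\mathrm{op}},$$ where $V^{\#}:=\{f^*\mid f\in V\}\subseteq\mathrm{End}_F(A)$.
   Context: $F$ is a fixed field; everything is over $F$; coalgebras are coassociative and counital. $B^{\mathrm{op}}$ denotes the bialgebra with opposite multiplication. $\Omega$ is a fixed set with two maps $s,t\colon\Omega\to\mathbb{Z}_+$. An $\Omega$-algebra is a vector space $A$ with a linear map $\omega_A\colon A^{\otimes s(\omega)}\to A^{\otimes t(\omega)}$ for every $\omega\in\Omega$, where $A^{\otimes 0}:=F$. $\Omega^*=\{\omega^*\mid\omega\in\Omega\}$ is the set with $s^*(\omega^* )=t(\omega)$, $t^*(\omega^* )=s(\omega)$; for a finite dimensional $\Omega$-algebra $A$, $A^*$ is an $\Omega^*$-algebra whose operations are the dual maps of the $\omega_A$ (identifying $(A^{\otimes n})^*=(A^* )^{\otimes n}$). For $f\in\mathrm{End}_F(A^* )$, $f^*\in\mathrm{End}_F(A^{**})=\mathrm{End}_F(A)$ is the dual operator. For an $\Omega$-algebra $A$ (similarly for $\Omega^*$-algebras), a coalgebra $P$ and linear $\psi\colon P\otimes A\to A$ put $\psi_0=\varepsilon_P$, $\psi_n(p\otimes a_1\otimes\dots\otimes a_n)=\psi(p_{(1)}\otimes a_1)\otimes\dots\otimes\psi(p_{(n)}\otimes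 a_n)$ for $n>0$; $\psi$ is a measuring if $\psi_{t(\omega)}(p\otimes\omega_A(x))=\omega_A(\psi_{s(\omega)}(p\otimes x))$ for all $\omega,p,x$. $\mathrm{cosupp}\,\psi=\{\psi(p\otimes(-))\mid p\in P\}\subseteq\mathrm{End}_F(A)$. An action of a bialgebra $B$ on $A$ is a unital left module structure $B\otimes A\to A$ that is a measuring. For a unital subalgebra $V\subseteq\mathrm{End}_F(A)$, the $V$-universal acting bialgebra $({}_\square\mathcal{B}(A,V),\psi_{A,V})$ is the terminal object in the category of measurings $\psi\colon P\otimes A\to A$ with $\mathrm{cosupp}\,\psi\subseteq V$ ($P$ a coalgebra; morphisms are coalgebra maps $\varphi$ with $\psi_2(\varphi\otimes\mathrm{id}_A)=\psi_1$), with the unique bialgebra structure making $\psi_{A,V}$ an action; it always exists and is also terminal among actions of bialgebras on $A$ with cosupport in $V$ (morphisms being bialgebra maps). *)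

theory Defs
  imports Complex_Main "HOL-Library.Function_Algebras"
begin

text \<open>
  The ground field is a type of class \<open>field\<close>. A vector space is given by its set of vectors
  inside an ambient type, together with a scalar multiplication on that type.
\<close>

record ('f, 'v) vsp =
  vec :: "'v set"
  smul :: "'f \<Rightarrow> 'v \<Rightarrow> 'v"

definition vspace :: "('f::field, 'v::ab_group_add, 'z) vsp_scheme \<Rightarrow> bool" where
  "vspace V \<longleftrightarrow> vector_space (smul V) \<and> module.subspace (smul V) (vec V)"

definition fin_dim :: "('f::field, 'v::ab_group_add, 'z) vsp_scheme \<Rightarrow> bool" where
  "fin_dim V \<longleftrightarrow> (\<exists>S. finite S \<and> S \<subseteq> vec V \<and> module.span (smul V) S = vec V)"

definition ground :: "('f::field, 'f) vsp" where
  "ground = \<lparr>vec = UNIV, smul = (*)\<rparr>"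

definition fscale :: "'f::field \<Rightarrow> ('x \<Rightarrow> 'f) \<Rightarrow> 'x \<Rightarrow> 'f" where
  "fscale c f = (\<lambda>x. c * f x)"

definition linear_on ::
  "('f::field, 'v::ab_group_add, 'y) vsp_scheme \<Rightarrow> ('f, 'w::ab_group_add, 'z) vsp_scheme
    \<Rightarrow> ('v \<Rightarrow> 'w) \<Rightarrow> bool" where
  "linear_on V W f \<longleftrightarrow>
    (\<forall>x\<in>vec V. f x \<in> vec W) \<and>
    (\<forall>x\<in>vec V. \<forall>y\<in>vec V. f (x + y) = f x + f y) \<and>
    (\<forall>c. \<forall>x\<in>vec V. f (smul V c x) = smul W c (f x))"

definition bilinear_on ::
  "('f::field, 'u::ab_group_add, 'x) vsp_scheme \<Rightarrow> ('f, 'v::ab_group_add, 'y) vsp_scheme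
    \<Rightarrow> ('f, 'w::ab_group_add, 'z) vsp_scheme \<Rightarrow> ('u \<Rightarrow> 'v \<Rightarrow> 'w) \<Rightarrow> bool" where
  "bilinear_on U V W b \<longleftrightarrow>
    (\<forall>x\<in>vec U. linear_on V W (b x)) \<and> (\<forall>y\<in>vec V. linear_on U W (\<lambda>x. b x y))"

text \<open>
  So that equality of functions is equality of linear maps, the elements of \<open>Hom V W\<close> are
  required to be zero outside \<open>V\<close>; \<open>extend0 V\<close> brings a map defined on \<open>V\<close> into this form.
\<close>

definition extend0 :: "('f, 'v, 'y) vsp_scheme \<Rightarrow> ('v \<Rightarrow> 'w::zero) \<Rightarrow> 'v \<Rightarrow> 'w" where
  "extend0 V f = (\<lambda>x. if x \<in> vec V then f x else 0)"

definition Hom ::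
  "('f::field, 'v::ab_group_add, 'y) vsp_scheme \<Rightarrow> ('f, 'w::ab_group_add, 'z) vsp_scheme
    \<Rightarrow> ('v \<Rightarrow> 'w) set" where
  "Hom V W = {f. linear_on V W f \<and> (\<forall>x. x \<notin> vec V \<longrightarrow> f x = 0)}"

abbreviation End :: "('f::field, 'v::ab_group_add, 'y) vsp_scheme \<Rightarrow> ('v \<Rightarrow> 'v) set" where
  "End V \<equiv> Hom V V"

definition dual :: "('f::field, 'v::ab_group_add, 'y) vsp_scheme \<Rightarrow> ('f, 'v \<Rightarrow> 'f) vsp" where
  "dual V = \<lparr>vec = Hom V ground, smul = fscale\<rparr>"

definition transpose :: "('f, 'v, 'y) vsp_scheme \<Rightarrow> ('v \<Rightarrow> 'w) \<Rightarrow> ('w \<Rightarrow> 'f::field) \<Rightarrow> 'v \<Rightarrow> 'f" where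
  "transpose V f g = extend0 V (\<lambda>x. g (f x))"

subsection \<open>Tensor powers\<close>

definition tuples :: "nat \<Rightarrow> ('f, 'v, 'y) vsp_scheme \<Rightarrow> 'v list set" where
  "tuples n V = {vs. length vs = n \<and> set vs \<subseteq> vec V}"

definition multilinear ::
  "nat \<Rightarrow> ('f::field, 'v::ab_group_add, 'y) vsp_scheme \<Rightarrow> ('f, 'w::ab_group_add, 'z) vsp_scheme
    \<Rightarrow> ('v list \<Rightarrow> 'w) \<Rightarrow> bool" where
  "multilinear n V W m \<longleftrightarrow>
    (\<forall>vs\<in>tuples n V. m vs \<in> vec W \<and> (\<forall>i<n. linear_on V W (\<lambda>x. m (vs[i := x]))))"

text \<open>
  The pure tensor of \<open>v\<^sub>1, \<dots>, v\<^sub>n\<close> is evaluation of \<open>n\<close>-linear forms at \<open>(v\<^sub>1, \<dots>, v\<^sub>n)\<close>, and the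
  \<open>n\<close>-th tensor power is the span of the pure tensors in the dual of the space of \<open>n\<close>-linear
  forms. Over a field this is a tensor power: see \<open>tensor_power_universal\<close> below. For \<open>n = 0\<close>
  it is one-dimensional with the empty tensor as basis, i.e. it is the ground field.
\<close>

type_synonym ('f, 'v) tensor = "('v list \<Rightarrow> 'f) \<Rightarrow> 'f"

definition pure ::
  "nat \<Rightarrow> ('f::field, 'v::ab_group_add, 'y) vsp_scheme \<Rightarrow> 'v list \<Rightarrow> ('f, 'v) tensor" where
  "pure n V vs = (\<lambda>m. if multilinear n V ground m then m vs else 0)"

definition tpow ::
  "nat \<Rightarrow> ('f::field, 'v::ab_group_add, 'y) vsp_scheme \<Rightarrow> ('f, ('f, 'v) tensor) vsp" where
  "tpow n V = \<lparr>vec = module.span fscale (pure n V ` tuples n V), smul = fscale\<rparr>"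

text \<open>The linear map on the tensor power corresponding to an \<open>n\<close>-linear map \<open>m\<close> into \<open>W\<close>.\<close>

definition tlift ::
  "nat \<Rightarrow> ('f::field, 'v::ab_group_add, 'y) vsp_scheme \<Rightarrow> ('f, 'w::ab_group_add, 'z) vsp_scheme
    \<Rightarrow> ('v list \<Rightarrow> 'w) \<Rightarrow> ('f, 'v) tensor \<Rightarrow> 'w" where
  "tlift n V W m = (THE f. f \<in> Hom (tpow n V) W \<and> (\<forall>vs\<in>tuples n V. f (pure n V vs) = m vs))"

lemma vector_space_fscale: "vector_space (fscale :: 'f::field \<Rightarrow> ('x \<Rightarrow> 'f) \<Rightarrow> 'x \<Rightarrow> 'f)"
  by unfold_locales (auto simp: fscale_def fun_eq_iff algebra_simps)

lemma vspace_tpow: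
  fixes V :: "('f::field, 'v::ab_group_add, 'y) vsp_scheme"
  shows "vspace (tpow n V)"
proof -
  interpret vector_space "fscale :: 'f \<Rightarrow> ('f, 'v) tensor \<Rightarrow> ('f, 'v) tensor"
    by (rule vector_space_fscale)
  show ?thesis
    by (simp add: vspace_def tpow_def vector_space_axioms)
qed

lemma pure_in_tpow:
  fixes V :: "('f::field, 'v::ab_group_add, 'y) vsp_scheme"
  shows "vs \<in> tuples n V \<Longrightarrow> pure n V vs \<in> vec (tpow n V)"
proof -
  interpret vector_space "fscale :: 'f \<Rightarrow> ('f, 'v) tensor \<Rightarrow> ('f, 'v) tensor"
    by (rule vector_space_fscale)
  show "vs \<in> tuples n V \<Longrightarrow> pure n V vs \<in> vec (tpow n V)"
    by (simp add: tpow_def span_base)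
qed

lemma multilinear_pure: "multilinear n V (tpow n V) (pure n V)"
  unfolding multilinear_def
proof (intro ballI conjI allI impI)
  fix vs i assume vs: "vs \<in> tuples n V" and i: "i < n"
  show "linear_on V (tpow n V) (\<lambda>x. pure n V (vs[i := x]))"
    unfolding linear_on_def
  proof (intro conjI ballI allI)
    fix x assume "x \<in> vec V"
    then have "vs[i := x] \<in> tuples n V"
      using vs set_update_subset_insert[of vs i x] unfolding tuples_def by auto
    then show "pure n V (vs[i := x]) \<in> vec (tpow n V)" by (rule pure_in_tpow)
  next
    fix x y assume "x \<in> vec V" "y \<in> vec V"
    then show "pure n V (vs[i := x + y]) = pure n V (vs[i := x]) + pure n V (vs[i := y])"
      using vs i by (auto simp: pure_def fun_eq_iff multilinear_def linear_on_def)
  next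
    fix c x assume "x \<in> vec V"
    then show "pure n V (vs[i := smul V c x]) = smul (tpow n V) c (pure n V (vs[i := x]))"
      using vs i
      by (auto simp: pure_def fun_eq_iff multilinear_def linear_on_def tpow_def fscale_def ground_def)
  qed
qed (rule pure_in_tpow)

text \<open>
  The universal property; it shows that \<open>tpow\<close> is the tensor power and that \<open>tlift\<close> is well
  defined.
\<close>

lemma tensor_power_universal:
  fixes V :: "('f::field, 'v::ab_group_add, 'y) vsp_scheme"
    and W :: "('f, 'w::ab_group_add, 'z) vsp_scheme"
  assumes V: "vspace V" and W: "vspace W" and m: "multilinear n V W m"
  shows "\<exists>!f. f \<in> Hom (tpow n V) W \<and> (\<forall>vs\<in>tuples n V. f (pure n V vs) = m vs)"
proof -
  interpret T: vector_space "fscale :: 'f \<Rightarrow> ('f, 'v) tensor \<Rightarrow> ('f, 'v) tensor"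
    by (rule vector_space_fscale)
  interpret W: vector_space "smul W" using W by (simp add: vspace_def)
  interpret WF: vector_space_pair "smul W" "(*) :: 'f \<Rightarrow> 'f \<Rightarrow> 'f"
    by unfold_locales (auto simp: algebra_simps)
  have Wsub: "W.subspace (vec W)" using W by (simp add: vspace_def)
  let ?lf = "Vector_Spaces.linear (smul W) ((*) :: 'f \<Rightarrow> 'f \<Rightarrow> 'f)"
  let ?S = "pure n V ` tuples n V"
  have sep: "x = y" if eq: "\<And>h. ?lf h \<Longrightarrow> h x = h y" for x y
  proof (rule ccontr)
    assume "x \<noteq> y"
    then have ind: "W.independent {x - y}" by simp
    let ?h = "WF.construct {x - y} (\<lambda>_. 1)"
    have lin: "?lf ?h" using ind by (rule WF.linear_construct)
    have "?h (x - y) = 1" using ind by (simp add: WF.construct_basis)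
    moreover have "?h (x - y) = ?h x - ?h y"
      using lin by (rule WF.linear_diff)
    ultimately show False using eq[OF lin] by simp
  qed
  have hm: "multilinear n V ground (\<lambda>vs. h (m vs))" if h: "?lf h" for h
  proof -
    interpret h: Vector_Spaces.linear "smul W" "(*) :: 'f \<Rightarrow> 'f \<Rightarrow> 'f" h by (rule h)
    show ?thesis
      using m by (auto simp: multilinear_def linear_on_def ground_def h.add h.scale)
  qed
  define P where "P t u \<longleftrightarrow> u \<in> vec W \<and> (\<forall>h. ?lf h \<longrightarrow> t (\<lambda>vs. h (m vs)) = h u)" for t u
  have P_unique: "u = u'" if "P t u" "P t u'" for t u u'
    using that by (intro sep) (auto simp: P_def)
  have P_pure: "P (pure n V vs) (m vs)" if "vs \<in> tuples n V" for vs
    using that m hm by (auto simp: P_def pure_def multilinear_def)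
  have P_add: "P (t + t') (u + u')" if "P t u" "P t' u'" for t t' u u'
    using that Wsub by (auto simp: P_def W.subspace_add WF.linear_add)
  have P_scale: "P (fscale c t) (smul W c u)" if "P t u" for c t u
    using that Wsub by (auto simp: P_def W.subspace_scale WF.linear_scale fscale_def)
  have P_zero: "P 0 0"
    using Wsub by (auto simp: P_def W.subspace_0 WF.linear_0)
  have ex: "\<exists>u. P t u" if "t \<in> T.span ?S" for t
    using that
  proof (induction rule: T.span_induct_alt)
    case base
    show ?case using P_zero by blast
  next
    case (step c x y)
    then obtain vs u where "x = pure n V vs" "vs \<in> tuples n V" "P y u" by auto
    then show ?case using P_add[OF P_scale[OF P_pure]] by blast
  qed
  define f where "f t = (if t \<in> T.span ?S then THE u. P t u else 0)" for t
  have fI: "f t = u" if "P t u" "t \<in> T.span ?S" for t u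
    using that P_unique by (auto simp: f_def)
  have fP: "P t (f t)" if "t \<in> T.span ?S" for t
    using ex[OF that] fI[OF _ that] by auto
  have f_hom: "f \<in> Hom (tpow n V) W"
    unfolding Hom_def linear_on_def mem_Collect_eq
  proof (intro conjI ballI allI impI)
    fix t assume t: "t \<in> vec (tpow n V)"
    then show "f t \<in> vec W" using fP by (auto simp: tpow_def P_def)
    show "f (smul (tpow n V) c t) = smul W c (f t)" for c
      using t fP by (auto simp: tpow_def intro!: fI P_scale T.span_scale)
    show "f (t + t') = f t + f t'" if "t' \<in> vec (tpow n V)" for t'
      using t that fP by (auto simp: tpow_def intro!: fI P_add T.span_add)
  qed (simp add: f_def tpow_def)
  have f_pure: "f (pure n V vs) = m vs" if "vs \<in> tuples n V" for vs
    using that by (intro fI P_pure T.span_base) auto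
  show ?thesis
  proof (rule ex1I[of _ f])
    fix g assume g: "g \<in> Hom (tpow n V) W \<and> (\<forall>vs\<in>tuples n V. g (pure n V vs) = m vs)"
    show "g = f"
    proof
      fix t
      show "g t = f t"
      proof (cases "t \<in> T.span ?S")
        case True
        have f_lin: "linear_on (tpow n V) W f" and g_lin: "linear_on (tpow n V) W g"
          using f_hom g by (auto simp: Hom_def)
        have z: "fscale 0 (0 :: ('f, 'v) tensor) = 0" by (simp add: fscale_def zero_fun_def)
        have "0 \<in> vec (tpow n V)" by (simp add: tpow_def T.span_zero)
        then have "g (smul (tpow n V) 0 0) = smul W 0 (g 0)" "f (smul (tpow n V) 0 0) = smul W 0 (f 0)"
          using f_lin g_lin unfolding linear_on_def by blast+
        then have base: "g 0 = f 0" by (simp add: tpow_def z)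
        have "T.span ?S \<subseteq> {x \<in> T.span ?S. g x = f x}"
        proof (rule T.span_minimal)
          show "?S \<subseteq> {x \<in> T.span ?S. g x = f x}"
            using g f_pure by (auto intro: T.span_base)
          show "T.subspace {x \<in> T.span ?S. g x = f x}"
            using f_lin g_lin base
            by (auto simp: linear_on_def tpow_def T.span_scale T.span_add T.span_zero
                intro!: T.subspaceI)
        qed
        with True show ?thesis by auto
      next
        case False
        then show ?thesis using f_hom g by (auto simp: Hom_def tpow_def)
      qed
    qed
  qed (use f_hom f_pure in auto)
qed

subsection \<open>Coalgebras and bialgebras\<close>

text \<open>
  Linear maps on a tensor product of two different spaces are written as bilinear maps. The
  comultiplication takes values in \<open>tpow 2 C\<close>.
\<close>

record ('f, 'v) coalg = "('f, 'v) vsp" +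
  comul :: "'v \<Rightarrow> ('f, 'v) tensor"
  counit :: "'v \<Rightarrow> 'f"

record ('f, 'v) bialg = "('f, 'v) coalg" +
  mul :: "'v \<Rightarrow> 'v \<Rightarrow> 'v"
  unity :: 'v

text \<open>
  Sweedler notation: \<open>sweedler C W b c\<close> is \<open>b(c\<^sub>(\<^sub>1\<^sub>), c\<^sub>(\<^sub>2\<^sub>))\<close> for a bilinear map
  \<open>b\<close> from \<open>C \<times> C\<close> to \<open>W\<close>.
\<close>

definition sweedler ::
  "('f::field, 'v::ab_group_add, 'y) coalg_scheme \<Rightarrow> ('f, 'w::ab_group_add, 'z) vsp_scheme
    \<Rightarrow> ('v \<Rightarrow> 'v \<Rightarrow> 'w) \<Rightarrow> 'v \<Rightarrow> 'w" where
  "sweedler C W b c = tlift 2 C W (\<lambda>xs. b (xs ! 0) (xs ! 1)) (comul C c)"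

text \<open>\<open>x \<otimes> t\<close> and \<open>t \<otimes> x\<close> for a vector \<open>x\<close> and a tensor \<open>t\<close> of degree \<open>n\<close>\<close>

definition tcons ::
  "nat \<Rightarrow> ('f::field, 'v::ab_group_add, 'y) vsp_scheme \<Rightarrow> 'v \<Rightarrow> ('f, 'v) tensor
    \<Rightarrow> ('f, 'v) tensor" where
  "tcons n V x = tlift n V (tpow (Suc n) V) (\<lambda>vs. pure (Suc n) V (x # vs))"

definition tsnoc ::
  "nat \<Rightarrow> ('f::field, 'v::ab_group_add, 'y) vsp_scheme \<Rightarrow> ('f, 'v) tensor \<Rightarrow> 'v
    \<Rightarrow> ('f, 'v) tensor" where
  "tsnoc n V t x = tlift n V (tpow (Suc n) V) (\<lambda>vs. pure (Suc n) V (vs @ [x])) t"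

definition coalgebra :: "('f::field, 'v::ab_group_add, 'y) coalg_scheme \<Rightarrow> bool" where
  "coalgebra C \<longleftrightarrow>
    vspace C \<and> linear_on C (tpow 2 C) (comul C) \<and> linear_on C ground (counit C) \<and>
    (\<forall>c\<in>vec C.
      sweedler C (tpow 3 C) (\<lambda>x y. tsnoc 2 C (comul C x) y) c =
        sweedler C (tpow 3 C) (\<lambda>x y. tcons 2 C x (comul C y)) c \<and>
      sweedler C C (\<lambda>x y. smul C (counit C x) y) c = c \<and>
      sweedler C C (\<lambda>x y. smul C (counit C y) x) c = c)"

definition coalgebra_hom ::
  "('f::field, 'v::ab_group_add, 'y) coalg_scheme \<Rightarrow> ('f, 'w::ab_group_add, 'z) coalg_scheme
    \<Rightarrow> ('v \<Rightarrow> 'w) \<Rightarrow> bool" where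
  "coalgebra_hom C D \<phi> \<longleftrightarrow>
    \<phi> \<in> Hom C D \<and>
    (\<forall>c\<in>vec C.
      comul D (\<phi> c) = sweedler C (tpow 2 D) (\<lambda>x y. pure 2 D [\<phi> x, \<phi> y]) c \<and>
      counit D (\<phi> c) = counit C c)"

definition bialgebra :: "('f::field, 'v::ab_group_add, 'y) bialg_scheme \<Rightarrow> bool" where
  "bialgebra B \<longleftrightarrow>
    coalgebra B \<and> bilinear_on B B B (mul B) \<and> unity B \<in> vec B \<and>
    (\<forall>x\<in>vec B. \<forall>y\<in>vec B. \<forall>z\<in>vec B. mul B (mul B x y) z = mul B x (mul B y z)) \<and>
    (\<forall>x\<in>vec B. mul B (unity B) x = x \<and> mul B x (unity B) = x) \<and>
    (\<forall>x\<in>vec B. \<forall>y\<in>vec B.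
      comul B (mul B x y) =
        sweedler B (tpow 2 B) (\<lambda>x1 x2.
          sweedler B (tpow 2 B) (\<lambda>y1 y2. pure 2 B [mul B x1 y1, mul B x2 y2]) y) x \<and>
      counit B (mul B x y) = counit B x * counit B y) \<and>
    comul B (unity B) = pure 2 B [unity B, unity B] \<and> counit B (unity B) = 1"

definition bialgebra_iso ::
  "('f::field, 'v::ab_group_add, 'y) bialg_scheme \<Rightarrow> ('f, 'w::ab_group_add, 'z) bialg_scheme
    \<Rightarrow> ('v \<Rightarrow> 'w) \<Rightarrow> bool" where
  "bialgebra_iso B C \<phi> \<longleftrightarrow>
    coalgebra_hom B C \<phi> \<and> bij_betw \<phi> (vec B) (vec C) \<and>
    (\<forall>x\<in>vec B. \<forall>y\<in>vec B. \<phi> (mul B x y) = mul C (\<phi> x) (\<phi> y)) \<and> \<phi> (unity B) = unity C"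

definition bialg_op :: "('f, 'v, 'y) bialg_scheme \<Rightarrow> ('f, 'v, 'y) bialg_scheme" where
  "bialg_op B = B\<lparr>mul := \<lambda>x y. mul B y x\<rparr>"

subsection \<open>Omega-algebras and their duals\<close>

definition omega_algebra ::
  "'o set \<Rightarrow> ('o \<Rightarrow> nat) \<Rightarrow> ('o \<Rightarrow> nat) \<Rightarrow> ('f::field, 'a::ab_group_add, 'y) vsp_scheme
    \<Rightarrow> ('o \<Rightarrow> ('f, 'a) tensor \<Rightarrow> ('f, 'a) tensor) \<Rightarrow> bool" where
  "omega_algebra \<Omega> s t A ops \<longleftrightarrow>
    vspace A \<and> (\<forall>\<omega>\<in>\<Omega>. linear_on (tpow (s \<omega>) A) (tpow (t \<omega>) A) (ops \<omega>))"

text \<open>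
  The identification of the \<open>n\<close>-th tensor power of \<open>A\<^sup>*\<close> with the dual of the \<open>n\<close>-th tensor
  power of \<open>A\<close>: \<open>f\<^sub>1 \<otimes> \<dots> \<otimes> f\<^sub>n\<close> sends \<open>a\<^sub>1 \<otimes> \<dots> \<otimes> a\<^sub>n\<close> to \<open>f\<^sub>1 a\<^sub>1 \<cdots> f\<^sub>n a\<^sub>n\<close>. It is bijective for
  finite-dimensional \<open>A\<close>.
\<close>

definition tpow_dual ::
  "nat \<Rightarrow> ('f::field, 'a::ab_group_add, 'y) vsp_scheme \<Rightarrow> ('f, 'a \<Rightarrow> 'f) tensor
    \<Rightarrow> ('f, 'a) tensor \<Rightarrow> 'f" where
  "tpow_dual n A = tlift n (dual A) (dual (tpow n A))
    (\<lambda>fs. tlift n A ground (\<lambda>as. \<Prod>i<n. (fs ! i) (as ! i)))"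

text \<open>
  The operations of the dual. The set \<open>\<Omega>\<^sup>*\<close> is indexed by \<open>\<Omega>\<close> itself (\<open>\<omega>\<^sup>*\<close> is written
  \<open>\<omega>\<close>), so that the dual is an algebra for \<open>\<Omega>\<close> with the two arity maps interchanged.
\<close>

definition dual_ops ::
  "('o \<Rightarrow> nat) \<Rightarrow> ('o \<Rightarrow> nat) \<Rightarrow> ('f::field, 'a::ab_group_add, 'y) vsp_scheme
    \<Rightarrow> ('o \<Rightarrow> ('f, 'a) tensor \<Rightarrow> ('f, 'a) tensor)
    \<Rightarrow> 'o \<Rightarrow> ('f, 'a \<Rightarrow> 'f) tensor \<Rightarrow> ('f, 'a \<Rightarrow> 'f) tensor" where
  "dual_ops s t A ops \<omega> u =
    the_inv_into (vec (tpow (s \<omega>) (dual A))) (tpow_dual (s \<omega>) A)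
      (transpose (tpow (s \<omega>) A) (ops \<omega>) (tpow_dual (t \<omega>) A u))"

definition to_bidual ::
  "('f::field, 'a::ab_group_add, 'y) vsp_scheme \<Rightarrow> 'a \<Rightarrow> ('a \<Rightarrow> 'f) \<Rightarrow> 'f" where
  "to_bidual A a = extend0 (dual A) (\<lambda>g. g a)"

text \<open>
  For an endomorphism \<open>f\<close> of \<open>A\<^sup>*\<close>, the dual operator of \<open>f\<close>, transported to \<open>A\<close> along
  \<open>to_bidual A\<close> (bijective for finite-dimensional \<open>A\<close>)
\<close>

definition dual_operator ::
  "('f::field, 'a::ab_group_add, 'y) vsp_scheme \<Rightarrow> (('a \<Rightarrow> 'f) \<Rightarrow> ('a \<Rightarrow> 'f)) \<Rightarrow> 'a \<Rightarrow> 'a" where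
  "dual_operator A f = extend0 A (\<lambda>a.
    the_inv_into (vec A) (to_bidual A) (transpose (dual A) f (to_bidual A a)))"

definition unital_subalgebra_End ::
  "('f::field, 'a::ab_group_add, 'y) vsp_scheme \<Rightarrow> ('a \<Rightarrow> 'a) set \<Rightarrow> bool" where
  "unital_subalgebra_End A V \<longleftrightarrow>
    V \<subseteq> End A \<and> extend0 A (\<lambda>x. x) \<in> V \<and>
    (\<forall>f\<in>V. \<forall>g\<in>V. f + g \<in> V \<and> f \<circ> g \<in> V) \<and>
    (\<forall>c. \<forall>f\<in>V. extend0 A (\<lambda>x. smul A c (f x)) \<in> V)"

subsection \<open>Measurings, actions and universal acting bialgebras\<close>

text \<open>The iterated comultiplication, with values in the \<open>n\<close>-th tensor power\<close>

fun iter_comul ::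
  "('f::field, 'p::ab_group_add, 'y) coalg_scheme \<Rightarrow> nat \<Rightarrow> 'p \<Rightarrow> ('f, 'p) tensor" where
  "iter_comul P 0 p = fscale (counit P p) (pure 0 P [])"
| "iter_comul P (Suc 0) p = pure 1 P [p]"
| "iter_comul P (Suc (Suc n)) p =
    sweedler P (tpow (Suc (Suc n)) P) (\<lambda>x y. tcons (Suc n) P x (iter_comul P (Suc n) y)) p"

definition tensor_action ::
  "('f::field, 'p::ab_group_add, 'y) coalg_scheme \<Rightarrow> ('f, 'a::ab_group_add, 'z) vsp_scheme
    \<Rightarrow> ('p \<Rightarrow> 'a \<Rightarrow> 'a) \<Rightarrow> nat \<Rightarrow> 'p \<Rightarrow> ('f, 'a) tensor \<Rightarrow> ('f, 'a) tensor" where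
  "tensor_action P A \<psi> n p x =
    (if n = 0 then fscale (counit P p) x
     else tlift n P (tpow n A)
       (\<lambda>ps. tlift n A (tpow n A) (\<lambda>as. pure n A (map2 \<psi> ps as)) x) (iter_comul P n p))"

definition measuring ::
  "'o set \<Rightarrow> ('o \<Rightarrow> nat) \<Rightarrow> ('o \<Rightarrow> nat) \<Rightarrow> ('f::field, 'p::ab_group_add, 'y) coalg_scheme
    \<Rightarrow> ('f, 'a::ab_group_add, 'z) vsp_scheme \<Rightarrow> ('o \<Rightarrow> ('f, 'a) tensor \<Rightarrow> ('f, 'a) tensor)
    \<Rightarrow> ('p \<Rightarrow> 'a \<Rightarrow> 'a) \<Rightarrow> bool" where
  "measuring \<Omega> s t P A ops \<psi> \<longleftrightarrow>
    coalgebra P \<and> bilinear_on P A A \<psi> \<and>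
    (\<forall>\<omega>\<in>\<Omega>. \<forall>p\<in>vec P. \<forall>x\<in>vec (tpow (s \<omega>) A).
      tensor_action P A \<psi> (t \<omega>) p (ops \<omega> x) = ops \<omega> (tensor_action P A \<psi> (s \<omega>) p x))"

definition cosupp ::
  "('f, 'p, 'y) vsp_scheme \<Rightarrow> ('f, 'a::zero, 'z) vsp_scheme \<Rightarrow> ('p \<Rightarrow> 'a \<Rightarrow> 'a)
    \<Rightarrow> ('a \<Rightarrow> 'a) set" where
  "cosupp P A \<psi> = (\<lambda>p. extend0 A (\<psi> p)) ` vec P"

definition action ::
  "'o set \<Rightarrow> ('o \<Rightarrow> nat) \<Rightarrow> ('o \<Rightarrow> nat) \<Rightarrow> ('f::field, 'p::ab_group_add, 'y) bialg_scheme
    \<Rightarrow> ('f, 'a::ab_group_add, 'z) vsp_scheme \<Rightarrow> ('o \<Rightarrow> ('f, 'a) tensor \<Rightarrow> ('f, 'a) tensor)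
    \<Rightarrow> ('p \<Rightarrow> 'a \<Rightarrow> 'a) \<Rightarrow> bool" where
  "action \<Omega> s t B A ops \<psi> \<longleftrightarrow>
    bialgebra B \<and> measuring \<Omega> s t B A ops \<psi> \<and>
    (\<forall>a\<in>vec A. \<psi> (unity B) a = a) \<and>
    (\<forall>x\<in>vec B. \<forall>y\<in>vec B. \<forall>a\<in>vec A. \<psi> (mul B x y) a = \<psi> x (\<psi> y a))"

text \<open>
  \<open>(B, \<psi>)\<close> is terminal among the measurings of \<open>A\<close> with cosupport in \<open>V\<close>, and \<open>B\<close> carries a
  bialgebra structure for which \<open>\<psi>\<close> is an action. Since one cannot quantify over types, the
  type \<open>'u\<close> plays the role of the universe that the coalgebras are taken from: the
  coalgebras \<open>P\<close> range over all coalgebra structures on linear subspaces of \<open>'u\<close>, for every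
  scalar multiplication on \<open>'u\<close>. Keeping \<open>'u\<close> a type variable covers arbitrarily large
  universes.
\<close>

definition universal_acting_bialgebra ::
  "'o set \<Rightarrow> ('o \<Rightarrow> nat) \<Rightarrow> ('o \<Rightarrow> nat) \<Rightarrow> ('f::field, 'a::ab_group_add, 'z) vsp_scheme
    \<Rightarrow> ('o \<Rightarrow> ('f, 'a) tensor \<Rightarrow> ('f, 'a) tensor) \<Rightarrow> ('a \<Rightarrow> 'a) set
    \<Rightarrow> ('f, 'u::ab_group_add) bialg \<Rightarrow> ('u \<Rightarrow> 'a \<Rightarrow> 'a) \<Rightarrow> bool" where
  "universal_acting_bialgebra \<Omega> s t A ops V B \<psi> \<longleftrightarrow>
    action \<Omega> s t B A ops \<psi> \<and> cosupp B A \<psi> \<subseteq> V \<and>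
    (\<forall>(P :: ('f, 'u) coalg) \<xi>. measuring \<Omega> s t P A ops \<xi> \<and> cosupp P A \<xi> \<subseteq> V \<longrightarrow>
      (\<exists>!\<phi>. coalgebra_hom P B \<phi> \<and> (\<forall>p\<in>vec P. \<forall>a\<in>vec A. \<psi> (\<phi> p) a = \<xi> p a)))"

end

theory Submission
  imports Defs
begin

text \<open>
  Dualising \<open>\<psi> : P \<otimes> A \<rightarrow> A\<close> to \<open>\<chi> : P \<otimes> A\<^sup>* \<rightarrow> A\<^sup>*\<close> with \<open>\<chi>(p \<otimes> g)(a) = g(\<psi>(p \<otimes> a))\<close> is
  compatible with tensor powers, so for a finite-dimensional \<open>A\<close> the same coalgebras measure \<open>A\<close> and
  \<open>A\<^sup>*\<close>, with cosupports corresponding under \<open>f \<mapsto> f\<^sup>*\<close>. The two universal measurings are therefore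
  isomorphic as coalgebras. Dualising reverses composition of operators, so \<open>\<phi>(x y)\<close> and
  \<open>\<phi>(y) \<phi>(x)\<close> act in the same way on \<open>A\<close>. Their differences span a coideal that acts as zero, and
  the universal coalgebra has no nonzero coideal of this kind.
\<close>

text \<open>Transposition acts on each tensor factor separately and leaves the iterated
  comultiplication of \<open>P\<close> alone, which is why only the multiplication is reversed and
  no co-opposite appears. The inverses hidden in \<open>dual_ops\<close> and
  \<open>dual_operator\<close> are replaced by adjunction identities, and equations are tested by
  pairing. Finite dimension enters only through a finite coordinate system, which makes the pairings
  perfect.

  The universal property says nothing about products, and it can be tested only on coalgebras
  carried by subspaces of \<open>'u\<close>. The direct way to compare x \<otimes> y \<mapsto>
  \<phi>(x y) with x \<otimes> y \<mapsto> \<phi>(y) \<phi>(x) would be uniqueness for a measuring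
  by \<open>B \<otimes> B\<close>, but its carrier is another type and may be too large for
  \<open>'u\<close>. A quotient of \<open>B'\<close>, in contrast, has a copy inside
  \<open>B'\<close>, namely a complement of the coideal. Therefore the failure of \<phi> to be an
  antihomomorphism is collected in a coideal and divided out.\<close>

lemma vec_ground [simp]: "vec ground = UNIV" and smul_ground [simp]: "smul ground = (*)"
  by (simp_all add: ground_def)

lemma vec_dual: "vec (dual V) = Hom V ground" and smul_dual [simp]: "smul (dual V) = fscale"
  by (simp_all add: dual_def)

lemma smul_tpow [simp]: "smul (tpow n V) = fscale"
  by (simp add: tpow_def)

lemma vspace_closed:
  assumes "vspace V"
  shows "0 \<in> vec V"
    and "x \<in> vec V \<Longrightarrow> y \<in> vec V \<Longrightarrow> x + y \<in> vec V"
    and "x \<in> vec V \<Longrightarrow> y \<in> vec V \<Longrightarrow> x - y \<in> vec V"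
    and "x \<in> vec V \<Longrightarrow> smul V c x \<in> vec V"
    and "(\<And>i. i \<in> I \<Longrightarrow> g i \<in> vec V) \<Longrightarrow> sum g I \<in> vec V"
proof -
  interpret vector_space "smul V" using assms by (simp add: vspace_def)
  have "subspace (vec V)" using assms by (simp add: vspace_def)
  then show "0 \<in> vec V"
    and "x \<in> vec V \<Longrightarrow> y \<in> vec V \<Longrightarrow> x + y \<in> vec V"
    and "x \<in> vec V \<Longrightarrow> y \<in> vec V \<Longrightarrow> x - y \<in> vec V"
    and "x \<in> vec V \<Longrightarrow> smul V c x \<in> vec V"
    and "(\<And>i. i \<in> I \<Longrightarrow> g i \<in> vec V) \<Longrightarrow> sum g I \<in> vec V"
    by (auto intro: subspace_0 subspace_add subspace_diff subspace_scale subspace_sum)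
qed

lemma vspace_smul:
  assumes "vspace V"
  shows "smul V 0 x = 0" and "smul V c 0 = 0" and "smul V 1 x = x"
    and "smul V c (x + y) = smul V c x + smul V c y"
    and "smul V (a + b) x = smul V a x + smul V b x"
    and "smul V a (smul V b x) = smul V (a * b) x"
    and "smul V c (sum g I) = (\<Sum>i\<in>I. smul V c (g i))"
    and "smul V (sum h I) x = (\<Sum>i\<in>I. smul V (h i) x)"
proof -
  interpret vector_space "smul V" using assms by (simp add: vspace_def)
  show "smul V 0 x = 0" and "smul V c 0 = 0" and "smul V 1 x = x"
    and "smul V c (x + y) = smul V c x + smul V c y"
    and "smul V (a + b) x = smul V a x + smul V b x"
    and "smul V a (smul V b x) = smul V (a * b) x"
    and "smul V c (sum g I) = (\<Sum>i\<in>I. smul V c (g i))"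
    and "smul V (sum h I) x = (\<Sum>i\<in>I. smul V (h i) x)"
    by (auto simp: scale_right_distrib scale_left_distrib scale_sum_right scale_sum_left)
qed

lemma vspace_ground: "vspace (ground :: ('f::field, 'f) vsp)"
proof -
  interpret vector_space "(*) :: 'f \<Rightarrow> 'f \<Rightarrow> 'f"
    by unfold_locales (auto simp: algebra_simps)
  show ?thesis by (simp add: vspace_def vector_space_axioms)
qed

section \<open>Linear maps between carriers, and dual spaces\<close>

lemma linear_onD:
  assumes "linear_on V W f"
  shows "x \<in> vec V \<Longrightarrow> f x \<in> vec W"
    and "x \<in> vec V \<Longrightarrow> y \<in> vec V \<Longrightarrow> f (x + y) = f x + f y"
    and "x \<in> vec V \<Longrightarrow> f (smul V c x) = smul W c (f x)"
  using assms by (auto simp: linear_on_def)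

lemma linear_onI:
  assumes "\<And>x. x \<in> vec V \<Longrightarrow> f x \<in> vec W"
    and "\<And>x y. x \<in> vec V \<Longrightarrow> y \<in> vec V \<Longrightarrow> f (x + y) = f x + f y"
    and "\<And>c x. x \<in> vec V \<Longrightarrow> f (smul V c x) = smul W c (f x)"
  shows "linear_on V W f"
  using assms by (auto simp: linear_on_def)

lemma linear_on_0:
  assumes "linear_on V W f" "vspace V"
  shows "f 0 = 0"
proof -
  have "f (0 + 0) = f 0 + f 0" using assms vspace_closed(1) by (intro linear_onD(2))
  then show ?thesis by simp
qed

lemma linear_on_diff:
  assumes "linear_on V W f" "vspace V" "x \<in> vec V" "y \<in> vec V"
  shows "f (x - y) = f x - f y"
proof -
  have "f (x - y + y) = f (x - y) + f y"
    by (rule linear_onD(2)[OF assms(1) vspace_closed(3)[OF assms(2-4)] assms(4)])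
  then show ?thesis by (simp add: algebra_simps)
qed

lemma linear_on_sum:
  assumes "linear_on V W f" "vspace V" "\<And>i. i \<in> I \<Longrightarrow> g i \<in> vec V"
  shows "f (sum g I) = (\<Sum>i\<in>I. f (g i))"
  using assms(3)
proof (induction I rule: infinite_finite_induct)
  case (insert i I)
  then have "f (g i + sum g I) = f (g i) + f (sum g I)"
    using vspace_closed(5)[OF assms(2), of I g] by (intro linear_onD(2)[OF assms(1)]) auto
  with insert show ?case by simp
qed (use assms linear_on_0 in auto)

lemma linear_on_comp:
  "linear_on U V f \<Longrightarrow> linear_on V W g \<Longrightarrow> linear_on U W (\<lambda>x. g (f x))"
  by (auto simp: linear_on_def)

lemma linear_on_id: "linear_on V V (\<lambda>x. x)"
  by (simp add: linear_on_def)

lemma linear_on_cong: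
  assumes "vspace V" "\<And>x. x \<in> vec V \<Longrightarrow> f x = g x"
  shows "linear_on V W f \<longleftrightarrow> linear_on V W g"
  using assms vspace_closed[OF assms(1)] by (auto simp: linear_on_def)

lemma linear_on_extend0:
  assumes "vspace V"
  shows "linear_on V W (extend0 V f) \<longleftrightarrow> linear_on V W f"
  using assms by (intro linear_on_cong) (auto simp: extend0_def)

lemma HomD: "f \<in> Hom V W \<Longrightarrow> linear_on V W f" "f \<in> Hom V W \<Longrightarrow> x \<notin> vec V \<Longrightarrow> f x = 0"
  by (auto simp: Hom_def)

lemma extend0_Hom: "vspace V \<Longrightarrow> linear_on V W f \<Longrightarrow> extend0 V f \<in> Hom V W"
  by (simp add: Hom_def linear_on_extend0) (simp add: extend0_def)

lemma Hom_eqI: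
  assumes "f \<in> Hom V W" "g \<in> Hom V W" "\<And>x. x \<in> vec V \<Longrightarrow> f x = g x"
  shows "f = g"
proof
  fix x show "f x = g x" using assms by (cases "x \<in> vec V") (auto simp: Hom_def)
qed

lemma vspace_dual:
  fixes V :: "('f::field, 'v::ab_group_add, 'y) vsp_scheme"
  assumes "vspace V"
  shows "vspace (dual V)"
proof -
  interpret vector_space "fscale :: 'f \<Rightarrow> ('v \<Rightarrow> 'f) \<Rightarrow> 'v \<Rightarrow> 'f"
    by (rule vector_space_fscale)
  have "subspace (vec (dual V))"
    by (rule subspaceI)
      (auto simp: vec_dual Hom_def linear_on_def fscale_def algebra_simps)
  then show ?thesis by (simp add: vspace_def vector_space_axioms)
qed

lemma bilinear_onD:
  assumes "bilinear_on U V W b"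
  shows "x \<in> vec U \<Longrightarrow> linear_on V W (b x)" "y \<in> vec V \<Longrightarrow> linear_on U W (\<lambda>x. b x y)"
    and "x \<in> vec U \<Longrightarrow> y \<in> vec V \<Longrightarrow> b x y \<in> vec W"
  using assms by (auto simp: bilinear_on_def linear_on_def)

lemma bilinear_on_comp:
  assumes "bilinear_on U V W b" "linear_on U' U f" "linear_on V' V g"
  shows "bilinear_on U' V' W (\<lambda>x y. b (f x) (g y))"
  unfolding bilinear_on_def
proof (intro conjI ballI)
  show "linear_on V' W (\<lambda>y. b (f x) (g y))" if "x \<in> vec U'" for x
    using bilinear_onD(1)[OF assms(1) linear_onD(1)[OF assms(2) that]]
    by (rule linear_on_comp[OF assms(3)])
  show "linear_on U' W (\<lambda>x. b (f x) (g y))" if "y \<in> vec V'" for y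
    using bilinear_onD(2)[OF assms(1) linear_onD(1)[OF assms(3) that]]
    by (rule linear_on_comp[OF assms(2)])
qed

subsection \<open>Multilinear maps\<close>

lemma tuples_Suc: "vs \<in> tuples (Suc n) V \<longleftrightarrow> (\<exists>v ws. vs = v # ws \<and> v \<in> vec V \<and> ws \<in> tuples n V)"
  by (cases vs) (auto simp: tuples_def)

lemma tuples_0 [simp]: "tuples 0 V = {[]}"
  by (auto simp: tuples_def)

lemma tuples_2: "vs \<in> tuples 2 V \<longleftrightarrow> (\<exists>x\<in>vec V. \<exists>y\<in>vec V. vs = [x, y])"
  by (auto simp: numeral_2_eq_2 tuples_Suc)

lemma tuples_nth: "vs \<in> tuples n V \<Longrightarrow> i < n \<Longrightarrow> vs ! i \<in> vec V"
  by (auto simp: tuples_def)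

lemma tuples_update: "vs \<in> tuples n V \<Longrightarrow> x \<in> vec V \<Longrightarrow> vs[i := x] \<in> tuples n V"
  using set_update_subset_insert[of vs i x] by (auto simp: tuples_def)

lemma tuples_length: "vs \<in> tuples n V \<Longrightarrow> length vs = n"
  by (simp add: tuples_def)

lemma tuples_map:
  "vs \<in> tuples n V \<Longrightarrow> (\<And>x. x \<in> vec V \<Longrightarrow> f x \<in> vec W) \<Longrightarrow> map f vs \<in> tuples n W"
  by (auto simp: tuples_def)

lemma tuples_map2:
  assumes "ps \<in> tuples n P" "as \<in> tuples n A" "\<And>p a. p \<in> vec P \<Longrightarrow> a \<in> vec A \<Longrightarrow> b p a \<in> vec W"
  shows "map2 b ps as \<in> tuples n W"
  using assms by (auto simp: tuples_def set_zip intro!: assms(3))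

lemma multilinearD:
  assumes "multilinear n V W m" "vs \<in> tuples n V"
  shows "m vs \<in> vec W" "i < n \<Longrightarrow> linear_on V W (\<lambda>x. m (vs[i := x]))"
  using assms by (auto simp: multilinear_def)

lemma multilinearI:
  assumes "\<And>vs. vs \<in> tuples n V \<Longrightarrow> m vs \<in> vec W"
    and "\<And>vs i. vs \<in> tuples n V \<Longrightarrow> i < n \<Longrightarrow> linear_on V W (\<lambda>x. m (vs[i := x]))"
  shows "multilinear n V W m"
  using assms by (auto simp: multilinear_def)

lemma linear_multilinear:
  assumes "multilinear n U V m" "linear_on V W h"
  shows "multilinear n U W (\<lambda>us. h (m us))"
  using assms linear_on_comp[of U V _ W h] linear_onD(1)[of V W h]
  by (auto simp: multilinear_def)

lemma multilinear_Cons: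
  assumes m: "multilinear (Suc n) V W m"
  shows "v \<in> vec V \<Longrightarrow> multilinear n V W (\<lambda>vs. m (v # vs))"
    and "vs \<in> tuples n V \<Longrightarrow> linear_on V W (\<lambda>x. m (x # vs))"
proof -
  assume v: "v \<in> vec V"
  have "linear_on V W (\<lambda>x. m (v # vs[i := x]))" if "vs \<in> tuples n V" "i < n" for vs i
    using multilinearD(2)[OF m, of "v # vs" "Suc i"] v that by (simp add: tuples_Suc)
  moreover have "m (v # vs) \<in> vec W" if "vs \<in> tuples n V" for vs
    using multilinearD(1)[OF m, of "v # vs"] v that by (simp add: tuples_Suc)
  ultimately show "multilinear n V W (\<lambda>vs. m (v # vs))" by (intro multilinearI)
next
  assume vs: "vs \<in> tuples n V"
  show "linear_on V W (\<lambda>x. m (x # vs))"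
  \<comment> \<open>The carrier may be empty here. A vector \<open>v\<close> serves to form a full
    tuple whose position 0 can be updated; without one, linearity is vacuous.\<close>
  proof (cases "\<exists>v. v \<in> vec V")
    case True
    then obtain v where "v \<in> vec V" ..
    with vs show ?thesis using multilinearD(2)[OF m, of "v # vs" 0] by (simp add: tuples_Suc)
  qed (auto simp: linear_on_def)
qed

lemma multilinear_snoc:
  assumes m: "multilinear (Suc n) V W m"
  shows "v \<in> vec V \<Longrightarrow> multilinear n V W (\<lambda>vs. m (vs @ [v]))"
    and "vs \<in> tuples n V \<Longrightarrow> linear_on V W (\<lambda>x. m (vs @ [x]))"
proof -
  have tup: "vs @ [v] \<in> tuples (Suc n) V" if "vs \<in> tuples n V" "v \<in> vec V" for vs v
    using that by (auto simp: tuples_def)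
  {
    assume v: "v \<in> vec V"
    have "linear_on V W (\<lambda>x. m (vs[i := x] @ [v]))" if "vs \<in> tuples n V" "i < n" for vs i
      using multilinearD(2)[OF m tup[OF that(1) v], of i] that
      by (simp add: tuples_def list_update_append)
    then show "multilinear n V W (\<lambda>vs. m (vs @ [v]))"
      using multilinearD(1)[OF m tup] v by (intro multilinearI)
  }
  assume vs: "vs \<in> tuples n V"
  show "linear_on V W (\<lambda>x. m (vs @ [x]))"
  proof (cases "\<exists>v. v \<in> vec V")
    case True
    then obtain v where "v \<in> vec V" ..
    with vs show ?thesis using multilinearD(2)[OF m tup, of vs v n]
      by (auto simp: tuples_def)
  qed (auto simp: linear_on_def)
qed

lemma multilinear_map:
  assumes "multilinear n D W m" "linear_on C D f"
  shows "multilinear n C W (\<lambda>vs. m (map f vs))"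
proof (rule multilinearI)
  fix vs assume "vs \<in> tuples n C"
  then have vs: "map f vs \<in> tuples n D" using assms(2) by (auto intro!: tuples_map simp: linear_on_def)
  with assms(1) show "m (map f vs) \<in> vec W" by (rule multilinearD)
  fix i assume "i < n"
  then show "linear_on C W (\<lambda>x. m (map f (vs[i := x])))"
    using linear_on_comp[OF assms(2) multilinearD(2)[OF assms(1) vs]] by (simp add: map_update)
qed

lemma map2_update:
  "map2 b (xs[i := x]) ys = (map2 b xs ys)[i := b x (ys ! i)]"
  "map2 b xs (ys[i := y]) = (map2 b xs ys)[i := b (xs ! i) y]"
proof -
  show "map2 b (xs[i := x]) ys = (map2 b xs ys)[i := b x (ys ! i)]"
    by (rule nth_equalityI; simp; cases "i < length xs"; auto simp: nth_list_update)
  show "map2 b xs (ys[i := y]) = (map2 b xs ys)[i := b (xs ! i) y]"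
    by (rule nth_equalityI; simp; cases "i < length ys"; auto simp: nth_list_update)
qed

text \<open>With \<open>m\<close> the map \<open>pure n W\<close>, this is the integrand of
  \<open>tensor_action\<close>: letting the i-th element of \<open>P\<close> act on the i-th vector
  is multilinear in either list while the other is fixed.\<close>

lemma multilinear_map2:
  assumes b: "bilinear_on P A W b" and m: "multilinear n W X m"
  shows "as \<in> tuples n A \<Longrightarrow> multilinear n P X (\<lambda>ps. m (map2 b ps as))"
    and "ps \<in> tuples n P \<Longrightarrow> multilinear n A X (\<lambda>as. m (map2 b ps as))"
proof -
  have tup: "map2 b ps as \<in> tuples n W" if "ps \<in> tuples n P" "as \<in> tuples n A" for ps as
    using that bilinear_onD(3)[OF b] by (rule tuples_map2)
  {
    assume "as \<in> tuples n A"
    then show "multilinear n P X (\<lambda>ps. m (map2 b ps as))"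
      using linear_on_comp[OF bilinear_onD(2)[OF b] multilinearD(2)[OF m tup]] multilinearD(1)[OF m tup]
      by (intro multilinearI) (simp_all add: map2_update tuples_nth)
  }
  assume "ps \<in> tuples n P"
  then show "multilinear n A X (\<lambda>as. m (map2 b ps as))"
    using linear_on_comp[OF bilinear_onD(1)[OF b] multilinearD(2)[OF m tup]] multilinearD(1)[OF m tup]
    by (intro multilinearI) (simp_all add: map2_update tuples_nth)
qed

lemma multilinear_prod:
  assumes "\<And>i. i < n \<Longrightarrow> linear_on V ground (f i)"
  shows "multilinear n V ground (\<lambda>vs. \<Prod>i<n. f i (vs ! i))"
proof (rule multilinearI)
  fix vs i assume vs: "vs \<in> tuples n V" and i: "i < n"
  have "(\<Prod>j<n. f j (vs[i := x] ! j)) = f i x * (\<Prod>j\<in>{..<n} - {i}. f j (vs ! j))" for x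
    using i vs by (subst prod.remove[of _ i]) (auto simp: tuples_def)
  then show "linear_on V ground (\<lambda>x. \<Prod>j<n. f j (vs[i := x] ! j))"
    using assms[OF i] by (simp add: linear_on_def algebra_simps)
qed simp

lemma bilinear_multilinear:
  assumes "bilinear_on V V W b"
  shows "multilinear 2 V W (\<lambda>xs. b (xs ! 0) (xs ! 1))"
proof (rule multilinearI)
  fix vs i assume "vs \<in> tuples 2 V" "i < (2::nat)"
  moreover from this have "i = 0 \<or> i = 1" by auto
  ultimately show "linear_on V W (\<lambda>x. b (vs[i := x] ! 0) (vs[i := x] ! 1))"
    using assms by (auto simp: tuples_2 bilinear_on_def)
qed (use assms in \<open>auto simp: tuples_2 bilinear_on_def linear_on_def\<close>)

lemma bilinear_pure:
  assumes "vspace W"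
  shows "bilinear_on W W (tpow 2 W) (\<lambda>x y. pure 2 W [x, y])"
  unfolding bilinear_on_def
proof (intro conjI ballI)
  have *: "multilinear (Suc 1) W (tpow 2 W) (pure 2 W)" "multilinear (Suc 1) W (tpow 2 W) (pure 2 W)"
    using multilinear_pure[of 2 W] by (simp_all add: numeral_2_eq_2)
  fix x assume x: "x \<in> vec W"
  show "linear_on W (tpow 2 W) (\<lambda>y. pure 2 W [x, y])"
    using multilinear_snoc(2)[OF *(1), of "[x]"] x by (simp add: tuples_def)
  show "linear_on W (tpow 2 W) (\<lambda>y. pure 2 W [y, x])"
    using multilinear_Cons(2)[OF *(1), of "[x]"] x by (simp add: tuples_def)
qed

text \<open>Expand one argument after another in the family \<open>e\<close>. Indexing by an
  abstract set \<open>K\<close> with coefficients \<open>co\<close> lets one statement serve twice: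
  for \<open>A\<close> with its basis, and for \<open>dual A\<close> with the coordinate functionals
  as family and evaluation at basis vectors as coefficients.\<close>

lemma multilinear_expand:
  assumes V: "vspace V" and W: "vspace W" and K: "finite K" "\<And>k. k \<in> K \<Longrightarrow> e k \<in> vec V"
    and co: "\<And>v. v \<in> vec V \<Longrightarrow> v = (\<Sum>k\<in>K. smul V (co k v) (e k))"
    and "multilinear n V W m" "vs \<in> tuples n V"
  shows "m vs = (\<Sum>ks | set ks \<subseteq> K \<and> length ks = n.
    smul W (\<Prod>i<n. co (ks ! i) (vs ! i)) (m (map e ks)))"
  using assms(6,7)
proof (induction n arbitrary: m vs)
  case 0
  have "{ks. set ks \<subseteq> K \<and> length ks = 0} = {[]}" by auto
  with 0 W show ?case by (simp add: vspace_smul)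
next
  case (Suc n)
  then obtain v ws where vs: "vs = v # ws" "v \<in> vec V" "ws \<in> tuples n V"
    by (auto simp: tuples_Suc)
  let ?L = "\<lambda>n. {ks. set ks \<subseteq> K \<and> length ks = n}"
  have lin: "linear_on V W (\<lambda>x. m (x # ws))" using Suc.prems vs by (intro multilinear_Cons)
  have "m vs = m ((\<Sum>k\<in>K. smul V (co k v) (e k)) # ws)"
    using co[OF vs(2)] vs(1) by simp
  also have "\<dots> = (\<Sum>k\<in>K. smul W (co k v) (m (e k # ws)))"
    using V K linear_onD(3)[OF lin]
    by (subst linear_on_sum[OF lin]) (auto intro!: vspace_closed sum.cong)
  also have "\<dots> = (\<Sum>k\<in>K. \<Sum>ks\<in>?L n.
      smul W (co k v * (\<Prod>i<n. co (ks ! i) (ws ! i))) (m (e k # map e ks)))"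
  proof (rule sum.cong)
    fix k assume "k \<in> K"
    then have "m (e k # ws) = (\<Sum>ks\<in>?L n. smul W (\<Prod>i<n. co (ks ! i) (ws ! i)) (m (e k # map e ks)))"
      using Suc.prems vs K by (intro Suc.IH multilinear_Cons) auto
    then show "smul W (co k v) (m (e k # ws)) = (\<Sum>ks\<in>?L n.
      smul W (co k v * (\<Prod>i<n. co (ks ! i) (ws ! i))) (m (e k # map e ks)))"
      using W by (simp add: vspace_smul)
  qed simp
  also have "\<dots> = (\<Sum>(k, ks)\<in>K \<times> ?L n.
      smul W (co k v * (\<Prod>i<n. co (ks ! i) (ws ! i))) (m (e k # map e ks)))"
    using K by (simp add: sum.cartesian_product)
  \<comment> \<open>An index word of length \<open>Suc n\<close> is split into its head, coming from
    the first argument, and its tail, coming from the induction hypothesis.\<close>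
  also have "\<dots> = (\<Sum>ks\<in>?L (Suc n). smul W (\<Prod>i<Suc n. co (ks ! i) (vs ! i)) (m (map e ks)))"
  proof (rule sum.reindex_bij_witness[where i = "\<lambda>ks. (hd ks, tl ks)" and j = "\<lambda>(k, ks). k # ks"])
    fix ks assume "ks \<in> ?L (Suc n)"
    then show "(hd ks, tl ks) \<in> K \<times> ?L n" by (cases ks) auto
  next
    fix a assume "a \<in> K \<times> ?L n"
    then show "smul W (\<Prod>i<Suc n. co ((case a of (k, ks) \<Rightarrow> k # ks) ! i) (vs ! i))
        (m (map e (case a of (k, ks) \<Rightarrow> k # ks))) =
      (case a of (k, ks) \<Rightarrow> smul W (co k v * (\<Prod>i<n. co (ks ! i) (ws ! i))) (m (e k # map e ks)))"
      by (auto simp: vs(1) prod.lessThan_Suc_shift simp del: prod.lessThan_Suc)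
  next
    fix ks assume "ks \<in> ?L (Suc n)"
    then show "(case (hd ks, tl ks) of (k, ks) \<Rightarrow> k # ks) = ks" by (cases ks) auto
  qed auto
  finally show ?case .
qed

subsection \<open>Linear maps on tensor powers\<close>

lemma tlift_spec:
  assumes "vspace V" "vspace W" "multilinear n V W m"
  shows "tlift n V W m \<in> Hom (tpow n V) W \<and> (\<forall>vs\<in>tuples n V. tlift n V W m (pure n V vs) = m vs)"
  unfolding tlift_def using tensor_power_universal[OF assms] by (rule theI')

lemma tlift_Hom:
  "vspace V \<Longrightarrow> vspace W \<Longrightarrow> multilinear n V W m \<Longrightarrow> tlift n V W m \<in> Hom (tpow n V) W"
  using tlift_spec by blast

lemma tlift_linear:
  "vspace V \<Longrightarrow> vspace W \<Longrightarrow> multilinear n V W m \<Longrightarrow> linear_on (tpow n V) W (tlift n V W m)"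
  by (rule HomD(1)[OF tlift_Hom])

lemma tlift_pure:
  "vspace V \<Longrightarrow> vspace W \<Longrightarrow> multilinear n V W m \<Longrightarrow> vs \<in> tuples n V \<Longrightarrow>
    tlift n V W m (pure n V vs) = m vs"
  using tlift_spec by blast

lemma tlift_cong:
  assumes "\<And>vs. vs \<in> tuples n V \<Longrightarrow> m vs = m' vs"
  shows "tlift n V W m = tlift n V W m'"
  using assms by (simp add: tlift_def cong: ball_cong)

text \<open>Span induction with membership in the tensor power carried along, so that linearity,
  which is available only on the carrier, can be applied to the remainder \<open>T\<close>.\<close>

lemma tpow_induct [consumes 1, case_names zero step]:
  fixes V :: "('f::field, 'v::ab_group_add, 'y) vsp_scheme"
  assumes "T \<in> vec (tpow n V)" and "Q 0"
    and "\<And>c vs T. vs \<in> tuples n V \<Longrightarrow> T \<in> vec (tpow n V) \<Longrightarrow> Q T \<Longrightarrow> Q (fscale c (pure n V vs) + T)"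
  shows "Q T"
proof -
  interpret vector_space "fscale :: 'f \<Rightarrow> ('f, 'v) tensor \<Rightarrow> ('f, 'v) tensor"
    by (rule vector_space_fscale)
  have "T \<in> span (pure n V ` tuples n V)" using assms(1) by (simp add: tpow_def)
  then have "T \<in> vec (tpow n V) \<and> Q T"
  proof (induction rule: span_induct_alt)
    case base
    show ?case using assms(2) vspace_closed(1)[OF vspace_tpow] by blast
  next
    case (step c x y)
    then obtain vs where vs: "x = pure n V vs" "vs \<in> tuples n V" by blast
    then have "fscale c x \<in> vec (tpow n V)"
      using vspace_closed(4)[OF vspace_tpow pure_in_tpow] by fastforce
    then have "fscale c x + y \<in> vec (tpow n V)"
      using step by (intro vspace_closed(2)[OF vspace_tpow]) blast+
    then show ?case using assms(3) step vs by blast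
  qed
  then show ?thesis ..
qed

text \<open>Pure tensors span. This is the standard way below to establish an identity between
  tensors: check that both sides are linear, then evaluate on pure tensors.\<close>

lemma tensor_ext:
  assumes "linear_on (tpow n V) W f" "linear_on (tpow n V) W g"
    and "\<And>vs. vs \<in> tuples n V \<Longrightarrow> f (pure n V vs) = g (pure n V vs)"
    and "T \<in> vec (tpow n V)"
  shows "f T = g T"
  using assms(4)
proof (induction rule: tpow_induct)
  case zero
  show ?case using linear_on_0[OF assms(1) vspace_tpow] linear_on_0[OF assms(2) vspace_tpow] by metis
next
  case (step c vs T)
  have "h (fscale c (pure n V vs) + T) = smul W c (h (pure n V vs)) + h T"
    if "linear_on (tpow n V) W h" for h
  proof -
    have p: "pure n V vs \<in> vec (tpow n V)" using step by (intro pure_in_tpow)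
    then have "fscale c (pure n V vs) \<in> vec (tpow n V)"
      using vspace_closed(4)[OF vspace_tpow p] by simp
    then show ?thesis using linear_onD(2)[OF that _ step(2)] linear_onD(3)[OF that p] by simp
  qed
  then show ?case using assms(1-3) step by metis
qed

lemma linear_tlift:
  assumes "vspace V" "vspace W" "vspace X" "multilinear n V W m" "linear_on W X h"
    and "T \<in> vec (tpow n V)"
  shows "h (tlift n V W m T) = tlift n V X (\<lambda>vs. h (m vs)) T"
proof (rule tensor_ext[of n V X "\<lambda>T. h (tlift n V W m T)"])
  have m': "multilinear n V X (\<lambda>vs. h (m vs))" by (rule linear_multilinear[OF assms(4,5)])
  show "linear_on (tpow n V) X (\<lambda>T. h (tlift n V W m T))"
    using assms(1-5) by (auto intro: linear_on_comp[OF tlift_linear])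
  show "linear_on (tpow n V) X (tlift n V X (\<lambda>vs. h (m vs)))"
    using assms m' by (intro tlift_linear)
  show "h (tlift n V W m (pure n V vs)) = tlift n V X (\<lambda>vs. h (m vs)) (pure n V vs)"
    if "vs \<in> tuples n V" for vs
    using assms m' that by (simp add: tlift_pure)
qed fact

lemma tlift_pure_id:
  assumes "vspace V" "T \<in> vec (tpow n V)"
  shows "tlift n V (tpow n V) (pure n V) T = T"
proof (rule tensor_ext[OF _ _ _ assms(2)])
  show "linear_on (tpow n V) (tpow n V) (tlift n V (tpow n V) (pure n V))"
    by (rule tlift_linear[OF assms(1) vspace_tpow multilinear_pure])
qed (use tlift_pure[OF assms(1) vspace_tpow multilinear_pure] linear_on_id in auto)

text \<open>Lifting depends linearly on the lifted map: both sides of each required equation are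
  linear in \<open>T\<close>, so \<open>tensor_ext\<close> reduces them to pure tensors, where they
  are the linearity of \<open>M\<close> in \<open>x\<close>.\<close>

lemma tlift_linear_param:
  assumes U: "vspace U" and V: "vspace V" and W: "vspace W"
    and mult: "\<And>x. x \<in> vec U \<Longrightarrow> multilinear n V W (M x)"
    and lin: "\<And>vs. vs \<in> tuples n V \<Longrightarrow> linear_on U W (\<lambda>x. M x vs)"
    and T: "T \<in> vec (tpow n V)"
  shows "linear_on U W (\<lambda>x. tlift n V W (M x) T)"
proof (rule linear_onI)
  fix x assume x: "x \<in> vec U"
  show "tlift n V W (M x) T \<in> vec W"
    using V W x T mult by (intro linear_onD(1)[OF tlift_linear])
next
  fix x y assume xy: "x \<in> vec U" "y \<in> vec U"
  have l: "linear_on (tpow n V) W (tlift n V W (M z))" if "z \<in> vec U" for z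
    using V W mult[OF that] by (rule tlift_linear)
  have l': "linear_on (tpow n V) W (\<lambda>T. tlift n V W (M x) T + tlift n V W (M y) T)"
    using l[OF xy(1)] l[OF xy(2)] W
    by (auto simp: linear_on_def algebra_simps vspace_smul vspace_closed)
  have "x + y \<in> vec U" using U xy by (intro vspace_closed)
  then show "tlift n V W (M (x + y)) T = tlift n V W (M x) T + tlift n V W (M y) T"
    using xy linear_onD(2)[OF lin]
    by (intro tensor_ext[OF l l' _ T]) (simp_all add: tlift_pure[OF V W mult])
next
  fix c x assume x: "x \<in> vec U"
  then have cx: "smul U c x \<in> vec U" using U by (intro vspace_closed)
  have l: "linear_on (tpow n V) W (tlift n V W (M z))" if "z \<in> vec U" for z
    using V W mult[OF that] by (rule tlift_linear)
  have l': "linear_on (tpow n V) W (\<lambda>T. smul W c (tlift n V W (M x) T))"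
    using l[OF x] W
    by (auto simp: linear_on_def algebra_simps vspace_smul vspace_closed)
  show "tlift n V W (M (smul U c x)) T = smul W c (tlift n V W (M x) T)"
    using x cx linear_onD(3)[OF lin]
    by (intro tensor_ext[OF l l' _ T]) (simp_all add: tlift_pure[OF V W mult])
qed

lemma tlift_multilinear_param:
  assumes U: "vspace U" and V: "vspace V" and W: "vspace W"
    and mult: "\<And>us. us \<in> tuples k U \<Longrightarrow> multilinear n V W (M us)"
    and mult': "\<And>vs. vs \<in> tuples n V \<Longrightarrow> multilinear k U W (\<lambda>us. M us vs)"
    and T: "T \<in> vec (tpow n V)"
  shows "multilinear k U W (\<lambda>us. tlift n V W (M us) T)"
proof (rule multilinearI)
  fix us assume us: "us \<in> tuples k U"
  show "tlift n V W (M us) T \<in> vec W"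
    using V W us T mult by (intro linear_onD(1)[OF tlift_linear])
  fix i assume i: "i < k"
  show "linear_on U W (\<lambda>x. tlift n V W (M (us[i := x])) T)"
    using U V W us i T
    by (intro tlift_linear_param) (auto intro: mult tuples_update multilinearD(2)[OF mult'])
qed

text \<open>A Fubini rule for evaluation at two tensors. Both sides are linear in \<open>S\<close>,
  and at a pure tensor the lift over \<open>U\<close> is plain substitution. It yields the
  interchange of two Sweedler sums.\<close>

lemma tlift_swap:
  assumes U: "vspace U" and V: "vspace V" and W: "vspace W"
    and mult: "\<And>us. us \<in> tuples k U \<Longrightarrow> multilinear n V W (M us)"
    and mult': "\<And>vs. vs \<in> tuples n V \<Longrightarrow> multilinear k U W (\<lambda>us. M us vs)"
    and T: "T \<in> vec (tpow n V)" and S: "S \<in> vec (tpow k U)"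
  shows "tlift k U W (\<lambda>us. tlift n V W (M us) T) S = tlift n V W (\<lambda>vs. tlift k U W (\<lambda>us. M us vs) S) T"
proof (rule tensor_ext[OF tlift_linear _ _ S])
  have p: "multilinear k U W (\<lambda>us. tlift n V W (M us) T)" if "T \<in> vec (tpow n V)" for T
    using U V W mult mult' that by (rule tlift_multilinear_param)
  have q: "multilinear n V W (\<lambda>vs. tlift k U W (\<lambda>us. M us vs) S)" if "S \<in> vec (tpow k U)" for S
    using V U W mult' mult that by (rule tlift_multilinear_param)
  show "multilinear k U W (\<lambda>us. tlift n V W (M us) T)" by (rule p[OF T])
  show "linear_on (tpow k U) W (\<lambda>S. tlift n V W (\<lambda>vs. tlift k U W (\<lambda>us. M us vs) S) T)"
    using U V W T q by (intro tlift_linear_param)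
      (auto intro: vspace_tpow tlift_linear mult')
  fix us assume us: "us \<in> tuples k U"
  have "tlift n V W (\<lambda>vs. tlift k U W (\<lambda>us. M us vs) (pure k U us)) T = tlift n V W (M us) T"
    by (subst tlift_cong[OF tlift_pure[OF U W mult' us]]) auto
  then show "tlift k U W (\<lambda>us. tlift n V W (M us) T) (pure k U us) =
      tlift n V W (\<lambda>vs. tlift k U W (\<lambda>us. M us vs) (pure k U us)) T"
    using tlift_pure[OF U W p[OF T] us] by simp
qed (fact U W)+

subsection \<open>Dependence on the vector space structure only\<close>

text \<open>Records of different types, such as \<open>vsp\<close>, \<open>coalg\<close> and
  \<open>bialg\<close>, with equal carrier and scalars have equal tensor powers. This permits
  passing between a bialgebra, its underlying coalgebra and its opposite.\<close>

lemma multilinear_vsp_cong: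
  "vec V = vec V' \<Longrightarrow> smul V = smul V' \<Longrightarrow> vec W = vec W' \<Longrightarrow> smul W = smul W' \<Longrightarrow>
    multilinear n V W = multilinear n V' W'"
  by (simp add: fun_eq_iff multilinear_def tuples_def linear_on_def)

lemma pure_vsp_cong: "vec V = vec V' \<Longrightarrow> smul V = smul V' \<Longrightarrow> pure n V = pure n V'"
  using multilinear_vsp_cong[of V V' ground ground] by (simp add: pure_def fun_eq_iff)

lemma tpow_vsp_cong: "vec V = vec V' \<Longrightarrow> smul V = smul V' \<Longrightarrow> tpow n V = tpow n V'"
  using pure_vsp_cong[of V V'] by (simp add: tpow_def tuples_def)

subsection \<open>Tensor products of linear maps\<close>

lemma tcons_pure:
  assumes "vspace V" "v \<in> vec V" "vs \<in> tuples n V"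
  shows "tcons n V v (pure n V vs) = pure (Suc n) V (v # vs)"
  unfolding tcons_def
  using assms by (intro tlift_pure vspace_tpow multilinear_Cons(1)[OF multilinear_pure])

lemma bilinear_tcons:
  assumes V: "vspace V"
  shows "bilinear_on V (tpow n V) (tpow (Suc n) V) (tcons n V)"
  unfolding bilinear_on_def tcons_def
  using V by (auto intro!: tlift_linear tlift_linear_param vspace_tpow
      multilinear_Cons[OF multilinear_pure])

lemma tsnoc_pure:
  assumes "vspace V" "v \<in> vec V" "vs \<in> tuples n V"
  shows "tsnoc n V (pure n V vs) v = pure (Suc n) V (vs @ [v])"
  unfolding tsnoc_def
  using assms by (intro tlift_pure vspace_tpow multilinear_snoc(1)[OF multilinear_pure])

lemma bilinear_tsnoc:
  assumes V: "vspace V"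
  shows "bilinear_on (tpow n V) V (tpow (Suc n) V) (tsnoc n V)"
  unfolding bilinear_on_def tsnoc_def
  using V by (auto intro!: tlift_linear tlift_linear_param vspace_tpow
      multilinear_snoc[OF multilinear_pure])

text \<open>The tensor power of the linear map \<open>f\<close>. For \<open>n = 2\<close> it turns
  the Sweedler expression in \<open>coalgebra_hom\<close> into the composite of \<open>comul\<close>
  with f \<otimes> f (see \<open>tmap_comul\<close>).\<close>

definition tmap ::
  "nat \<Rightarrow> ('f::field, 'v::ab_group_add, 'y) vsp_scheme \<Rightarrow> ('f, 'w::ab_group_add, 'z) vsp_scheme
    \<Rightarrow> ('v \<Rightarrow> 'w) \<Rightarrow> ('f, 'v) tensor \<Rightarrow> ('f, 'w) tensor" where
  "tmap n V W f = tlift n V (tpow n W) (\<lambda>vs. pure n W (map f vs))"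

lemma tmap_linear:
  assumes "vspace V" "linear_on V W f"
  shows "linear_on (tpow n V) (tpow n W) (tmap n V W f)"
  unfolding tmap_def
  by (rule tlift_linear[OF assms(1) vspace_tpow multilinear_map[OF multilinear_pure assms(2)]])

lemma tmap_pure:
  assumes "vspace V" "linear_on V W f" "vs \<in> tuples n V"
  shows "tmap n V W f (pure n V vs) = pure n W (map f vs)"
  unfolding tmap_def
  by (rule tlift_pure[OF assms(1) vspace_tpow multilinear_map[OF multilinear_pure assms(2)] assms(3)])

lemma tmap_tcons:
  assumes V: "vspace V" and W: "vspace W" and f: "linear_on V W f"
    and v: "v \<in> vec V" and T: "T \<in> vec (tpow n V)"
  shows "tmap (Suc n) V W f (tcons n V v T) = tcons n W (f v) (tmap n V W f T)"
proof (rule tensor_ext[OF _ _ _ T])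
  have fv: "f v \<in> vec W" using f v by (simp add: linear_on_def)
  show "linear_on (tpow n V) (tpow (Suc n) W) (\<lambda>T. tmap (Suc n) V W f (tcons n V v T))"
    by (rule linear_on_comp[OF bilinear_onD(1)[OF bilinear_tcons[OF V] v] tmap_linear[OF V f]])
  show "linear_on (tpow n V) (tpow (Suc n) W) (\<lambda>T. tcons n W (f v) (tmap n V W f T))"
    by (rule linear_on_comp[OF tmap_linear[OF V f] bilinear_onD(1)[OF bilinear_tcons[OF W] fv]])
  fix vs assume vs: "vs \<in> tuples n V"
  then have "map f vs \<in> tuples n W" "v # vs \<in> tuples (Suc n) V"
    using f v by (auto intro!: tuples_map simp: tuples_Suc linear_on_def)
  with vs v fv show "tmap (Suc n) V W f (tcons n V v (pure n V vs)) =
      tcons n W (f v) (tmap n V W f (pure n V vs))"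
    by (simp add: tcons_pure[OF V] tcons_pure[OF W] tmap_pure[OF V f])
qed

lemma tmap_tsnoc:
  assumes V: "vspace V" and W: "vspace W" and f: "linear_on V W f"
    and v: "v \<in> vec V" and T: "T \<in> vec (tpow n V)"
  shows "tmap (Suc n) V W f (tsnoc n V T v) = tsnoc n W (tmap n V W f T) (f v)"
proof (rule tensor_ext[OF _ _ _ T])
  have fv: "f v \<in> vec W" using f v by (simp add: linear_on_def)
  show "linear_on (tpow n V) (tpow (Suc n) W) (\<lambda>T. tmap (Suc n) V W f (tsnoc n V T v))"
    by (rule linear_on_comp[OF bilinear_onD(2)[OF bilinear_tsnoc[OF V] v] tmap_linear[OF V f]])
  show "linear_on (tpow n V) (tpow (Suc n) W) (\<lambda>T. tsnoc n W (tmap n V W f T) (f v))"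
    by (rule linear_on_comp[OF tmap_linear[OF V f] bilinear_onD(2)[OF bilinear_tsnoc[OF W] fv]])
  fix vs assume vs: "vs \<in> tuples n V"
  then have "map f vs \<in> tuples n W" "vs @ [v] \<in> tuples (Suc n) V"
    using f v by (auto intro!: tuples_map simp: tuples_def linear_on_def)
  with vs v fv show "tmap (Suc n) V W f (tsnoc n V (pure n V vs) v) =
      tsnoc n W (tmap n V W f (pure n V vs)) (f v)"
    by (simp add: tsnoc_pure[OF V] tsnoc_pure[OF W] tmap_pure[OF V f])
qed

text \<open>Substitution rule: both sides are linear in \<open>T\<close> and agree on pure tensors.
  It gives \<open>sweedler_hom\<close> for \<open>n = 2\<close>, and the functoriality of
  \<open>tmap\<close>.\<close>

lemma tlift_tmap:
  assumes V: "vspace V" and W: "vspace W" and X: "vspace X" and f: "linear_on V W f"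
    and m: "multilinear n W X m" and T: "T \<in> vec (tpow n V)"
  shows "tlift n W X m (tmap n V W f T) = tlift n V X (\<lambda>vs. m (map f vs)) T"
proof (rule tensor_ext[OF _ _ _ T])
  show "linear_on (tpow n V) X (\<lambda>T. tlift n W X m (tmap n V W f T))"
    by (rule linear_on_comp[OF tmap_linear[OF V f] tlift_linear[OF W X m]])
  show "linear_on (tpow n V) X (tlift n V X (\<lambda>vs. m (map f vs)))"
    by (rule tlift_linear[OF V X multilinear_map[OF m f]])
  fix vs assume vs: "vs \<in> tuples n V"
  then have "map f vs \<in> tuples n W"
    using f by (auto intro!: tuples_map simp: linear_on_def)
  with vs show "tlift n W X m (tmap n V W f (pure n V vs)) =
      tlift n V X (\<lambda>vs. m (map f vs)) (pure n V vs)"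
    by (simp add: tmap_pure[OF V f] tlift_pure[OF W X m] tlift_pure[OF V X multilinear_map[OF m f]])
qed

subsection \<open>Coalgebras\<close>

lemma coalgebraD:
  assumes "coalgebra C"
  shows "vspace C" and "linear_on C (tpow 2 C) (comul C)" and "linear_on C ground (counit C)"
    and "c \<in> vec C \<Longrightarrow> comul C c \<in> vec (tpow 2 C)"
  using assms by (auto simp: coalgebra_def linear_on_def)

lemma sweedler_linear:
  assumes "coalgebra C" "vspace W" "bilinear_on C C W b"
  shows "linear_on C W (sweedler C W b)"
  unfolding sweedler_def
  by (rule linear_on_comp[OF coalgebraD(2)[OF assms(1)]
        tlift_linear[OF coalgebraD(1)[OF assms(1)] assms(2) bilinear_multilinear[OF assms(3)]]])

lemma sweedler_cong:
  assumes "\<And>x y. x \<in> vec C \<Longrightarrow> y \<in> vec C \<Longrightarrow> b x y = b' x y"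
  shows "sweedler C W b = sweedler C W b'"
proof -
  have "tlift 2 C W (\<lambda>xs. b (xs ! 0) (xs ! 1)) = tlift 2 C W (\<lambda>xs. b' (xs ! 0) (xs ! 1))"
    using assms by (intro tlift_cong) (auto simp: tuples_2)
  then show ?thesis by (simp add: sweedler_def fun_eq_iff)
qed

lemma linear_sweedler:
  assumes "coalgebra C" "vspace W" "vspace X" "bilinear_on C C W b" "linear_on W X h" "c \<in> vec C"
  shows "h (sweedler C W b c) = sweedler C X (\<lambda>x y. h (b x y)) c"
  unfolding sweedler_def
  by (rule linear_tlift[OF coalgebraD(1)[OF assms(1)] assms(2,3) bilinear_multilinear[OF assms(4)]
        assms(5) coalgebraD(4)[OF assms(1,6)]])

lemma tmap_comul:
  "tmap 2 C D f (comul C c) = sweedler C (tpow 2 D) (\<lambda>x y. pure 2 D [f x, f y]) c"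
proof -
  have "tmap 2 C D f = tlift 2 C (tpow 2 D) (\<lambda>xs. pure 2 D [f (xs ! 0), f (xs ! 1)])"
    unfolding tmap_def by (intro tlift_cong) (auto simp: tuples_2)
  then show ?thesis by (simp add: sweedler_def)
qed

lemma coalgebra_homD:
  assumes "coalgebra_hom C D \<phi>"
  shows "\<phi> \<in> Hom C D" and "linear_on C D \<phi>" and "c \<in> vec C \<Longrightarrow> \<phi> c \<in> vec D"
    and "c \<in> vec C \<Longrightarrow> comul D (\<phi> c) = tmap 2 C D \<phi> (comul C c)"
    and "c \<in> vec C \<Longrightarrow> counit D (\<phi> c) = counit C c"
  using assms by (auto simp: coalgebra_hom_def Hom_def tmap_comul) (auto simp: linear_on_def)

lemma coalgebra_homI:
  assumes "\<phi> \<in> Hom C D"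
    and "\<And>c. c \<in> vec C \<Longrightarrow> comul D (\<phi> c) = tmap 2 C D \<phi> (comul C c)"
    and "\<And>c. c \<in> vec C \<Longrightarrow> counit D (\<phi> c) = counit C c"
  shows "coalgebra_hom C D \<phi>"
  using assms by (auto simp: coalgebra_hom_def tmap_comul)

text \<open>A Sweedler sum over \<phi>(c) can be computed in \<open>C\<close>, since the
  comultiplication commutes with \<phi>. This turns identities in an image coalgebra into identities
  in \<open>C\<close>.\<close>

lemma sweedler_hom:
  assumes C: "coalgebra C" and D: "vspace D" and W: "vspace W" and \<phi>: "coalgebra_hom C D \<phi>"
    and b: "bilinear_on D D W b" and c: "c \<in> vec C"
  shows "sweedler D W b (\<phi> c) = sweedler C W (\<lambda>x y. b (\<phi> x) (\<phi> y)) c"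
proof -
  have "sweedler D W b (\<phi> c) = tlift 2 C W (\<lambda>xs. b (map \<phi> xs ! 0) (map \<phi> xs ! 1)) (comul C c)"
    unfolding sweedler_def coalgebra_homD(4)[OF \<phi> c]
    by (rule tlift_tmap[OF coalgebraD(1)[OF C] D W coalgebra_homD(2)[OF \<phi>]
          bilinear_multilinear[OF b] coalgebraD(4)[OF C c]])
  also have "\<dots> = sweedler C W (\<lambda>x y. b (\<phi> x) (\<phi> y)) c"
  proof -
    have "tlift 2 C W (\<lambda>xs. b (map \<phi> xs ! 0) (map \<phi> xs ! 1)) =
        tlift 2 C W (\<lambda>xs. b (\<phi> (xs ! 0)) (\<phi> (xs ! 1)))"
      by (intro tlift_cong) (auto simp: tuples_2)
    then show ?thesis by (simp add: sweedler_def)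
  qed
  finally show ?thesis .
qed

lemma sweedler_bilinear_param:
  assumes C: "vspace C" and D: "coalgebra D" and W: "vspace W"
    and b: "\<And>x1 x2. x1 \<in> vec C \<Longrightarrow> x2 \<in> vec C \<Longrightarrow> bilinear_on D D W (b x1 x2)"
    and b': "\<And>y1 y2. y1 \<in> vec D \<Longrightarrow> y2 \<in> vec D \<Longrightarrow> bilinear_on C C W (\<lambda>x1 x2. b x1 x2 y1 y2)"
    and d: "d \<in> vec D"
  shows "bilinear_on C C W (\<lambda>x1 x2. sweedler D W (b x1 x2) d)"
  unfolding bilinear_on_def sweedler_def
proof (intro conjI ballI)
  fix x assume x: "x \<in> vec C"
  show "linear_on C W (\<lambda>x2. tlift 2 D W (\<lambda>xs. b x x2 (xs ! 0) (xs ! 1)) (comul D d))"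
    using bilinear_onD(1)[OF b' x] bilinear_multilinear[OF b[OF x]]
    by (intro tlift_linear_param[OF C coalgebraD(1)[OF D] W _ _ coalgebraD(4)[OF D d]])
      (auto simp: tuples_2)
  show "linear_on C W (\<lambda>x1. tlift 2 D W (\<lambda>xs. b x1 x (xs ! 0) (xs ! 1)) (comul D d))"
    using bilinear_onD(2)[OF b' x] bilinear_multilinear[OF b[OF _ x]]
    by (intro tlift_linear_param[OF C coalgebraD(1)[OF D] W _ _ coalgebraD(4)[OF D d]])
      (auto simp: tuples_2)
qed

lemma sweedler_swap:
  assumes C: "coalgebra C" and D: "coalgebra D" and W: "vspace W"
    and b: "\<And>x1 x2. x1 \<in> vec C \<Longrightarrow> x2 \<in> vec C \<Longrightarrow> bilinear_on D D W (b x1 x2)"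
    and b': "\<And>y1 y2. y1 \<in> vec D \<Longrightarrow> y2 \<in> vec D \<Longrightarrow> bilinear_on C C W (\<lambda>x1 x2. b x1 x2 y1 y2)"
    and c: "c \<in> vec C" and d: "d \<in> vec D"
  shows "sweedler C W (\<lambda>x1 x2. sweedler D W (b x1 x2) d) c =
    sweedler D W (\<lambda>y1 y2. sweedler C W (\<lambda>x1 x2. b x1 x2 y1 y2) c) d"
  unfolding sweedler_def
proof (rule tlift_swap[OF coalgebraD(1)[OF C] coalgebraD(1)[OF D] W _ _ coalgebraD(4)[OF D d]
      coalgebraD(4)[OF C c]])
  show "multilinear 2 D W (\<lambda>ys. b (xs ! 0) (xs ! 1) (ys ! 0) (ys ! 1))" if "xs \<in> tuples 2 C" for xs
    using that by (intro bilinear_multilinear b) (auto simp: tuples_2)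
  show "multilinear 2 C W (\<lambda>xs. b (xs ! 0) (xs ! 1) (ys ! 0) (ys ! 1))" if "ys \<in> tuples 2 D" for ys
    using that by (intro bilinear_multilinear[OF b']) (auto simp: tuples_2)
qed

lemma coalgebra_hom_comp:
  assumes B: "coalgebra B" and C: "vspace C" and D: "vspace D" and \<phi>: "coalgebra_hom B C \<phi>"
    and \<chi>: "coalgebra_hom C D \<chi>"
  shows "coalgebra_hom B D (\<lambda>x. \<chi> (\<phi> x))"
proof -
  have "linear_on B D (\<lambda>x. \<chi> (\<phi> x))"
    by (rule linear_on_comp[OF coalgebra_homD(2)[OF \<phi>] coalgebra_homD(2)[OF \<chi>]])
  moreover have "\<chi> (\<phi> x) = 0" if "x \<notin> vec B" for x
    using that HomD(2)[OF coalgebra_homD(1)[OF \<phi>]] linear_on_0[OF coalgebra_homD(2)[OF \<chi>] C] by simp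
  ultimately have H: "(\<lambda>x. \<chi> (\<phi> x)) \<in> Hom B D" by (simp add: Hom_def)
  have "comul D (\<chi> (\<phi> x)) = tmap 2 B D (\<lambda>x. \<chi> (\<phi> x)) (comul B x)" if x: "x \<in> vec B" for x
  proof -
    have "comul D (\<chi> (\<phi> x)) = tmap 2 C D \<chi> (tmap 2 B C \<phi> (comul B x))"
      using x coalgebra_homD(3,4)[OF \<phi> x] coalgebra_homD(4)[OF \<chi>] by simp
    also have "\<dots> = tlift 2 B (tpow 2 D) (\<lambda>vs. pure 2 D (map \<chi> (map \<phi> vs))) (comul B x)"
      unfolding tmap_def[of 2 C D]
      by (rule tlift_tmap[OF coalgebraD(1)[OF B] C vspace_tpow coalgebra_homD(2)[OF \<phi>]
            multilinear_map[OF multilinear_pure coalgebra_homD(2)[OF \<chi>]] coalgebraD(4)[OF B x]])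
    finally show ?thesis by (simp add: tmap_def comp_def)
  qed
  then show ?thesis
    using H coalgebra_homD(3,5)[OF \<phi>] coalgebra_homD(5)[OF \<chi>] by (intro coalgebra_homI) simp_all
qed

text \<open>\<open>C\<close> and \<open>D\<close> may have different record types: the identity map
  changes the record while keeping the coalgebra. \<open>extend0\<close> is forced by
  \<open>Hom\<close>, whose members vanish off the carrier.\<close>

lemma coalgebra_hom_same:
  assumes C: "coalgebra C"
    and eq: "vec D = vec C" "smul D = smul C" "comul D = comul C" "counit D = counit C"
  shows "coalgebra_hom C D (extend0 C (\<lambda>x. x))"
proof (rule coalgebra_homI)
  note Cv = coalgebraD(1)[OF C]
  have "linear_on C D (\<lambda>x. x)" using eq by (simp add: linear_on_def)
  with Cv show "extend0 C (\<lambda>x. x) \<in> Hom C D" by (rule extend0_Hom)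
  fix c assume c: "c \<in> vec C"
  have "tmap 2 C D (extend0 C (\<lambda>x. x)) = tlift 2 C (tpow 2 C) (pure 2 C)"
    unfolding tmap_def pure_vsp_cong[OF eq(1,2)] tpow_vsp_cong[OF eq(1,2)]
    by (rule tlift_cong) (auto simp: tuples_2 extend0_def)
  with c eq show "comul D (extend0 C (\<lambda>x. x) c) = tmap 2 C D (extend0 C (\<lambda>x. x)) (comul C c)"
    using tlift_pure_id[OF Cv coalgebraD(4)[OF C c]] by (simp add: extend0_def)
  show "counit D (extend0 C (\<lambda>x. x) c) = counit C c"
    using c eq by (simp add: extend0_def)
qed

lemma bilinear_smul:
  assumes "vspace V" "linear_on V ground f"
  shows "bilinear_on V V V (\<lambda>x y. smul V (f x) y)" "bilinear_on V V V (\<lambda>x y. smul V (f y) x)"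
  using assms by (auto simp: bilinear_on_def linear_on_def vspace_smul vspace_closed mult.commute)

text \<open>Each axiom of \<open>Q\<close> is an identity at some \<pi>(c), and it is the image,
  under \<pi> or a tensor power of it, of the axiom of \<open>C\<close> at \<open>c\<close>. This
  provides the quotient coalgebra needed later.\<close>

lemma coalgebra_image:
  assumes C: "coalgebra C" and Q: "vspace Q" and \<pi>: "coalgebra_hom C Q \<pi>"
    and surj: "\<pi> ` vec C = vec Q"
  shows "coalgebra Q"
proof -
  note Cv = coalgebraD(1)[OF C] and lin = coalgebra_homD(2)[OF \<pi>]
  \<comment> \<open>\<open>g\<close> is already a function on \<open>Q\<close>, so nothing has to be
    shown well defined; linearity is read off from preimages under \<pi>.\<close>
  have mapped: "linear_on Q W g" if g: "linear_on C W (\<lambda>c. g (\<pi> c))"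
    for W :: "('a, 'w::ab_group_add, 'x) vsp_scheme" and g
  proof (rule linear_onI)
    fix x assume "x \<in> vec Q"
    then obtain c where c: "c \<in> vec C" "x = \<pi> c" using surj by auto
    show "g x \<in> vec W" using linear_onD(1)[OF g c(1)] c(2) by simp
    show "g (smul Q k x) = smul W k (g x)" for k
      using linear_onD(3)[OF g c(1), of k] linear_onD(3)[OF lin c(1), of k] c(2) by simp
    fix y assume "y \<in> vec Q"
    then obtain d where d: "d \<in> vec C" "y = \<pi> d" using surj by auto
    show "g (x + y) = g x + g y"
      using linear_onD(2)[OF g c(1) d(1)] linear_onD(2)[OF lin c(1) d(1)] c(2) d(2) by simp
  qed
  have "linear_on C (tpow 2 Q) (\<lambda>c. tmap 2 C Q \<pi> (comul C c))"
    by (rule linear_on_comp[OF coalgebraD(2)[OF C] tmap_linear[OF Cv lin]])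
  then have "linear_on C (tpow 2 Q) (\<lambda>c. comul Q (\<pi> c))"
    using coalgebra_homD(4)[OF \<pi>] by (subst linear_on_cong[OF Cv]) auto
  then have comul: "linear_on Q (tpow 2 Q) (comul Q)" by (rule mapped)
  have "linear_on C ground (\<lambda>c. counit Q (\<pi> c))"
    using coalgebra_homD(5)[OF \<pi>] coalgebraD(3)[OF C] by (subst linear_on_cong[OF Cv]) auto
  then have counit: "linear_on Q ground (counit Q)" by (rule mapped)
  have bl: "bilinear_on Q Q (tpow 3 Q) (\<lambda>x y. tsnoc 2 Q (comul Q x) y)"
    "bilinear_on Q Q (tpow 3 Q) (\<lambda>x y. tcons 2 Q x (comul Q y))"
    using bilinear_on_comp[OF bilinear_tsnoc[OF Q, of 2] comul linear_on_id]
      bilinear_on_comp[OF bilinear_tcons[OF Q, of 2] linear_on_id comul] by simp_all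
  have bl': "bilinear_on C C (tpow 3 C) (\<lambda>x y. tsnoc 2 C (comul C x) y)"
    "bilinear_on C C (tpow 3 C) (\<lambda>x y. tcons 2 C x (comul C y))"
    using bilinear_on_comp[OF bilinear_tsnoc[OF Cv, of 2] coalgebraD(2)[OF C] linear_on_id]
      bilinear_on_comp[OF bilinear_tcons[OF Cv, of 2] linear_on_id coalgebraD(2)[OF C]] by simp_all
  have ax: "sweedler Q (tpow 3 Q) (\<lambda>x y. tsnoc 2 Q (comul Q x) y) q =
        sweedler Q (tpow 3 Q) (\<lambda>x y. tcons 2 Q x (comul Q y)) q \<and>
      sweedler Q Q (\<lambda>x y. smul Q (counit Q x) y) q = q \<and>
      sweedler Q Q (\<lambda>x y. smul Q (counit Q y) x) q = q" if qQ: "q \<in> vec Q" for q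
  proof -
    obtain c where c: "c \<in> vec C" and q: "q = \<pi> c" using surj qQ by auto
    have t3: "linear_on (tpow 3 C) (tpow 3 Q) (tmap 3 C Q \<pi>)" by (rule tmap_linear[OF Cv lin])
    \<comment> \<open>Go up to \<open>C\<close>, recognise the integrand as \<pi> \<otimes> \<pi>
      \<otimes> \<pi> applied to the integrand of \<open>C\<close>, use coassociativity there, and
      come down again.\<close>
    have "sweedler Q (tpow 3 Q) (\<lambda>x y. tsnoc 2 Q (comul Q x) y) q =
        sweedler C (tpow 3 Q) (\<lambda>x y. tsnoc 2 Q (comul Q (\<pi> x)) (\<pi> y)) c"
      unfolding q by (rule sweedler_hom[OF C Q vspace_tpow \<pi> bl(1) c])
    also have "\<dots> = sweedler C (tpow 3 Q) (\<lambda>x y. tmap 3 C Q \<pi> (tsnoc 2 C (comul C x) y)) c"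
      using tmap_tsnoc[OF Cv Q lin _ coalgebraD(4)[OF C]] coalgebra_homD(4)[OF \<pi>]
      by (intro fun_cong[OF sweedler_cong]) simp
    also have "\<dots> = tmap 3 C Q \<pi> (sweedler C (tpow 3 C) (\<lambda>x y. tsnoc 2 C (comul C x) y) c)"
      by (rule linear_sweedler[OF C vspace_tpow vspace_tpow bl'(1) t3 c, symmetric])
    also have "\<dots> = tmap 3 C Q \<pi> (sweedler C (tpow 3 C) (\<lambda>x y. tcons 2 C x (comul C y)) c)"
      using C c by (simp add: coalgebra_def)
    also have "\<dots> = sweedler C (tpow 3 Q) (\<lambda>x y. tmap 3 C Q \<pi> (tcons 2 C x (comul C y))) c"
      by (rule linear_sweedler[OF C vspace_tpow vspace_tpow bl'(2) t3 c])
    also have "\<dots> = sweedler C (tpow 3 Q) (\<lambda>x y. tcons 2 Q (\<pi> x) (comul Q (\<pi> y))) c"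
      using tmap_tcons[OF Cv Q lin _ coalgebraD(4)[OF C]] coalgebra_homD(4)[OF \<pi>]
      by (intro fun_cong[OF sweedler_cong]) simp
    also have "\<dots> = sweedler Q (tpow 3 Q) (\<lambda>x y. tcons 2 Q x (comul Q y)) q"
      unfolding q by (rule sweedler_hom[OF C Q vspace_tpow \<pi> bl(2) c, symmetric])
    finally have 1: "sweedler Q (tpow 3 Q) (\<lambda>x y. tsnoc 2 Q (comul Q x) y) q =
        sweedler Q (tpow 3 Q) (\<lambda>x y. tcons 2 Q x (comul Q y)) q" .
    have "sweedler Q Q (\<lambda>x y. smul Q (counit Q x) y) q =
        sweedler C Q (\<lambda>x y. smul Q (counit Q (\<pi> x)) (\<pi> y)) c"
      unfolding q by (rule sweedler_hom[OF C Q Q \<pi> bilinear_smul(1)[OF Q counit] c])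
    also have "\<dots> = sweedler C Q (\<lambda>x y. \<pi> (smul C (counit C x) y)) c"
      using linear_onD(3)[OF lin] coalgebra_homD(5)[OF \<pi>]
      by (intro fun_cong[OF sweedler_cong]) simp
    also have "\<dots> = \<pi> (sweedler C C (\<lambda>x y. smul C (counit C x) y) c)"
      by (rule linear_sweedler[OF C Cv Q bilinear_smul(1)[OF Cv coalgebraD(3)[OF C]] lin c, symmetric])
    also have "\<dots> = q" using C c q by (simp add: coalgebra_def)
    finally have 2: "sweedler Q Q (\<lambda>x y. smul Q (counit Q x) y) q = q" .
    have "sweedler Q Q (\<lambda>x y. smul Q (counit Q y) x) q =
        sweedler C Q (\<lambda>x y. smul Q (counit Q (\<pi> y)) (\<pi> x)) c"
      unfolding q by (rule sweedler_hom[OF C Q Q \<pi> bilinear_smul(2)[OF Q counit] c])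
    also have "\<dots> = sweedler C Q (\<lambda>x y. \<pi> (smul C (counit C y) x)) c"
      using linear_onD(3)[OF lin] coalgebra_homD(5)[OF \<pi>]
      by (intro fun_cong[OF sweedler_cong]) simp
    also have "\<dots> = \<pi> (sweedler C C (\<lambda>x y. smul C (counit C y) x) c)"
      by (rule linear_sweedler[OF C Cv Q bilinear_smul(2)[OF Cv coalgebraD(3)[OF C]] lin c, symmetric])
    also have "\<dots> = q" using C c q by (simp add: coalgebra_def)
    finally have 3: "sweedler Q Q (\<lambda>x y. smul Q (counit Q y) x) q = q" .
    from 1 2 3 show ?thesis by simp
  qed
  then show ?thesis using Q comul counit by (simp add: coalgebra_def)
qed

subsection \<open>Measurings along coalgebra homomorphisms\<close>

lemma iter_comul_linear:
  assumes P: "coalgebra P"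
  shows "linear_on P (tpow n P) (iter_comul P n)"
proof -
  note Pv = coalgebraD(1)[OF P]
  \<comment> \<open>\<open>iter_comul\<close> has separate clauses for 0 and 1 and recurses from 2
    on; with two consecutive cases proved together, the induction step involves only the clause for
    \<open>Suc (Suc n)\<close>.\<close>
  have "linear_on P (tpow n P) (iter_comul P n) \<and>
    linear_on P (tpow (Suc n) P) (iter_comul P (Suc n))"
  proof (induction n)
    case 0
    have "pure 0 P [] \<in> vec (tpow 0 P)" by (intro pure_in_tpow) simp
    then have "linear_on P (tpow 0 P) (iter_comul P 0)"
      using coalgebraD(3)[OF P] vspace_closed(4)[OF vspace_tpow, of "pure 0 P []" 0 P]
        vspace_smul(5,6)[OF vspace_tpow, of 0 P]
      by (auto simp: linear_on_def)
    moreover have "linear_on P (tpow (Suc 0) P) (iter_comul P (Suc 0))"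
      using multilinear_Cons(2)[OF multilinear_pure, of "[]" 0 P]
      by (simp add: iter_comul.simps(2)[abs_def])
    ultimately show ?case by blast
  next
    case (Suc n)
    have "bilinear_on P P (tpow (Suc (Suc n)) P) (\<lambda>x y. tcons (Suc n) P x (iter_comul P (Suc n) y))"
      using Suc by (intro bilinear_on_comp[OF bilinear_tcons[OF Pv] linear_on_id]) blast
    then have "linear_on P (tpow (Suc (Suc n)) P) (iter_comul P (Suc (Suc n)))"
      using sweedler_linear[OF P vspace_tpow] by (simp add: iter_comul.simps(3)[abs_def])
    with Suc show ?case by blast
  qed
  then show ?thesis by blast
qed

lemma iter_comul_in:
  "coalgebra P \<Longrightarrow> p \<in> vec P \<Longrightarrow> iter_comul P n p \<in> vec (tpow n P)"
  by (rule linear_onD(1)[OF iter_comul_linear])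

lemma iter_comul_hom:
  assumes P: "coalgebra P" and Q: "coalgebra Q" and \<pi>: "coalgebra_hom P Q \<pi>"
  shows "p \<in> vec P \<Longrightarrow> iter_comul Q n (\<pi> p) = tmap n P Q \<pi> (iter_comul P n p)"
proof -
  note Pv = coalgebraD(1)[OF P] and Qv = coalgebraD(1)[OF Q] and lin = coalgebra_homD(2)[OF \<pi>]
  have "(\<forall>p\<in>vec P. iter_comul Q n (\<pi> p) = tmap n P Q \<pi> (iter_comul P n p)) \<and>
    (\<forall>p\<in>vec P. iter_comul Q (Suc n) (\<pi> p) = tmap (Suc n) P Q \<pi> (iter_comul P (Suc n) p))"
  proof (induction n)
    case 0
    have "iter_comul Q 0 (\<pi> p) = tmap 0 P Q \<pi> (iter_comul P 0 p)" if "p \<in> vec P" for p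
    proof -
      have "pure 0 P [] \<in> vec (tpow 0 P)" by (intro pure_in_tpow) simp
      then show ?thesis
        using linear_onD(3)[OF tmap_linear[OF Pv lin], of "pure 0 P []" 0 "counit P p"]
          tmap_pure[OF Pv lin, of "[]" 0] coalgebra_homD(5)[OF \<pi> that] by simp
    qed
    moreover have "iter_comul Q (Suc 0) (\<pi> p) = tmap (Suc 0) P Q \<pi> (iter_comul P (Suc 0) p)"
      if "p \<in> vec P" for p
      using tmap_pure[OF Pv lin, of "[p]" 1] that by (simp add: tuples_def)
    ultimately show ?case by blast
  next
    case (Suc n)
    have "iter_comul Q (Suc (Suc n)) (\<pi> p) = tmap (Suc (Suc n)) P Q \<pi> (iter_comul P (Suc (Suc n)) p)"
      if p: "p \<in> vec P" for p
    proof -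
      let ?n = "Suc (Suc n)"
      have bl: "bilinear_on Q Q (tpow ?n Q) (\<lambda>x y. tcons (Suc n) Q x (iter_comul Q (Suc n) y))"
        by (rule bilinear_on_comp[OF bilinear_tcons[OF Qv] linear_on_id iter_comul_linear[OF Q]])
      have bl': "bilinear_on P P (tpow ?n P) (\<lambda>x y. tcons (Suc n) P x (iter_comul P (Suc n) y))"
        by (rule bilinear_on_comp[OF bilinear_tcons[OF Pv] linear_on_id iter_comul_linear[OF P]])
      have "iter_comul Q ?n (\<pi> p) =
          sweedler P (tpow ?n Q) (\<lambda>x y. tcons (Suc n) Q (\<pi> x) (iter_comul Q (Suc n) (\<pi> y))) p"
        using sweedler_hom[OF P Qv vspace_tpow \<pi> bl p] by simp
      also have "\<dots> = sweedler P (tpow ?n Q)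
          (\<lambda>x y. tmap ?n P Q \<pi> (tcons (Suc n) P x (iter_comul P (Suc n) y))) p"
        using Suc tmap_tcons[OF Pv Qv lin _ iter_comul_in[OF P]]
        by (intro fun_cong[OF sweedler_cong]) simp
      also have "\<dots> = tmap ?n P Q \<pi> (iter_comul P ?n p)"
        using linear_sweedler[OF P vspace_tpow vspace_tpow bl' tmap_linear[OF Pv lin] p] by simp
      finally show ?thesis .
    qed
    with Suc show ?case by blast
  qed
  then show "p \<in> vec P \<Longrightarrow> iter_comul Q n (\<pi> p) = tmap n P Q \<pi> (iter_comul P n p)" by simp
qed

lemma multilinear_tensor_action:
  assumes P: "vspace P" and A: "vspace A" and \<psi>: "bilinear_on P A A \<psi>"
    and x: "x \<in> vec (tpow n A)"
  shows "multilinear n P (tpow n A) (\<lambda>ps. tlift n A (tpow n A) (\<lambda>as. pure n A (map2 \<psi> ps as)) x)"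
  by (rule tlift_multilinear_param[OF P A vspace_tpow _ _ x])
    (rule multilinear_map2[OF \<psi> multilinear_pure]; assumption)+

lemma tensor_action_hom:
  assumes P: "coalgebra P" and Q: "coalgebra Q" and A: "vspace A" and \<pi>: "coalgebra_hom P Q \<pi>"
    and \<xi>: "bilinear_on Q A A \<xi>"
    and eq: "\<And>p a. p \<in> vec P \<Longrightarrow> a \<in> vec A \<Longrightarrow> \<xi> (\<pi> p) a = \<psi> p a"
    and p: "p \<in> vec P" and x: "x \<in> vec (tpow n A)"
  shows "tensor_action Q A \<xi> n (\<pi> p) x = tensor_action P A \<psi> n p x"
proof (cases "n = 0")
  case True
  then show ?thesis using coalgebra_homD(5)[OF \<pi> p] by (simp add: tensor_action_def)
next
  case False
  note Pv = coalgebraD(1)[OF P] and Qv = coalgebraD(1)[OF Q] and lin = coalgebra_homD(2)[OF \<pi>]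
  have "tensor_action Q A \<xi> n (\<pi> p) x = tlift n P (tpow n A)
      (\<lambda>ps. tlift n A (tpow n A) (\<lambda>as. pure n A (map2 \<xi> (map \<pi> ps) as)) x) (iter_comul P n p)"
    using False iter_comul_hom[OF P Q \<pi> p]
      tlift_tmap[OF Pv Qv vspace_tpow lin multilinear_tensor_action[OF Qv A \<xi> x] iter_comul_in[OF P p]]
    by (simp add: tensor_action_def)
  also have "\<dots> = tensor_action P A \<psi> n p x"
  proof -
    have "map2 \<xi> (map \<pi> ps) as = map2 \<psi> ps as" if "ps \<in> tuples n P" "as \<in> tuples n A" for ps as
      using that eq by (auto intro!: nth_equalityI simp: tuples_def subset_iff)
    then have "tlift n A (tpow n A) (\<lambda>as. pure n A (map2 \<xi> (map \<pi> ps) as)) =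
        tlift n A (tpow n A) (\<lambda>as. pure n A (map2 \<psi> ps as))" if "ps \<in> tuples n P" for ps
      using that by (intro tlift_cong) simp
    then have "tlift n P (tpow n A)
        (\<lambda>ps. tlift n A (tpow n A) (\<lambda>as. pure n A (map2 \<xi> (map \<pi> ps) as)) x) =
      tlift n P (tpow n A) (\<lambda>ps. tlift n A (tpow n A) (\<lambda>as. pure n A (map2 \<psi> ps as)) x)"
      by (intro tlift_cong) simp
    with False show ?thesis by (simp add: tensor_action_def)
  qed
  finally show ?thesis .
qed

lemma tensor_action_in:
  assumes P: "coalgebra P" and A: "vspace A" and \<psi>: "bilinear_on P A A \<psi>"
    and p: "p \<in> vec P" and x: "x \<in> vec (tpow n A)"
  shows "tensor_action P A \<psi> n p x \<in> vec (tpow n A)"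
  using linear_onD(1)[OF tlift_linear[OF coalgebraD(1)[OF P] vspace_tpow
        multilinear_tensor_action[OF coalgebraD(1)[OF P] A \<psi> x]] iter_comul_in[OF P p]]
    vspace_closed(4)[OF vspace_tpow x]
  by (auto simp: tensor_action_def)

text \<open>Every \<open>q\<close> is some \<pi>(p) and acts on each tensor power as
  \<open>p\<close> does, so the measuring condition descends. Used for the quotient by a coideal and
  for dropping extra record fields.\<close>

lemma measuring_image:
  assumes \<Omega>: "omega_algebra \<Omega> s t A ops" and P: "measuring \<Omega> s t P A ops \<psi>"
    and Q: "vspace Q" and \<pi>: "coalgebra_hom P Q \<pi>" and surj: "\<pi> ` vec P = vec Q"
    and \<xi>: "bilinear_on Q A A \<xi>"
    and eq: "\<And>p a. p \<in> vec P \<Longrightarrow> a \<in> vec A \<Longrightarrow> \<xi> (\<pi> p) a = \<psi> p a"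
  shows "measuring \<Omega> s t Q A ops \<xi>"
proof -
  have Pc: "coalgebra P" using P by (simp add: measuring_def)
  have A: "vspace A" using \<Omega> by (simp add: omega_algebra_def)
  have Qc: "coalgebra Q" by (rule coalgebra_image[OF Pc Q \<pi> surj])
  note hom = tensor_action_hom[OF Pc Qc A \<pi> \<xi> eq]
  have "tensor_action Q A \<xi> (t \<omega>) q (ops \<omega> x) = ops \<omega> (tensor_action Q A \<xi> (s \<omega>) q x)"
    if w: "\<omega> \<in> \<Omega>" and q: "q \<in> vec Q" and x: "x \<in> vec (tpow (s \<omega>) A)" for \<omega> q x
  proof -
    obtain p where p: "p \<in> vec P" "q = \<pi> p" using q surj by auto
    have "ops \<omega> x \<in> vec (tpow (t \<omega>) A)"
      using \<Omega> w x by (auto simp: omega_algebra_def linear_on_def)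
    then have "tensor_action Q A \<xi> (t \<omega>) q (ops \<omega> x) = tensor_action P A \<psi> (t \<omega>) p (ops \<omega> x)"
      using hom p by simp
    moreover have "tensor_action Q A \<xi> (s \<omega>) q x = tensor_action P A \<psi> (s \<omega>) p x"
      using hom p x by simp
    ultimately show ?thesis using P w p x by (simp add: measuring_def)
  qed
  with Qc \<xi> show ?thesis by (simp add: measuring_def)
qed

subsection \<open>Uniqueness of the universal bialgebra structure\<close>

text \<open>The definition quantifies over plain \<open>coalg\<close> records, whereas some
  measurings below come from bialgebra records. The universal property is moved to an arbitrary
  record extension by means of the truncated copy \<open>T\<close>.\<close>

lemma universal_measuring:
  fixes B :: "('f::field, 'u::ab_group_add) bialg" and P :: "('f, 'u, 'z) coalg_scheme"
  assumes \<Omega>: "omega_algebra \<Omega> s t A ops"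
    and U: "universal_acting_bialgebra \<Omega> s t A ops V B \<psi>"
    and P: "measuring \<Omega> s t P A ops \<xi>" "cosupp P A \<xi> \<subseteq> V"
  shows "\<exists>\<phi>. coalgebra_hom P B \<phi> \<and> (\<forall>p\<in>vec P. \<forall>a\<in>vec A. \<psi> (\<phi> p) a = \<xi> p a)" (is ?ex)
    and "coalgebra_hom P B \<phi> \<Longrightarrow> (\<And>p a. p \<in> vec P \<Longrightarrow> a \<in> vec A \<Longrightarrow> \<psi> (\<phi> p) a = \<xi> p a) \<Longrightarrow>
      coalgebra_hom P B \<phi>' \<Longrightarrow> (\<And>p a. p \<in> vec P \<Longrightarrow> a \<in> vec A \<Longrightarrow> \<psi> (\<phi>' p) a = \<xi> p a) \<Longrightarrow> \<phi> = \<phi>'"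
proof -
  define T :: "('f, 'u) coalg" where
    "T = \<lparr>vec = vec P, smul = smul P, comul = comul P, counit = counit P\<rparr>"
  have T [simp]: "vec T = vec P" "smul T = smul P" "comul T = comul P" "counit T = counit P"
    by (simp_all add: T_def)
  have Pc: "coalgebra P" and \<xi>: "bilinear_on P A A \<xi>" using P by (simp_all add: measuring_def)
  have Pv: "vspace P" by (rule coalgebraD[OF Pc])
  then have Tv: "vspace T" by (simp add: vspace_def)
  have Bv: "vspace B"
    using U by (simp add: universal_acting_bialgebra_def action_def bialgebra_def coalgebra_def)
  let ?i = "extend0 P (\<lambda>x. x)"
  have i: "coalgebra_hom P T ?i" by (rule coalgebra_hom_same[OF Pc]) simp_all
  have surj: "?i ` vec P = vec T" by (auto simp: extend0_def image_iff)
  have Tc: "coalgebra T" by (rule coalgebra_image[OF Pc Tv i surj])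
  have j: "coalgebra_hom T P ?i"
    using coalgebra_hom_same[OF Tc, of P] by (simp add: extend0_def)
  have "bilinear_on T A A \<xi>" using \<xi> by (simp add: bilinear_on_def linear_on_def)
  then have "measuring \<Omega> s t T A ops \<xi>"
    by (rule measuring_image[OF \<Omega> P(1) Tv i surj]) (simp add: extend0_def)
  moreover have "cosupp T A \<xi> \<subseteq> V" using P(2) by (simp add: cosupp_def)
  ultimately have ex1: "\<exists>!\<phi>. coalgebra_hom T B \<phi> \<and> (\<forall>p\<in>vec T. \<forall>a\<in>vec A. \<psi> (\<phi> p) a = \<xi> p a)"
    using U unfolding universal_acting_bialgebra_def by blast
  then obtain \<chi> where "coalgebra_hom T B \<chi>" "\<forall>p\<in>vec T. \<forall>a\<in>vec A. \<psi> (\<chi> p) a = \<xi> p a" by blast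
  then show ?ex
    using coalgebra_hom_comp[OF Pc Tv Bv i]
    by (intro exI[of _ "\<lambda>x. \<chi> (?i x)"]) (simp add: extend0_def)
  assume h: "coalgebra_hom P B \<phi>" "\<And>p a. p \<in> vec P \<Longrightarrow> a \<in> vec A \<Longrightarrow> \<psi> (\<phi> p) a = \<xi> p a"
    and h': "coalgebra_hom P B \<phi>'" "\<And>p a. p \<in> vec P \<Longrightarrow> a \<in> vec A \<Longrightarrow> \<psi> (\<phi>' p) a = \<xi> p a"
  \<comment> \<open>Precomposition with the identity map from \<open>T\<close> back to
    \<open>P\<close> puts both candidates where uniqueness is available.\<close>
  have "coalgebra_hom T B (\<lambda>x. \<phi> (?i x)) \<and> (\<forall>p\<in>vec T. \<forall>a\<in>vec A. \<psi> (\<phi> (?i p)) a = \<xi> p a)"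
    using coalgebra_hom_comp[OF Tc Pv Bv j h(1)] h(2) by (simp add: extend0_def)
  moreover have "coalgebra_hom T B (\<lambda>x. \<phi>' (?i x)) \<and> (\<forall>p\<in>vec T. \<forall>a\<in>vec A. \<psi> (\<phi>' (?i p)) a = \<xi> p a)"
    using coalgebra_hom_comp[OF Tc Pv Bv j h'(1)] h'(2) by (simp add: extend0_def)
  ultimately have eq: "(\<lambda>x. \<phi> (?i x)) = (\<lambda>x. \<phi>' (?i x))" using ex1 by blast
  show "\<phi> = \<phi>'"
  proof (rule Hom_eqI[OF coalgebra_homD(1)[OF h(1)] coalgebra_homD(1)[OF h'(1)]])
    fix x assume "x \<in> vec P"
    with fun_cong[OF eq, of x] show "\<phi> x = \<phi>' x" by (simp add: extend0_def)
  qed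
qed

text \<open>The projection onto a complement of \<open>span S\<close>: \<open>p x\<close> is a
  chosen representative of the class of \<open>x\<close>, so the image of \<open>p\<close> is a copy
  of the quotient by \<open>span S\<close> made of vectors of \<open>B\<close>.\<close>

lemma ex_projection:
  fixes B :: "('f::field, 'u::ab_group_add, 'z) vsp_scheme"
  assumes B: "vspace B" and S: "S \<subseteq> vec B"
  shows "\<exists>p. linear_on B B p \<and> (\<forall>s\<in>S. p s = 0) \<and>
    (\<forall>x\<in>vec B. x - p x \<in> module.span (smul B) S)"
proof -
  interpret vector_space "smul B" using B by (simp add: vspace_def)
  interpret vector_space_pair "smul B" "smul B" ..
  have sub: "subspace (vec B)" using B by (simp add: vspace_def)
  \<comment> \<open>\<open>E\<close> is a basis of \<open>span S\<close>, and \<open>F\<close>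
    extends it to a basis of \<open>vec B\<close>; \<open>p\<close> annihilates \<open>E\<close> and
    fixes the rest of \<open>F\<close>.\<close>
  obtain E where E: "E \<subseteq> S" "independent E" "S \<subseteq> span E"
    by (rule maximal_independent_subset)
  obtain F where F: "E \<subseteq> F" "F \<subseteq> vec B" "independent F" "vec B \<subseteq> span F"
    by (rule maximal_independent_subset_extend[of E "vec B"]) (use E S in auto)
  obtain p where p: "Vector_Spaces.linear (smul B) (smul B) p"
    and pF: "\<forall>x\<in>F. p x = (if x \<in> E then 0 else x)"
    using linear_independent_extend[OF F(3), of "\<lambda>x. if x \<in> E then 0 else x"] by blast
  have p0: "p 0 = 0" using p by (rule linear_0)
  have span_F: "span F \<subseteq> vec B" using F(2) sub by (rule span_minimal)
  have mem: "p x \<in> vec B \<and> x - p x \<in> span S" if "x \<in> span F" for x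
    using that
  proof (induction rule: span_induct_alt)
    case base
    show ?case using p0 sub by (simp add: subspace_0 span_zero)
  next
    case (step c x y)
    have add: "p (smul B c x + y) = smul B c (p x) + p y"
      using p by (simp add: linear_add linear_scale)
    have x: "p x \<in> vec B" "x - p x \<in> span S"
      using step(1) pF F(2) E(1) sub by (auto simp: subspace_0 span_zero intro: span_base)
    have "smul B c x + y - (smul B c (p x) + p y) = smul B c (x - p x) + (y - p y)"
      by (simp add: scale_right_diff_distrib)
    also have "\<dots> \<in> span S" using x step(2) by (intro span_add span_scale) auto
    finally show ?case using x step(2) sub unfolding add
      by (simp add: subspace_add subspace_scale)
  qed
  show ?thesis
  proof (intro exI[of _ p] conjI ballI)
    show "linear_on B B p"
      using mem F(4) p by (auto simp: linear_on_def linear_add linear_scale)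
    have "p s = 0" if "s \<in> span E" for s
      by (rule linear_eq_0_on_span[OF p _ that]) (use pF F(1) in auto)
    then show "p s = 0" if "s \<in> S" for s using that E(3) by auto
    show "x - p x \<in> span S" if "x \<in> vec B" for x using mem F(4) that by auto
  qed
qed

text \<open>A linear map that kills \<open>S\<close> kills \<open>span S\<close>, hence cannot
  distinguish \<open>x\<close> from its representative \<open>p x\<close>. This replaces factoring
  through a quotient space.\<close>

lemma linear_on_projection:
  assumes B: "vspace B" and S: "S \<subseteq> vec B" and p: "linear_on B B p"
    and diff: "\<forall>x\<in>vec B. x - p x \<in> module.span (smul B) S"
    and g: "linear_on B X g" "\<forall>s\<in>S. g s = 0" and X: "vspace X" and x: "x \<in> vec B"
  shows "g (p x) = g x"
proof -
  interpret vector_space "smul B" using B by (simp add: vspace_def)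
  have "subspace {x \<in> vec B. g x = 0}"
    using linear_onD(2,3)[OF g(1)] linear_on_0[OF g(1) B]
    by (intro subspaceI) (auto simp: vspace_closed[OF B] vspace_smul[OF X])
  then have "span S \<subseteq> {x \<in> vec B. g x = 0}" using S g(2) by (intro span_minimal) auto
  then have "g (x - p x) = 0" using diff x by auto
  then show ?thesis using linear_on_diff[OF g(1) B x linear_onD(1)[OF p x]] by simp
qed

lemma tmap_cong:
  assumes "\<And>x. x \<in> vec V \<Longrightarrow> f x = g x"
  shows "tmap n V W f = tmap n V W g"
proof -
  have "map f vs = map g vs" if "vs \<in> tuples n V" for vs
    using that assms by (auto simp: tuples_def)
  then show ?thesis unfolding tmap_def by (intro tlift_cong arg_cong[where f = "pure n W"])
qed

text \<open>
  \<open>S\<close> spans a coideal on which \<open>\<psi>\<close> vanishes, so the measuring \<open>\<psi>\<close> factors through the quotient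
  coalgebra, which is realised here on a complement. By universality the identity of \<open>B\<close> factors
  through the quotient as well. Unlike the usual argument with the coalgebra \<open>B \<otimes> B\<close>, this stays
  inside the type \<open>'u\<close>.
\<close>

lemma universal_coideal_trivial:
  fixes B :: "('f::field, 'u::ab_group_add) bialg"
  assumes \<Omega>: "omega_algebra \<Omega> s t A ops"
    and U: "universal_acting_bialgebra \<Omega> s t A ops V B \<psi>"
    and S: "S \<subseteq> vec B"
    and counit0: "\<And>x. x \<in> S \<Longrightarrow> counit B x = 0"
    and act0: "\<And>x a. x \<in> S \<Longrightarrow> a \<in> vec A \<Longrightarrow> \<psi> x a = 0"
    and comul0: "\<And>(W :: ('f, 'u) vsp) \<pi> x. vspace W \<Longrightarrow> linear_on B W \<pi> \<Longrightarrow>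
      (\<And>y. y \<in> S \<Longrightarrow> \<pi> y = 0) \<Longrightarrow> x \<in> S \<Longrightarrow> tmap 2 B W \<pi> (comul B x) = 0"
    and x: "x \<in> S"
  shows "x = 0"
proof -
  have M: "measuring \<Omega> s t B A ops \<psi>" and cosupp: "cosupp B A \<psi> \<subseteq> V"
    using U by (simp_all add: universal_acting_bialgebra_def action_def)
  have Bc: "coalgebra B" and \<psi>: "bilinear_on B A A \<psi>" using M by (simp_all add: measuring_def)
  have A: "vspace A" using \<Omega> by (simp add: omega_algebra_def)
  note Bv = coalgebraD(1)[OF Bc]
  obtain p where p: "linear_on B B p" "\<And>s. s \<in> S \<Longrightarrow> p s = 0"
    and diff: "\<forall>x\<in>vec B. x - p x \<in> module.span (smul B) S"
    using ex_projection[OF Bv S] by blast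
  note proj = linear_on_projection[OF Bv S p(1) diff]
  \<comment> \<open>\<open>Q0\<close> is the vector space underlying \<open>Q\<close>: the
    comultiplication of \<open>Q\<close> has to name its target before \<open>Q\<close> exists. A
    vector of the complement represents its own class, so its comultiplication is p \<otimes> p
    applied to the one taken in \<open>B\<close>.\<close>
  define Q0 :: "('f, 'u) vsp" where "Q0 = \<lparr>vec = p ` vec B, smul = smul B\<rparr>"
  define Q :: "('f, 'u) coalg" where
    "Q = \<lparr>vec = p ` vec B, smul = smul B, comul = (\<lambda>q. tmap 2 B Q0 p (comul B q)), counit = counit B\<rparr>"
  have Q [simp]: "vec Q = p ` vec B" "smul Q = smul B" "counit Q = counit B"
    and comul_Q: "comul Q q = tmap 2 B Q0 p (comul B q)"
    and Q0 [simp]: "vec Q0 = p ` vec B" "smul Q0 = smul B"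
    for q by (simp_all add: Q_def Q0_def)
  have sub: "p ` vec B \<subseteq> vec B" using p(1) by (auto simp: linear_on_def)
  have Q0v: "vspace Q0"
  proof -
    interpret vector_space "smul B" using Bv by (simp add: vspace_def)
    have "subspace (p ` vec B)"
    proof (rule subspaceI)
      show "0 \<in> p ` vec B"
        using linear_on_0[OF p(1) Bv] vspace_closed(1)[OF Bv] by force
    next
      fix x y assume "x \<in> p ` vec B" "y \<in> p ` vec B"
      then show "x + y \<in> p ` vec B"
        using linear_onD(2)[OF p(1)] vspace_closed(2)[OF Bv] by (auto simp: image_iff) metis
    next
      fix c x assume "x \<in> p ` vec B"
      then show "smul B c x \<in> p ` vec B"
        using linear_onD(3)[OF p(1)] vspace_closed(4)[OF Bv] by (auto simp: image_iff) metis
    qed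
    then show ?thesis by (simp add: vspace_def vector_space_axioms)
  qed
  then have Qv: "vspace Q" by (simp add: vspace_def)
  have pQ0: "linear_on B Q0 p" and pQ: "linear_on B Q p"
    using p(1) by (simp_all add: linear_on_def)
  have tmap_Q: "tmap n B Q0 f = tmap n B Q f" for n f
    using pure_vsp_cong[of Q0 Q n] tpow_vsp_cong[of Q0 Q n] by (simp add: tmap_def)
  let ?\<pi> = "extend0 B p"
  have \<pi>: "coalgebra_hom B Q ?\<pi>"
  proof (rule coalgebra_homI)
    show "?\<pi> \<in> Hom B Q" using Bv pQ by (rule extend0_Hom)
    fix c assume c: "c \<in> vec B"
    \<comment> \<open>Here the coideal property enters. With \<open>I\<close> the span of
      \<open>S\<close>, the hypothesis \<open>comul0\<close> phrases the inclusion of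
      \<open>comul B\<close> applied to \<open>S\<close> in I \<otimes> B + B \<otimes> I as
      annihilation by \<pi> \<otimes> \<pi> for every \<pi> killing \<open>S\<close>. Hence the
      composite takes equal values at \<open>c\<close> and at \<open>p c\<close>.\<close>
    have "tmap 2 B Q0 p (comul B (p c)) = tmap 2 B Q0 p (comul B c)"
      by (rule proj[OF linear_on_comp[OF coalgebraD(2)[OF Bc] tmap_linear[OF Bv pQ0]] _ vspace_tpow c])
        (use comul0[OF Q0v pQ0 p(2)] in blast)
    moreover have "tmap 2 B Q ?\<pi> = tmap 2 B Q p" by (rule tmap_cong) (simp add: extend0_def)
    moreover have "?\<pi> c = p c" using c by (simp add: extend0_def)
    ultimately show "comul Q (?\<pi> c) = tmap 2 B Q ?\<pi> (comul B c)"
      using tmap_Q[of 2 p] by (simp only: comul_Q)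
    show "counit Q (?\<pi> c) = counit B c"
      using proj[OF coalgebraD(3)[OF Bc] _ vspace_ground c] counit0 c by (simp add: extend0_def)
  qed
  have surj: "?\<pi> ` vec B = vec Q" by (simp add: extend0_def)
  have \<psi>Q: "bilinear_on Q A A \<psi>"
    using \<psi> sub by (auto simp: bilinear_on_def linear_on_def subset_iff)
  have \<psi>\<pi>: "\<psi> (?\<pi> b) a = \<psi> b a" if "b \<in> vec B" "a \<in> vec A" for a b
    using proj[OF bilinear_onD(2)[OF \<psi> that(2)] _ A that(1)] act0 that
    by (simp add: extend0_def)
  have MQ: "measuring \<Omega> s t Q A ops \<psi>"
    by (rule measuring_image[OF \<Omega> M Qv \<pi> surj \<psi>Q \<psi>\<pi>])
  moreover have "cosupp Q A \<psi> \<subseteq> V" using cosupp sub by (auto simp: cosupp_def)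
  ultimately obtain \<phi> where \<phi>: "coalgebra_hom Q B \<phi>"
    "\<And>q a. q \<in> vec Q \<Longrightarrow> a \<in> vec A \<Longrightarrow> \<psi> (\<phi> q) a = \<psi> q a"
    using universal_measuring(1)[OF \<Omega> U] by blast
  \<comment> \<open>The composite through \<open>Q\<close> and the identity are both morphisms from
    \<open>B\<close> to itself over \<psi>, so they coincide; but the composite annihilates
    \<open>S\<close>.\<close>
  have "(\<lambda>x. \<phi> (?\<pi> x)) = extend0 B (\<lambda>x. x)"
  proof (rule universal_measuring(2)[OF \<Omega> U M cosupp])
    show "coalgebra_hom B B (\<lambda>x. \<phi> (?\<pi> x))" by (rule coalgebra_hom_comp[OF Bc Qv Bv \<pi> \<phi>(1)])
    show "coalgebra_hom B B (extend0 B (\<lambda>x. x))" by (rule coalgebra_hom_same[OF Bc]) simp_all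
    show "\<psi> (\<phi> (?\<pi> b)) a = \<psi> b a" if "b \<in> vec B" "a \<in> vec A" for a b
      using \<phi>(2)[of "?\<pi> b" a] \<psi>\<pi> that by (simp add: extend0_def)
  qed (simp add: extend0_def)
  then have "\<phi> (?\<pi> x) = extend0 B (\<lambda>x. x) x" by (rule fun_cong)
  then have "\<phi> (?\<pi> x) = x" using x S by (simp add: extend0_def subset_iff)
  moreover have "?\<pi> x = 0" using x p(2) by (simp add: extend0_def)
  ultimately show "x = 0" using linear_on_0[OF coalgebra_homD(2)[OF \<phi>(1)] Qv] by simp
qed

subsection \<open>Duality of tensor powers\<close>

text \<open>Coordinates for a basis chosen inside a finite spanning set, extended by zero so that
  they are elements of \<open>dual A\<close>. All later uses of finite dimension go through
  this.\<close>

lemma ex_coordinates: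
  fixes A :: "('f::field, 'a::ab_group_add, 'y) vsp_scheme"
  assumes A: "vspace A" and "fin_dim A"
  obtains E co where "finite E" "E \<subseteq> vec A" "\<And>e. co e \<in> vec (dual A)"
    "\<And>v. v \<in> vec A \<Longrightarrow> v = (\<Sum>e\<in>E. smul A (co e v) e)"
proof -
  interpret vector_space "smul A" using A by (simp add: vspace_def)
  obtain S where S: "finite S" "S \<subseteq> vec A" "span S = vec A"
    using assms(2) by (auto simp: fin_dim_def)
  obtain E where E: "E \<subseteq> S" "independent E" "S \<subseteq> span E"
    by (rule maximal_independent_subset)
  have span: "span E = vec A"
    using E(1,3) S(3) span_mono[OF E(1)] span_mono[OF E(3)] by (auto simp: span_span)
  have fin: "finite E" using E(1) S(1) by (rule finite_subset)
  define co where "co e = extend0 A (\<lambda>v. representation E v e)" for e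
  have "co e \<in> vec (dual A)" for e
    unfolding co_def vec_dual
    by (rule extend0_Hom[OF A])
      (auto simp: linear_on_def span[symmetric] representation_add[OF E(2)] representation_scale[OF E(2)])
  moreover have "v = (\<Sum>e\<in>E. smul A (co e v) e)" if "v \<in> vec A" for v
    using sum_representation_eq[OF E(2), of v E] that fin span by (simp add: co_def extend0_def)
  ultimately show thesis using that[OF fin] E(1) S(2) by blast
qed

lemma dual_eval_linear: "a \<in> vec A \<Longrightarrow> linear_on (dual A) ground (\<lambda>g. g a)"
  by (auto simp: linear_on_def fscale_def)

lemma dualD: "g \<in> vec (dual A) \<Longrightarrow> linear_on A ground g"
  by (simp add: vec_dual Hom_def)

lemma multilinear_dual_pairing:
  shows "fs \<in> tuples n (dual A) \<Longrightarrow> multilinear n A ground (\<lambda>as. \<Prod>i<n. (fs ! i) (as ! i))"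
    and "as \<in> tuples n A \<Longrightarrow> multilinear n (dual A) ground (\<lambda>fs. \<Prod>i<n. (fs ! i) (as ! i))"
proof -
  show "fs \<in> tuples n (dual A) \<Longrightarrow> multilinear n A ground (\<lambda>as. \<Prod>i<n. (fs ! i) (as ! i))"
    by (rule multilinear_prod[where f = "\<lambda>i. fs ! i"]) (rule dualD[OF tuples_nth])
  show "as \<in> tuples n A \<Longrightarrow> multilinear n (dual A) ground (\<lambda>fs. \<Prod>i<n. (fs ! i) (as ! i))"
    by (rule multilinear_prod[where f = "\<lambda>i g. g (as ! i)"]) (rule dual_eval_linear[OF tuples_nth])
qed

lemma multilinear_tpow_dual:
  assumes A: "vspace A"
  shows "multilinear n (dual A) (dual (tpow n A)) (\<lambda>fs. tlift n A ground (\<lambda>as. \<Prod>i<n. (fs ! i) (as ! i)))"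
    (is "multilinear n _ _ ?L")
proof (rule multilinearI)
  have hom: "?L fs \<in> Hom (tpow n A) ground" if "fs \<in> tuples n (dual A)" for fs
    by (rule tlift_Hom[OF A vspace_ground multilinear_dual_pairing(1)[OF that]])
  fix fs assume fs: "fs \<in> tuples n (dual A)"
  show "?L fs \<in> vec (dual (tpow n A))" using hom[OF fs] by (simp add: vec_dual)
  fix i assume i: "i < n"
  have up: "fs[i := g] \<in> tuples n (dual A)" if "g \<in> vec (dual A)" for g
    using fs that by (rule tuples_update)
  have param: "linear_on (dual A) ground (\<lambda>g. ?L (fs[i := g]) T)" if "T \<in> vec (tpow n A)" for T
    using tlift_multilinear_param[OF vspace_dual[OF A] A vspace_ground
        multilinear_dual_pairing(1) multilinear_dual_pairing(2) that] fs i
    by (rule multilinearD(2))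
  \<comment> \<open>Elements of the dual are functions on the whole tensor type, so equality must
    also be checked off the carrier, where all of them vanish.\<close>
  have out: "?L (fs[i := g]) T = 0" if "g \<in> vec (dual A)" "T \<notin> vec (tpow n A)" for g T
    using HomD(2)[OF hom[OF up[OF that(1)]] that(2)] .
  note closed = vspace_closed[OF vspace_dual[OF A]]
  show "linear_on (dual A) (dual (tpow n A)) (\<lambda>g. ?L (fs[i := g]))"
  proof (rule linear_onI)
    fix g assume g: "g \<in> vec (dual A)"
    show "?L (fs[i := g]) \<in> vec (dual (tpow n A))" using hom[OF up[OF g]] by (simp add: vec_dual)
    fix c
    show "?L (fs[i := smul (dual A) c g]) = smul (dual (tpow n A)) c (?L (fs[i := g]))"
    proof
      fix T
      show "?L (fs[i := smul (dual A) c g]) T = smul (dual (tpow n A)) c (?L (fs[i := g])) T"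
        using linear_onD(3)[OF param g, of T c] out[OF g, of T] out[OF closed(4)[OF g], of T c]
        by (cases "T \<in> vec (tpow n A)") (simp_all add: fscale_def)
    qed
  next
    fix g h assume g: "g \<in> vec (dual A)" and h: "h \<in> vec (dual A)"
    show "?L (fs[i := g + h]) = ?L (fs[i := g]) + ?L (fs[i := h])"
    proof
      fix T
      show "?L (fs[i := g + h]) T = (?L (fs[i := g]) + ?L (fs[i := h])) T"
        using linear_onD(2)[OF param g h, of T] out[OF g, of T] out[OF h, of T]
          out[OF closed(2)[OF g h], of T]
        by (cases "T \<in> vec (tpow n A)") simp_all
    qed
  qed
qed

lemma tpow_dual_linear:
  "vspace A \<Longrightarrow> linear_on (tpow n (dual A)) (dual (tpow n A)) (tpow_dual n A)"
  unfolding tpow_dual_def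
  by (rule tlift_linear[OF vspace_dual vspace_dual[OF vspace_tpow] multilinear_tpow_dual])

lemma tpow_dual_pure:
  assumes A: "vspace A" and fs: "fs \<in> tuples n (dual A)" and as: "as \<in> tuples n A"
  shows "tpow_dual n A (pure n (dual A) fs) (pure n A as) = (\<Prod>i<n. (fs ! i) (as ! i))"
  using tlift_pure[OF vspace_dual[OF A] vspace_dual[OF vspace_tpow] multilinear_tpow_dual[OF A] fs]
    tlift_pure[OF A vspace_ground multilinear_dual_pairing(1)[OF fs] as]
  by (simp add: tpow_dual_def)

lemma tpow_dual_linear_left:
  "vspace A \<Longrightarrow> x \<in> vec (tpow n A) \<Longrightarrow> linear_on (tpow n (dual A)) ground (\<lambda>u. tpow_dual n A u x)"
  by (rule linear_on_comp[OF tpow_dual_linear dual_eval_linear])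

lemma tpow_dual_linear_right:
  "vspace A \<Longrightarrow> u \<in> vec (tpow n (dual A)) \<Longrightarrow> linear_on (tpow n A) ground (tpow_dual n A u)"
  by (rule dualD[OF linear_onD(1)[OF tpow_dual_linear]])

lemma linear_on_lincomb:
  assumes W: "vspace W" and "\<And>i. i \<in> I \<Longrightarrow> linear_on V ground (h i)" "\<And>i. i \<in> I \<Longrightarrow> w i \<in> vec W"
  shows "linear_on V W (\<lambda>x. \<Sum>i\<in>I. smul W (h i x) (w i))"
proof (rule linear_onI)
  fix x assume x: "x \<in> vec V"
  show "(\<Sum>i\<in>I. smul W (h i x) (w i)) \<in> vec W" using assms by (intro vspace_closed)
  show "(\<Sum>i\<in>I. smul W (h i (smul V c x)) (w i)) = smul W c (\<Sum>i\<in>I. smul W (h i x) (w i))" for c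
    using x linear_onD(3)[OF assms(2)] by (auto simp: vspace_smul[OF W] intro!: sum.cong)
  fix y assume y: "y \<in> vec V"
  show "(\<Sum>i\<in>I. smul W (h i (x + y)) (w i)) =
      (\<Sum>i\<in>I. smul W (h i x) (w i)) + (\<Sum>i\<in>I. smul W (h i y) (w i))"
    using x y linear_onD(2)[OF assms(2)]
    by (auto simp: vspace_smul[OF W] sum.distrib[symmetric] intro!: sum.cong)
qed

text \<open>The coefficient of \<open>co e\<close> is the value at \<open>e\<close>, as for a dual
  basis. So \<open>dual A\<close> has coordinates of the same shape as \<open>A\<close>, and
  \<open>multilinear_expand\<close> applies to it as well.\<close>

lemma dual_expand:
  assumes A: "vspace A" and E: "E \<subseteq> vec A" and co: "\<And>e. co e \<in> vec (dual A)"
    and exp: "\<And>v. v \<in> vec A \<Longrightarrow> v = (\<Sum>e\<in>E. smul A (co e v) e)"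
    and f: "f \<in> vec (dual A)"
  shows "f = (\<Sum>e\<in>E. smul (dual A) (f e) (co e))"
proof (rule Hom_eqI)
  show "f \<in> Hom A ground" using f by (simp add: vec_dual)
  have "(\<Sum>e\<in>E. smul (dual A) (f e) (co e)) \<in> vec (dual A)"
    using co by (intro vspace_closed(4,5)[OF vspace_dual[OF A]])
  then show "(\<Sum>e\<in>E. smul (dual A) (f e) (co e)) \<in> Hom A ground" by (simp add: vec_dual)
  fix v assume v: "v \<in> vec A"
  have "f v = f (\<Sum>e\<in>E. smul A (co e v) e)" using exp[OF v] by simp
  also have "\<dots> = (\<Sum>e\<in>E. co e v * f e)"
    using E linear_onD(3)[OF dualD[OF f]]
    by (subst linear_on_sum[OF dualD[OF f] A]) (auto intro!: sum.cong vspace_closed(4)[OF A])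
  also have "\<dots> = (\<Sum>e\<in>E. smul (dual A) (f e) (co e)) v"
    using linear_on_sum[OF dual_eval_linear[OF v] vspace_dual[OF A], of E "\<lambda>e. smul (dual A) (f e) (co e)"]
      vspace_closed(4)[OF vspace_dual[OF A] co]
    by (simp add: fscale_def mult.commute)
  finally show "f v = (\<Sum>e\<in>E. smul (dual A) (f e) (co e)) v" .
qed

text \<open>Words of length \<open>n\<close> in a basis and the matching words of coordinate
  functionals act as dual bases for the pairing \<open>tpow_dual\<close>. The two expansions contain
  its perfectness: nondegeneracy on either side and surjectivity onto the dual.\<close>

lemma tpow_dual_expand:
  fixes A :: "('f::field, 'a::ab_group_add, 'y) vsp_scheme"
  assumes A: "vspace A" and "fin_dim A"
  shows "\<exists>(I :: 'a list set) \<epsilon>. I \<subseteq> tuples n A \<and> (\<forall>es\<in>I. \<epsilon> es \<in> tuples n (dual A)) \<and>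
    (\<forall>x\<in>vec (tpow n A).
      x = (\<Sum>es\<in>I. fscale (tpow_dual n A (pure n (dual A) (\<epsilon> es)) x) (pure n A es))) \<and>
    (\<forall>u\<in>vec (tpow n (dual A)).
      u = (\<Sum>es\<in>I. fscale (tpow_dual n A u (pure n A es)) (pure n (dual A) (\<epsilon> es))))"
proof -
  note D = vspace_dual[OF A]
  obtain E co where E: "finite E" "E \<subseteq> vec A" and co: "\<And>e. co e \<in> vec (dual A)"
    and exp: "\<And>v. v \<in> vec A \<Longrightarrow> v = (\<Sum>e\<in>E. smul A (co e v) e)"
    using ex_coordinates[OF assms] by blast
  define I where "I = {es. set es \<subseteq> E \<and> length es = n}"
  define \<epsilon> where "\<epsilon> = map co"
  have I: "I \<subseteq> tuples n A" using E(2) by (auto simp: I_def tuples_def)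
  have \<epsilon>: "\<epsilon> es \<in> tuples n (dual A)" if "es \<in> I" for es
    using that co by (auto simp: \<epsilon>_def I_def tuples_def)
  have p: "pure n A es \<in> vec (tpow n A)" if "es \<in> I" for es using that I by (auto intro: pure_in_tpow)
  have pd: "pure n (dual A) (\<epsilon> es) \<in> vec (tpow n (dual A))" if "es \<in> I" for es
    using \<epsilon>[OF that] by (rule pure_in_tpow)
  have "x = (\<Sum>es\<in>I. fscale (tpow_dual n A (pure n (dual A) (\<epsilon> es)) x) (pure n A es))"
    if "x \<in> vec (tpow n A)" for x
  proof (rule tensor_ext[OF linear_on_id _ _ that])
    show "linear_on (tpow n A) (tpow n A)
        (\<lambda>x. \<Sum>es\<in>I. fscale (tpow_dual n A (pure n (dual A) (\<epsilon> es)) x) (pure n A es))"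
      using linear_on_lincomb[OF vspace_tpow[of n A] tpow_dual_linear_right[OF A pd] p] by simp
    fix as assume as: "as \<in> tuples n A"
    have "pure n A as = (\<Sum>es\<in>I. fscale (\<Prod>i<n. co (es ! i) (as ! i)) (pure n A es))"
      using multilinear_expand[OF A vspace_tpow E(1) subsetD[OF E(2)] exp multilinear_pure as]
      by (simp add: I_def)
    also have "\<dots> = (\<Sum>es\<in>I. fscale (tpow_dual n A (pure n (dual A) (\<epsilon> es)) (pure n A as)) (pure n A es))"
      using tpow_dual_pure[OF A \<epsilon> as]
      by (intro sum.cong refl arg_cong2[where f = fscale]) (simp add: \<epsilon>_def I_def)
    finally show "pure n A as =
      (\<Sum>es\<in>I. fscale (tpow_dual n A (pure n (dual A) (\<epsilon> es)) (pure n A as)) (pure n A es))" .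
  qed
  moreover have "u = (\<Sum>es\<in>I. fscale (tpow_dual n A u (pure n A es)) (pure n (dual A) (\<epsilon> es)))"
    if "u \<in> vec (tpow n (dual A))" for u
  proof (rule tensor_ext[OF linear_on_id _ _ that])
    show "linear_on (tpow n (dual A)) (tpow n (dual A))
        (\<lambda>u. \<Sum>es\<in>I. fscale (tpow_dual n A u (pure n A es)) (pure n (dual A) (\<epsilon> es)))"
      using linear_on_lincomb[OF vspace_tpow[of n "dual A"] tpow_dual_linear_left[OF A p] pd] by simp
    fix fs assume fs: "fs \<in> tuples n (dual A)"
    have "pure n (dual A) fs = (\<Sum>es\<in>I. fscale (\<Prod>i<n. (fs ! i) (es ! i)) (pure n (dual A) (\<epsilon> es)))"
      using multilinear_expand[OF D vspace_tpow E(1) co dual_expand[OF A E(2) co exp] multilinear_pure fs]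
      by (simp add: I_def \<epsilon>_def)
    also have "\<dots> = (\<Sum>es\<in>I. fscale (tpow_dual n A (pure n (dual A) fs) (pure n A es)) (pure n (dual A) (\<epsilon> es)))"
      using tpow_dual_pure[OF A fs] I by (intro sum.cong refl arg_cong2[where f = fscale]) auto
    finally show "pure n (dual A) fs =
      (\<Sum>es\<in>I. fscale (tpow_dual n A (pure n (dual A) fs) (pure n A es)) (pure n (dual A) (\<epsilon> es)))" .
  qed
  ultimately show ?thesis using I \<epsilon> by (intro exI[of _ I] exI[of _ \<epsilon>]) blast
qed

lemma tpow_dual_separates:
  assumes A: "vspace A" and "fin_dim A" and x: "x \<in> vec (tpow n A)" and y: "y \<in> vec (tpow n A)"
    and eq: "\<And>u. u \<in> vec (tpow n (dual A)) \<Longrightarrow> tpow_dual n A u x = tpow_dual n A u y"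
  shows "x = y"
proof -
  obtain I \<epsilon> where "I \<subseteq> tuples n A" and \<epsilon>': "\<forall>es\<in>I. \<epsilon> es \<in> tuples n (dual A)"
    and exp': "\<forall>x\<in>vec (tpow n A).
      x = (\<Sum>es\<in>I. fscale (tpow_dual n A (pure n (dual A) (\<epsilon> es)) x) (pure n A es))"
    using tpow_dual_expand[OF assms(1,2), of n] by (elim exE conjE) (rule that)
  note \<epsilon> = \<epsilon>'[rule_format] and exp = exp'[rule_format]
  have "x = (\<Sum>es\<in>I. fscale (tpow_dual n A (pure n (dual A) (\<epsilon> es)) y) (pure n A es))"
    using exp[OF x] eq[OF pure_in_tpow[OF \<epsilon>]] by simp
  with exp[OF y] show ?thesis by simp
qed

lemma tpow_dual_eqI:
  assumes A: "vspace A" and "fin_dim A"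
    and u: "u \<in> vec (tpow n (dual A))" and v: "v \<in> vec (tpow n (dual A))"
    and eq: "\<And>x. x \<in> vec (tpow n A) \<Longrightarrow> tpow_dual n A u x = tpow_dual n A v x"
  shows "u = v"
proof -
  obtain I \<epsilon> where I: "I \<subseteq> tuples n A"
    and exp': "\<forall>u\<in>vec (tpow n (dual A)).
      u = (\<Sum>es\<in>I. fscale (tpow_dual n A u (pure n A es)) (pure n (dual A) (\<epsilon> es)))"
    using tpow_dual_expand[OF assms(1,2), of n] by (elim exE conjE) (rule that)
  note exp = exp'[rule_format]
  have "u = (\<Sum>es\<in>I. fscale (tpow_dual n A v (pure n A es)) (pure n (dual A) (\<epsilon> es)))"
    using exp[OF u] eq[OF pure_in_tpow] I by (simp add: subset_iff)
  with exp[OF v] show ?thesis by simp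
qed

lemma tpow_dual_bij:
  assumes A: "vspace A" and fin: "fin_dim A"
  shows "bij_betw (tpow_dual n A) (vec (tpow n (dual A))) (vec (dual (tpow n A)))"
  unfolding bij_betw_def
proof
  show "inj_on (tpow_dual n A) (vec (tpow n (dual A)))"
    using tpow_dual_eqI[OF A fin] by (auto intro: inj_onI)
  show "tpow_dual n A ` vec (tpow n (dual A)) = vec (dual (tpow n A))"
  proof (intro equalityI subsetI)
    fix g assume g: "g \<in> vec (dual (tpow n A))"
    obtain I \<epsilon> where I: "I \<subseteq> tuples n A" and \<epsilon>': "\<forall>es\<in>I. \<epsilon> es \<in> tuples n (dual A)"
      and exp': "\<forall>x\<in>vec (tpow n A).
        x = (\<Sum>es\<in>I. fscale (tpow_dual n A (pure n (dual A) (\<epsilon> es)) x) (pure n A es))"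
      using tpow_dual_expand[OF assms(1,2), of n] by (elim exE conjE) (rule that)
    note \<epsilon> = \<epsilon>'[rule_format] and exp = exp'[rule_format]
    have p: "pure n A es \<in> vec (tpow n A)" if "es \<in> I" for es
      using that I by (auto intro: pure_in_tpow)
    have pd: "fscale c (pure n (dual A) (\<epsilon> es)) \<in> vec (tpow n (dual A))" if "es \<in> I" for es c
      using vspace_closed(4)[OF vspace_tpow pure_in_tpow[OF \<epsilon>[OF that]]] by simp
    \<comment> \<open>The preimage of \<open>g\<close> has as coefficients the values of
      \<open>g\<close> on the basis tensors.\<close>
    define u where "u = (\<Sum>es\<in>I. fscale (g (pure n A es)) (pure n (dual A) (\<epsilon> es)))"
    have u: "u \<in> vec (tpow n (dual A))"
      unfolding u_def using pd by (intro vspace_closed(5)[OF vspace_tpow])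
    have "tpow_dual n A u = g"
    proof (rule Hom_eqI)
      show "tpow_dual n A u \<in> Hom (tpow n A) ground"
        using linear_onD(1)[OF tpow_dual_linear[OF A] u] by (simp add: vec_dual)
      show "g \<in> Hom (tpow n A) ground" using g by (simp add: vec_dual)
      fix x assume x: "x \<in> vec (tpow n A)"
      note l = tpow_dual_linear_left[OF A x]
      have "tpow_dual n A u x =
          (\<Sum>es\<in>I. tpow_dual n A (fscale (g (pure n A es)) (pure n (dual A) (\<epsilon> es))) x)"
        unfolding u_def by (rule linear_on_sum[OF l vspace_tpow pd])
      also have "\<dots> = (\<Sum>es\<in>I. g (pure n A es) * tpow_dual n A (pure n (dual A) (\<epsilon> es)) x)"
        using linear_onD(3)[OF l pure_in_tpow[OF \<epsilon>]] by (intro sum.cong) auto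
      also have "\<dots> = (\<Sum>es\<in>I. g (fscale (tpow_dual n A (pure n (dual A) (\<epsilon> es)) x) (pure n A es)))"
        using linear_onD(3)[OF dualD[OF g] p] by (intro sum.cong) (auto simp: mult.commute)
      also have "\<dots> = g x"
        using linear_on_sum[OF dualD[OF g] vspace_tpow, of I
            "\<lambda>es. fscale (tpow_dual n A (pure n (dual A) (\<epsilon> es)) x) (pure n A es)"]
          vspace_closed(4)[OF vspace_tpow p] exp[OF x] by simp
      finally show "tpow_dual n A u x = g x" .
    qed
    with u show "g \<in> tpow_dual n A ` vec (tpow n (dual A))" by blast
  qed (use linear_onD(1)[OF tpow_dual_linear[OF A]] in auto)
qed

text \<open>Bijectivity of \<open>tpow_dual\<close> gives the \<open>the_inv_into\<close> in
  \<open>dual_ops\<close> its meaning. The second claim makes the dual operation the adjoint of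
  \<open>ops \<omega>\<close>, and this is the form in which it is used from here on.\<close>

lemma dual_ops_pairing:
  assumes \<Omega>: "omega_algebra \<Omega> s t A ops" and fin: "fin_dim A" and w: "\<omega> \<in> \<Omega>"
    and u: "u \<in> vec (tpow (t \<omega>) (dual A))"
  shows "dual_ops s t A ops \<omega> u \<in> vec (tpow (s \<omega>) (dual A))"
    and "x \<in> vec (tpow (s \<omega>) A) \<Longrightarrow>
      tpow_dual (s \<omega>) A (dual_ops s t A ops \<omega> u) x = tpow_dual (t \<omega>) A u (ops \<omega> x)"
proof -
  have A: "vspace A" and ops: "linear_on (tpow (s \<omega>) A) (tpow (t \<omega>) A) (ops \<omega>)"
    using \<Omega> w by (auto simp: omega_algebra_def)
  let ?g = "transpose (tpow (s \<omega>) A) (ops \<omega>) (tpow_dual (t \<omega>) A u)"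
  have g: "?g \<in> vec (dual (tpow (s \<omega>) A))"
    unfolding vec_dual transpose_def
    by (rule extend0_Hom[OF vspace_tpow linear_on_comp[OF ops tpow_dual_linear_right[OF A u]]])
  note bij = tpow_dual_bij[OF A fin, of "s \<omega>"]
  then have inj: "inj_on (tpow_dual (s \<omega>) A) (vec (tpow (s \<omega>) (dual A)))"
    and g': "?g \<in> tpow_dual (s \<omega>) A ` vec (tpow (s \<omega>) (dual A))"
    using g by (simp_all add: bij_betw_def)
  show "dual_ops s t A ops \<omega> u \<in> vec (tpow (s \<omega>) (dual A))"
    unfolding dual_ops_def using the_inv_into_into[OF inj g'] by blast
  show "tpow_dual (s \<omega>) A (dual_ops s t A ops \<omega> u) x = tpow_dual (t \<omega>) A u (ops \<omega> x)"
    if "x \<in> vec (tpow (s \<omega>) A)"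
    unfolding dual_ops_def f_the_inv_into_f[OF inj g'] using that by (simp add: transpose_def extend0_def)
qed

lemma omega_algebra_dual:
  assumes \<Omega>: "omega_algebra \<Omega> s t A ops" and fin: "fin_dim A"
  shows "omega_algebra \<Omega> t s (dual A) (dual_ops s t A ops)"
proof -
  have A: "vspace A" using \<Omega> by (simp add: omega_algebra_def)
  have "linear_on (tpow (t \<omega>) (dual A)) (tpow (s \<omega>) (dual A)) (dual_ops s t A ops \<omega>)" if w: "\<omega> \<in> \<Omega>" for \<omega>
  proof (rule linear_onI)
    note pair = dual_ops_pairing[OF \<Omega> fin w]
    note closed = vspace_closed[OF vspace_tpow[of _ "dual A"]]
    have ops: "ops \<omega> x \<in> vec (tpow (t \<omega>) A)" if "x \<in> vec (tpow (s \<omega>) A)" for x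
      using \<Omega> w that by (auto simp: omega_algebra_def linear_on_def)
    fix u assume u: "u \<in> vec (tpow (t \<omega>) (dual A))"
    then show "dual_ops s t A ops \<omega> u \<in> vec (tpow (s \<omega>) (dual A))" by (rule pair)
    fix c
    show "dual_ops s t A ops \<omega> (smul (tpow (t \<omega>) (dual A)) c u) =
        smul (tpow (s \<omega>) (dual A)) c (dual_ops s t A ops \<omega> u)"
    proof (rule tpow_dual_eqI[OF A fin])
      fix x assume x: "x \<in> vec (tpow (s \<omega>) A)"
      show "tpow_dual (s \<omega>) A (dual_ops s t A ops \<omega> (smul (tpow (t \<omega>) (dual A)) c u)) x =
          tpow_dual (s \<omega>) A (smul (tpow (s \<omega>) (dual A)) c (dual_ops s t A ops \<omega> u)) x"
        unfolding pair(2)[OF closed(4)[OF u] x] linear_onD(3)[OF tpow_dual_linear_left[OF A x] pair(1)[OF u]]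
          linear_onD(3)[OF tpow_dual_linear_left[OF A ops[OF x]] u] pair(2)[OF u x] ..
    qed (use pair(1) closed(4) u in blast)+
  next
    note pair = dual_ops_pairing[OF \<Omega> fin w]
    note closed = vspace_closed[OF vspace_tpow[of _ "dual A"]]
    have ops: "ops \<omega> x \<in> vec (tpow (t \<omega>) A)" if "x \<in> vec (tpow (s \<omega>) A)" for x
      using \<Omega> w that by (auto simp: omega_algebra_def linear_on_def)
    fix u v assume u: "u \<in> vec (tpow (t \<omega>) (dual A))" and v: "v \<in> vec (tpow (t \<omega>) (dual A))"
    show "dual_ops s t A ops \<omega> (u + v) = dual_ops s t A ops \<omega> u + dual_ops s t A ops \<omega> v"
    proof (rule tpow_dual_eqI[OF A fin])
      fix x assume x: "x \<in> vec (tpow (s \<omega>) A)"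
      show "tpow_dual (s \<omega>) A (dual_ops s t A ops \<omega> (u + v)) x =
          tpow_dual (s \<omega>) A (dual_ops s t A ops \<omega> u + dual_ops s t A ops \<omega> v) x"
        unfolding pair(2)[OF closed(2)[OF u v] x]
          linear_onD(2)[OF tpow_dual_linear_left[OF A x] pair(1)[OF u] pair(1)[OF v]]
          linear_onD(2)[OF tpow_dual_linear_left[OF A ops[OF x]] u v] pair(2)[OF u x] pair(2)[OF v x] ..
    qed (use pair(1) closed(2) u v in blast)+
  qed
  with A show ?thesis by (simp add: omega_algebra_def vspace_dual)
qed

subsection \<open>Duality of measurings\<close>

text \<open>On pure tensors both sides are the product of the numbers
  \<open>f_i (\<psi> p_i a_i)\<close>. The same tensor \<open>iter_comul P n p\<close> enters on
  both sides with its factors in the same order, so the comultiplication is not reversed. In degree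
  0 both sides are scaled by the counit.\<close>

lemma tensor_action_dual:
  assumes P: "coalgebra P" and A: "vspace A"
    and \<psi>: "bilinear_on P A A \<psi>" and \<chi>: "bilinear_on P (dual A) (dual A) \<chi>"
    and pairing: "\<And>p g a. p \<in> vec P \<Longrightarrow> g \<in> vec (dual A) \<Longrightarrow> a \<in> vec A \<Longrightarrow> \<chi> p g a = g (\<psi> p a)"
    and p: "p \<in> vec P" and u: "u \<in> vec (tpow n (dual A))" and x: "x \<in> vec (tpow n A)"
  shows "tpow_dual n A (tensor_action P (dual A) \<chi> n p u) x = tpow_dual n A u (tensor_action P A \<psi> n p x)"
proof (cases "n = 0")
  case True
  then show ?thesis
    using linear_onD(3)[OF tpow_dual_linear_left[OF A x] u, of "counit P p"]
      linear_onD(3)[OF tpow_dual_linear_right[OF A u] x, of "counit P p"]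
    by (simp add: tensor_action_def)
next
  case False
  note Pv = coalgebraD(1)[OF P] and D = vspace_dual[OF A]
  let ?G = "\<lambda>ps. tlift n (dual A) (tpow n (dual A)) (\<lambda>fs. pure n (dual A) (map2 \<chi> ps fs))"
  let ?H = "\<lambda>ps. tlift n A (tpow n A) (\<lambda>as. pure n A (map2 \<psi> ps as))"
  have mG: "multilinear n (dual A) (tpow n (dual A)) (\<lambda>fs. pure n (dual A) (map2 \<chi> ps fs))"
    if "ps \<in> tuples n P" for ps
    by (rule multilinear_map2(2)[OF \<chi> multilinear_pure that])
  have mH: "multilinear n A (tpow n A) (\<lambda>as. pure n A (map2 \<psi> ps as))" if "ps \<in> tuples n P" for ps
    by (rule multilinear_map2(2)[OF \<psi> multilinear_pure that])
  note lG = tlift_linear[OF D vspace_tpow mG] and lH = tlift_linear[OF A vspace_tpow mH]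
  have pure_pure: "tpow_dual n A (?G ps (pure n (dual A) fs)) (pure n A as) =
      tpow_dual n A (pure n (dual A) fs) (?H ps (pure n A as))"
    if ps: "ps \<in> tuples n P" and fs: "fs \<in> tuples n (dual A)" and as: "as \<in> tuples n A" for ps fs as
  proof -
    have "map2 \<chi> ps fs \<in> tuples n (dual A)"
      by (rule tuples_map2[OF ps fs]) (rule bilinear_onD(3)[OF \<chi>])
    moreover have "map2 \<psi> ps as \<in> tuples n A"
      by (rule tuples_map2[OF ps as]) (rule bilinear_onD(3)[OF \<psi>])
    ultimately show ?thesis
      using ps fs as pairing tuples_nth[OF ps] tuples_nth[OF fs] tuples_nth[OF as]
      by (simp add: tlift_pure[OF D vspace_tpow mG] tlift_pure[OF A vspace_tpow mH] tpow_dual_pure[OF A]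
          tuples_length)
  qed
  \<comment> \<open>Linearity is exploited one argument at a time: here in the functionals and the
    vectors, afterwards in the tensor of elements of \<open>P\<close>.\<close>
  have pure: "tpow_dual n A (?G ps u) x = tpow_dual n A u (?H ps x)" if ps: "ps \<in> tuples n P" for ps
  proof (rule tensor_ext[OF linear_on_comp[OF lG[OF ps] tpow_dual_linear_left[OF A x]]
        tpow_dual_linear_left[OF A linear_onD(1)[OF lH[OF ps] x]] _ u])
    fix fs assume fs: "fs \<in> tuples n (dual A)"
    show "tpow_dual n A (?G ps (pure n (dual A) fs)) x = tpow_dual n A (pure n (dual A) fs) (?H ps x)"
      by (rule tensor_ext[OF tpow_dual_linear_right[OF A linear_onD(1)[OF lG[OF ps] pure_in_tpow[OF fs]]]
            linear_on_comp[OF lH[OF ps] tpow_dual_linear_right[OF A pure_in_tpow[OF fs]]]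
            pure_pure[OF ps fs] x])
  qed
  have MG: "multilinear n P (tpow n (dual A)) (\<lambda>ps. ?G ps u)"
    by (rule multilinear_tensor_action[OF Pv D \<chi> u])
  have MH: "multilinear n P (tpow n A) (\<lambda>ps. ?H ps x)"
    by (rule multilinear_tensor_action[OF Pv A \<psi> x])
  have "tpow_dual n A (tlift n P (tpow n (dual A)) (\<lambda>ps. ?G ps u) T) x =
      tpow_dual n A u (tlift n P (tpow n A) (\<lambda>ps. ?H ps x) T)" if T: "T \<in> vec (tpow n P)" for T
  proof (rule tensor_ext[OF linear_on_comp[OF tlift_linear[OF Pv vspace_tpow MG] tpow_dual_linear_left[OF A x]]
        linear_on_comp[OF tlift_linear[OF Pv vspace_tpow MH] tpow_dual_linear_right[OF A u]] _ T])
    fix ps assume ps: "ps \<in> tuples n P"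
    show "tpow_dual n A (tlift n P (tpow n (dual A)) (\<lambda>ps. ?G ps u) (pure n P ps)) x =
        tpow_dual n A u (tlift n P (tpow n A) (\<lambda>ps. ?H ps x) (pure n P ps))"
      unfolding tlift_pure[OF Pv vspace_tpow MG ps] tlift_pure[OF Pv vspace_tpow MH ps]
      by (rule pure[OF ps])
  qed
  from this[OF iter_comul_in[OF P p]] False show ?thesis by (simp add: tensor_action_def)
qed

text \<open>The dual condition at \<open>u\<close> paired with \<open>x\<close> is the original
  condition at \<open>x\<close> paired with \<open>u\<close>. The pairing separates points in both
  arguments, which gives the two implications.\<close>

lemma measuring_dual_iff:
  assumes \<Omega>: "omega_algebra \<Omega> s t A ops" and fin: "fin_dim A"
    and \<psi>: "bilinear_on P A A \<psi>" and \<chi>: "bilinear_on P (dual A) (dual A) \<chi>"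
    and pairing: "\<And>p g a. p \<in> vec P \<Longrightarrow> g \<in> vec (dual A) \<Longrightarrow> a \<in> vec A \<Longrightarrow> \<chi> p g a = g (\<psi> p a)"
  shows "measuring \<Omega> t s P (dual A) (dual_ops s t A ops) \<chi> \<longleftrightarrow> measuring \<Omega> s t P A ops \<psi>"
proof (cases "coalgebra P")
  case P: True
  have A: "vspace A" using \<Omega> by (simp add: omega_algebra_def)
  note D = vspace_dual[OF A]
  have act: "tpow_dual n A (tensor_action P (dual A) \<chi> n p u) x =
      tpow_dual n A u (tensor_action P A \<psi> n p x)"
    if "p \<in> vec P" "u \<in> vec (tpow n (dual A))" "x \<in> vec (tpow n A)" for n p u x
    using tensor_action_dual[OF P A \<psi> \<chi> pairing that] .
  have "(\<forall>u\<in>vec (tpow (t \<omega>) (dual A)). tensor_action P (dual A) \<chi> (s \<omega>) p (dual_ops s t A ops \<omega> u) =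
        dual_ops s t A ops \<omega> (tensor_action P (dual A) \<chi> (t \<omega>) p u)) \<longleftrightarrow>
      (\<forall>x\<in>vec (tpow (s \<omega>) A). tensor_action P A \<psi> (t \<omega>) p (ops \<omega> x) =
        ops \<omega> (tensor_action P A \<psi> (s \<omega>) p x))" (is "?l \<longleftrightarrow> ?r")
    if w: "\<omega> \<in> \<Omega>" and p: "p \<in> vec P" for \<omega> p
  proof -
    note pair = dual_ops_pairing[OF \<Omega> fin w]
    have ops: "ops \<omega> x \<in> vec (tpow (t \<omega>) A)" if "x \<in> vec (tpow (s \<omega>) A)" for x
      using \<Omega> w that by (auto simp: omega_algebra_def linear_on_def)
    note in\<psi> = tensor_action_in[OF P A \<psi> p] and in\<chi> = tensor_action_in[OF P D \<chi> p]
    \<comment> \<open>The sides change places: the left side of the dual condition pairs to the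
      right side of the original one, and \<open>right\<close> is the converse.\<close>
    have left: "tpow_dual (s \<omega>) A (tensor_action P (dual A) \<chi> (s \<omega>) p (dual_ops s t A ops \<omega> u)) x =
        tpow_dual (t \<omega>) A u (ops \<omega> (tensor_action P A \<psi> (s \<omega>) p x))"
      if "u \<in> vec (tpow (t \<omega>) (dual A))" "x \<in> vec (tpow (s \<omega>) A)" for u x
      using act[OF p pair(1)[OF that(1)] that(2)] pair(2)[OF that(1) in\<psi>[OF that(2)]] by simp
    have right: "tpow_dual (s \<omega>) A (dual_ops s t A ops \<omega> (tensor_action P (dual A) \<chi> (t \<omega>) p u)) x =
        tpow_dual (t \<omega>) A u (tensor_action P A \<psi> (t \<omega>) p (ops \<omega> x))"
      if "u \<in> vec (tpow (t \<omega>) (dual A))" "x \<in> vec (tpow (s \<omega>) A)" for u x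
      using pair(2)[OF in\<chi>[OF that(1)] that(2)] act[OF p that(1) ops[OF that(2)]] by simp
    show ?thesis
    proof
      assume l: ?l
      show ?r
      proof
        fix x assume x: "x \<in> vec (tpow (s \<omega>) A)"
        show "tensor_action P A \<psi> (t \<omega>) p (ops \<omega> x) = ops \<omega> (tensor_action P A \<psi> (s \<omega>) p x)"
        proof (rule tpow_dual_separates[OF A fin in\<psi>[OF ops[OF x]] ops[OF in\<psi>[OF x]]])
          fix u assume u: "u \<in> vec (tpow (t \<omega>) (dual A))"
          show "tpow_dual (t \<omega>) A u (tensor_action P A \<psi> (t \<omega>) p (ops \<omega> x)) =
              tpow_dual (t \<omega>) A u (ops \<omega> (tensor_action P A \<psi> (s \<omega>) p x))"
            using left[OF u x] right[OF u x] l u by simp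
        qed
      qed
    next
      assume r: ?r
      show ?l
      proof
        fix u assume u: "u \<in> vec (tpow (t \<omega>) (dual A))"
        show "tensor_action P (dual A) \<chi> (s \<omega>) p (dual_ops s t A ops \<omega> u) =
            dual_ops s t A ops \<omega> (tensor_action P (dual A) \<chi> (t \<omega>) p u)"
        proof (rule tpow_dual_eqI[OF A fin in\<chi>[OF pair(1)[OF u]] pair(1)[OF in\<chi>[OF u]]])
          fix x assume x: "x \<in> vec (tpow (s \<omega>) A)"
          show "tpow_dual (s \<omega>) A (tensor_action P (dual A) \<chi> (s \<omega>) p (dual_ops s t A ops \<omega> u)) x =
              tpow_dual (s \<omega>) A (dual_ops s t A ops \<omega> (tensor_action P (dual A) \<chi> (t \<omega>) p u)) x"
            using left[OF u x] right[OF u x] r x by simp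
        qed
      qed
    qed
  qed
  then show ?thesis using P \<psi> \<chi> by (simp add: measuring_def)
qed (simp add: measuring_def)

section \<open>Bidual and dual operators, and the correspondence of measurings\<close>

lemma dual_separates:
  assumes A: "vspace A" and "fin_dim A" and "a \<in> vec A" "b \<in> vec A"
    and eq: "\<And>g. g \<in> vec (dual A) \<Longrightarrow> g a = g b"
  shows "a = b"
proof -
  obtain E co where "finite E" "E \<subseteq> vec A" and co: "\<And>e. co e \<in> vec (dual A)"
    and exp: "\<And>v. v \<in> vec A \<Longrightarrow> v = (\<Sum>e\<in>E. smul A (co e v) e)"
    using ex_coordinates[OF assms(1,2)] by blast
  have "a = (\<Sum>e\<in>E. smul A (co e b) e)" using exp[OF assms(3)] eq[OF co] by simp
  with exp[OF assms(4)] show ?thesis by simp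
qed

lemma to_bidual_bij:
  assumes A: "vspace A" and fin: "fin_dim A"
  shows "bij_betw (to_bidual A) (vec A) (vec (dual (dual A)))"
proof -
  note D = vspace_dual[OF A]
  have in_DD: "to_bidual A a \<in> vec (dual (dual A))" if "a \<in> vec A" for a
    unfolding vec_dual[of "dual A"] to_bidual_def
    by (rule extend0_Hom[OF D dual_eval_linear[OF that]])
  have "inj_on (to_bidual A) (vec A)"
  proof (rule inj_onI)
    fix a b assume ab: "a \<in> vec A" "b \<in> vec A" "to_bidual A a = to_bidual A b"
    show "a = b"
    proof (rule dual_separates[OF A fin ab(1,2)])
      fix g assume "g \<in> vec (dual A)"
      with fun_cong[OF ab(3), of g] show "g a = g b" by (simp add: to_bidual_def extend0_def)
    qed
  qed
  moreover have "\<Phi> \<in> to_bidual A ` vec A" if \<Phi>: "\<Phi> \<in> vec (dual (dual A))" for \<Phi>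
  proof -
    obtain E co where E: "finite E" "E \<subseteq> vec A" and co: "\<And>e. co e \<in> vec (dual A)"
      and exp: "\<And>v. v \<in> vec A \<Longrightarrow> v = (\<Sum>e\<in>E. smul A (co e v) e)"
      using ex_coordinates[OF assms(1,2)] by blast
    have expd: "f = (\<Sum>e\<in>E. smul (dual A) (f e) (co e))" if "f \<in> vec (dual A)" for f
      using dual_expand[OF A E(2) co exp that] .
    \<comment> \<open>The only candidate: the values of \<Phi> on the coordinate functionals must be
      the coordinates of the vector.\<close>
    define a where "a = (\<Sum>e\<in>E. smul A (\<Phi> (co e)) e)"
    have term_in: "smul A c e \<in> vec A" if "e \<in> E" for c e
      using that E(2) by (auto intro: vspace_closed(4)[OF A])
    then have a: "a \<in> vec A" unfolding a_def by (intro vspace_closed(5)[OF A])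
    have "to_bidual A a = \<Phi>"
    proof (rule Hom_eqI)
      show "to_bidual A a \<in> Hom (dual A) ground" "\<Phi> \<in> Hom (dual A) ground"
        using in_DD[OF a] \<Phi> by (simp_all add: vec_dual)
      fix f assume f: "f \<in> vec (dual A)"
      have "to_bidual A a f = f a" using f by (simp add: to_bidual_def extend0_def)
      also have "\<dots> = (\<Sum>e\<in>E. f e * \<Phi> (co e))"
        unfolding a_def using E(2) linear_onD(3)[OF dualD[OF f]] term_in
        by (subst linear_on_sum[OF dualD[OF f] A]) (auto intro!: sum.cong)
      also have "\<dots> = \<Phi> (\<Sum>e\<in>E. smul (dual A) (f e) (co e))"
        using linear_on_sum[OF dualD[OF \<Phi>] D, of E "\<lambda>e. smul (dual A) (f e) (co e)"]
          vspace_closed(4)[OF D co] linear_onD(3)[OF dualD[OF \<Phi>] co] by simp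
      also have "\<dots> = \<Phi> f" using expd[OF f] by simp
      finally show "to_bidual A a f = \<Phi> f" .
    qed
    with a show ?thesis by blast
  qed
  ultimately show ?thesis using in_DD by (auto simp: bij_betw_def)
qed

text \<open>The adjunction that characterises the dual operator; it frees later arguments from the
  inverse of \<open>to_bidual\<close>.\<close>

lemma dual_operator_pairing:
  assumes A: "vspace A" and fin: "fin_dim A" and f: "linear_on (dual A) (dual A) f" and a: "a \<in> vec A"
  shows "dual_operator A f a \<in> vec A"
    and "g \<in> vec (dual A) \<Longrightarrow> g (dual_operator A f a) = f g a"
proof -
  let ?\<Phi> = "transpose (dual A) f (to_bidual A a)"
  note bij = to_bidual_bij[OF A fin]
  have "linear_on (dual A) ground (\<lambda>g. to_bidual A a (f g))"
    using bij a by (intro linear_on_comp[OF f] dualD) (auto simp: bij_betw_def)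
  then have "?\<Phi> \<in> vec (dual (dual A))"
    unfolding transpose_def vec_dual[of "dual A"] by (rule extend0_Hom[OF vspace_dual[OF A]])
  then have \<Phi>: "?\<Phi> \<in> to_bidual A ` vec A" using bij by (simp add: bij_betw_def)
  have inj: "inj_on (to_bidual A) (vec A)" using bij by (simp add: bij_betw_def)
  have d: "dual_operator A f a = the_inv_into (vec A) (to_bidual A) ?\<Phi>"
    using a by (simp add: dual_operator_def extend0_def)
  show "dual_operator A f a \<in> vec A" unfolding d using the_inv_into_into[OF inj \<Phi>] by blast
  assume g: "g \<in> vec (dual A)"
  have "to_bidual A (dual_operator A f a) g = ?\<Phi> g"
    unfolding d f_the_inv_into_f[OF inj \<Phi>] ..
  then show "g (dual_operator A f a) = f g a"
    using g linear_onD(1)[OF f g] by (simp add: to_bidual_def transpose_def extend0_def)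
qed

text \<open>Bilinearity of \<psi> holds because equations in \<open>A\<close> may be tested against
  functionals, where they become those for \<chi>. \<open>extend0\<close> brings \<chi>(p) to the
  form in which it occurs in \<open>cosupp\<close>.\<close>

lemma measuring_from_dual:
  assumes \<Omega>: "omega_algebra \<Omega> s t A ops" and fin: "fin_dim A"
    and M: "measuring \<Omega> t s P (dual A) (dual_ops s t A ops) \<chi>" and cosupp: "cosupp P (dual A) \<chi> \<subseteq> V"
  defines "\<psi> \<equiv> \<lambda>p. dual_operator A (extend0 (dual A) (\<chi> p))"
  shows "measuring \<Omega> s t P A ops \<psi>" and "cosupp P A \<psi> \<subseteq> dual_operator A ` V"
    and "p \<in> vec P \<Longrightarrow> g \<in> vec (dual A) \<Longrightarrow> a \<in> vec A \<Longrightarrow> g (\<psi> p a) = \<chi> p g a"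
proof -
  have A: "vspace A" using \<Omega> by (simp add: omega_algebra_def)
  have P: "coalgebra P" and \<chi>: "bilinear_on P (dual A) (dual A) \<chi>" using M by (simp_all add: measuring_def)
  note D = vspace_dual[OF A] and Pv = coalgebraD(1)[OF P]
  have lin: "linear_on (dual A) (dual A) (extend0 (dual A) (\<chi> p))" if "p \<in> vec P" for p
    using bilinear_onD(1)[OF \<chi> that] linear_on_extend0[OF D] by blast
  have in_A: "\<psi> p a \<in> vec A" if "p \<in> vec P" "a \<in> vec A" for p a
    unfolding \<psi>_def by (rule dual_operator_pairing(1)[OF A fin lin[OF that(1)] that(2)])
  have pair: "g (\<psi> p a) = \<chi> p g a" if "p \<in> vec P" "g \<in> vec (dual A)" "a \<in> vec A" for p g a
    using dual_operator_pairing(2)[OF A fin lin[OF that(1)] that(3,2)] that(2)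
    by (simp add: \<psi>_def extend0_def)
  then show "p \<in> vec P \<Longrightarrow> g \<in> vec (dual A) \<Longrightarrow> a \<in> vec A \<Longrightarrow> g (\<psi> p a) = \<chi> p g a" .
  have \<chi>A: "linear_on A ground (\<chi> p g)" if "p \<in> vec P" "g \<in> vec (dual A)" for p g
    by (rule dualD[OF bilinear_onD(3)[OF \<chi> that]])
  have \<psi>: "bilinear_on P A A \<psi>"
    unfolding bilinear_on_def
  proof (intro conjI ballI)
    fix p assume p: "p \<in> vec P"
    show "linear_on A A (\<psi> p)"
    proof (rule linear_onI)
      fix a assume a: "a \<in> vec A"
      show "\<psi> p a \<in> vec A" using p a by (rule in_A)
      show "\<psi> p (smul A c a) = smul A c (\<psi> p a)" for c
        by (rule dual_separates[OF A fin])
          (simp_all add: p a in_A vspace_closed[OF A] pair linear_onD(3)[OF \<chi>A] linear_onD(3)[OF dualD])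
      show "\<psi> p (a + b) = \<psi> p a + \<psi> p b" if b: "b \<in> vec A" for b
        by (rule dual_separates[OF A fin])
          (simp_all add: p a b in_A vspace_closed[OF A] pair linear_onD(2)[OF \<chi>A] linear_onD(2)[OF dualD])
    qed
  next
    fix a assume a: "a \<in> vec A"
    show "linear_on P A (\<lambda>p. \<psi> p a)"
    proof (rule linear_onI)
      fix p assume p: "p \<in> vec P"
      show "\<psi> p a \<in> vec A" using p a by (rule in_A)
      show "\<psi> (smul P c p) a = smul A c (\<psi> p a)" for c
        by (rule dual_separates[OF A fin])
          (simp_all add: p a in_A vspace_closed[OF A] vspace_closed[OF Pv] pair
            linear_onD(3)[OF bilinear_onD(2)[OF \<chi>]] linear_onD(3)[OF dualD] fscale_def)
      show "\<psi> (p + q) a = \<psi> p a + \<psi> q a" if q: "q \<in> vec P" for q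
        by (rule dual_separates[OF A fin])
          (simp_all add: p q a in_A vspace_closed[OF A] vspace_closed[OF Pv] pair
            linear_onD(2)[OF bilinear_onD(2)[OF \<chi>]] linear_onD(2)[OF dualD])
    qed
  qed
  show "measuring \<Omega> s t P A ops \<psi>"
    using M measuring_dual_iff[OF \<Omega> fin \<psi> \<chi>] pair by simp
  \<comment> \<open>\<open>dual_operator\<close> already vanishes off \<open>vec A\<close>, so
    extension by zero changes nothing.\<close>
  have "extend0 A (\<psi> p) = dual_operator A (extend0 (dual A) (\<chi> p))" for p
    by (simp add: \<psi>_def dual_operator_def extend0_def fun_eq_iff)
  then show "cosupp P A \<psi> \<subseteq> dual_operator A ` V" using cosupp by (auto simp: cosupp_def)
qed

text \<open>The reverse passage is explicit, by transposition. That the cosupport lands in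
  \<open>V\<close> again rests on an endomorphism of \<open>dual A\<close> being determined by its
  dual operator.\<close>

lemma measuring_to_dual:
  assumes \<Omega>: "omega_algebra \<Omega> s t A ops" and fin: "fin_dim A" and V: "V \<subseteq> End (dual A)"
    and M: "measuring \<Omega> s t P A ops \<psi>" and cosupp: "cosupp P A \<psi> \<subseteq> dual_operator A ` V"
  defines "\<chi> \<equiv> \<lambda>p. transpose A (\<psi> p)"
  shows "measuring \<Omega> t s P (dual A) (dual_ops s t A ops) \<chi>" and "cosupp P (dual A) \<chi> \<subseteq> V"
    and "a \<in> vec A \<Longrightarrow> \<chi> p g a = g (\<psi> p a)"
proof -
  have A: "vspace A" using \<Omega> by (simp add: omega_algebra_def)
  have P: "coalgebra P" and \<psi>: "bilinear_on P A A \<psi>" using M by (simp_all add: measuring_def)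
  note D = vspace_dual[OF A] and Pv = coalgebraD(1)[OF P]
  have pair: "\<chi> p g a = g (\<psi> p a)" if "a \<in> vec A" for p g a
    using that by (simp add: \<chi>_def transpose_def extend0_def)
  then show "a \<in> vec A \<Longrightarrow> \<chi> p g a = g (\<psi> p a)" .
  have out: "\<chi> p g a = 0" if "a \<notin> vec A" for p g a
    using that by (simp add: \<chi>_def transpose_def extend0_def)
  have in_D: "\<chi> p g \<in> vec (dual A)" if "p \<in> vec P" "g \<in> vec (dual A)" for p g
    unfolding \<chi>_def transpose_def vec_dual
    by (rule extend0_Hom[OF A linear_on_comp[OF bilinear_onD(1)[OF \<psi> that(1)] dualD[OF that(2)]]])
  have \<chi>: "bilinear_on P (dual A) (dual A) \<chi>"
    unfolding bilinear_on_def
  proof (intro conjI ballI)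
    fix p assume p: "p \<in> vec P"
    show "linear_on (dual A) (dual A) (\<chi> p)"
      using in_D[OF p]
      by (auto simp: linear_on_def \<chi>_def transpose_def extend0_def fscale_def fun_eq_iff)
  next
    fix g assume g: "g \<in> vec (dual A)"
    show "linear_on P (dual A) (\<lambda>p. \<chi> p g)"
    proof (rule linear_onI)
      fix p assume p: "p \<in> vec P"
      show "\<chi> p g \<in> vec (dual A)" using p g by (rule in_D)
      show "\<chi> (smul P c p) g = smul (dual A) c (\<chi> p g)" for c
      proof
        fix a show "\<chi> (smul P c p) g a = smul (dual A) c (\<chi> p g) a"
          using p linear_onD(3)[OF bilinear_onD(2)[OF \<psi>]] linear_onD(3)[OF dualD[OF g]] bilinear_onD(3)[OF \<psi>]
          by (cases "a \<in> vec A") (simp_all add: pair out fscale_def)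
      qed
      show "\<chi> (p + q) g = \<chi> p g + \<chi> q g" if q: "q \<in> vec P" for q
      proof
        fix a show "\<chi> (p + q) g a = (\<chi> p g + \<chi> q g) a"
          using p q linear_onD(2)[OF bilinear_onD(2)[OF \<psi>]] linear_onD(2)[OF dualD[OF g]] bilinear_onD(3)[OF \<psi>]
          by (cases "a \<in> vec A") (simp_all add: pair out)
      qed
    qed
  qed
  show "measuring \<Omega> t s P (dual A) (dual_ops s t A ops) \<chi>"
    using M measuring_dual_iff[OF \<Omega> fin \<psi> \<chi>] pair by simp
  show "cosupp P (dual A) \<chi> \<subseteq> V"
  proof
    fix h assume "h \<in> cosupp P (dual A) \<chi>"
    then obtain p where p: "p \<in> vec P" and h: "h = extend0 (dual A) (\<chi> p)" by (auto simp: cosupp_def)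
    then obtain f where f: "f \<in> V" and ef: "extend0 A (\<psi> p) = dual_operator A f"
      using cosupp by (auto simp: cosupp_def)
    have fE: "f \<in> End (dual A)" using f V by auto
    \<comment> \<open>\<open>f\<close> is a member of \<open>V\<close> whose dual operator is
      \<psi>(p); the transpose of \<psi>(p) is then \<open>f\<close> itself.\<close>
    have "h = f"
    proof (rule Hom_eqI[OF _ fE])
      show "h \<in> End (dual A)" unfolding h by (rule extend0_Hom[OF D bilinear_onD(1)[OF \<chi> p]])
      fix g assume g: "g \<in> vec (dual A)"
      have "\<chi> p g = f g"
      proof (rule Hom_eqI)
        show "\<chi> p g \<in> Hom A ground" using in_D[OF p g] by (simp add: vec_dual)
        show "f g \<in> Hom A ground" using linear_onD(1)[OF HomD(1)[OF fE] g] by (simp add: vec_dual)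
        fix a assume a: "a \<in> vec A"
        have "\<psi> p a = dual_operator A f a" using fun_cong[OF ef, of a] a by (simp add: extend0_def)
        then show "\<chi> p g a = f g a"
          using dual_operator_pairing(2)[OF A fin HomD(1)[OF fE] a g] by (simp add: pair[OF a])
      qed
      then show "h g = f g" using g by (simp add: h extend0_def)
    qed
    with f show "h \<in> V" by simp
  qed
qed

subsection \<open>The isomorphism\<close>

lemma tmap_tmap:
  assumes U: "vspace U" and V: "vspace V" and f: "linear_on U V f" and g: "linear_on V W g"
    and T: "T \<in> vec (tpow n U)"
  shows "tmap n V W g (tmap n U V f T) = tmap n U W (\<lambda>x. g (f x)) T"
  using tlift_tmap[OF U V vspace_tpow f multilinear_map[OF multilinear_pure g] T]
  by (simp add: tmap_def comp_def)

text \<open>Multiplicativity of the comultiplication, pushed forward along f \<otimes> f. Keeping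
  \<open>f\<close> around each product makes it possible to use relations that hold only after
  applying \<open>f\<close>.\<close>

lemma tmap_comul_mul:
  assumes B: "bialgebra B" and W: "vspace W" and f: "linear_on B W f"
    and x: "x \<in> vec B" and y: "y \<in> vec B"
  shows "tmap 2 B W f (comul B (mul B x y)) =
    sweedler B (tpow 2 W) (\<lambda>x1 x2. sweedler B (tpow 2 W) (\<lambda>y1 y2.
      pure 2 W [f (mul B x1 y1), f (mul B x2 y2)]) y) x"
proof -
  have Bc: "coalgebra B" and mul: "bilinear_on B B B (mul B)" using B by (simp_all add: bialgebra_def)
  note Bv = coalgebraD(1)[OF Bc]
  have bl1: "bilinear_on B B (tpow 2 B) (\<lambda>y1 y2. pure 2 B [mul B x1 y1, mul B x2 y2])"
    if "x1 \<in> vec B" "x2 \<in> vec B" for x1 x2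
    by (rule bilinear_on_comp[OF bilinear_pure[OF Bv]]) (rule bilinear_onD(1)[OF mul], fact)+
  have bl2: "bilinear_on B B (tpow 2 B) (\<lambda>x1 x2. pure 2 B [mul B x1 y1, mul B x2 y2])"
    if "y1 \<in> vec B" "y2 \<in> vec B" for y1 y2
    by (rule bilinear_on_comp[OF bilinear_pure[OF Bv]]) (rule bilinear_onD(2)[OF mul], fact)+
  note tl = tmap_linear[OF Bv f]
  have "tmap 2 B W f (comul B (mul B x y)) = tmap 2 B W f (sweedler B (tpow 2 B) (\<lambda>x1 x2.
      sweedler B (tpow 2 B) (\<lambda>y1 y2. pure 2 B [mul B x1 y1, mul B x2 y2]) y) x)"
    using B x y by (simp add: bialgebra_def)
  also have "\<dots> = sweedler B (tpow 2 W) (\<lambda>x1 x2. tmap 2 B W f (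
      sweedler B (tpow 2 B) (\<lambda>y1 y2. pure 2 B [mul B x1 y1, mul B x2 y2]) y)) x"
    using sweedler_bilinear_param[OF Bv Bc vspace_tpow bl1 bl2 y]
    by (rule linear_sweedler[OF Bc vspace_tpow vspace_tpow _ tl x])
  also have "\<dots> = sweedler B (tpow 2 W) (\<lambda>x1 x2. sweedler B (tpow 2 W) (\<lambda>y1 y2.
      pure 2 W [f (mul B x1 y1), f (mul B x2 y2)]) y) x"
  proof (rule fun_cong[OF sweedler_cong])
    fix x1 x2 assume x12: "x1 \<in> vec B" "x2 \<in> vec B"
    have "tmap 2 B W f (sweedler B (tpow 2 B) (\<lambda>y1 y2. pure 2 B [mul B x1 y1, mul B x2 y2]) y) =
        sweedler B (tpow 2 W) (\<lambda>y1 y2. tmap 2 B W f (pure 2 B [mul B x1 y1, mul B x2 y2])) y"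
      by (rule linear_sweedler[OF Bc vspace_tpow vspace_tpow bl1[OF x12] tl y])
    also have "\<dots> = sweedler B (tpow 2 W) (\<lambda>y1 y2. pure 2 W [f (mul B x1 y1), f (mul B x2 y2)]) y"
      using x12 bilinear_onD(3)[OF mul]
      by (intro fun_cong[OF sweedler_cong]) (simp add: tmap_pure[OF Bv f] tuples_2)
    finally show "tmap 2 B W f (sweedler B (tpow 2 B) (\<lambda>y1 y2. pure 2 B [mul B x1 y1, mul B x2 y2]) y) =
      sweedler B (tpow 2 W) (\<lambda>y1 y2. pure 2 W [f (mul B x1 y1), f (mul B x2 y2)]) y" .
  qed
  finally show ?thesis .
qed

theorem theorem4p16:
  fixes \<Omega> :: "'o set" and s t :: "'o \<Rightarrow> nat"
    and A :: "('f::field, 'a::ab_group_add) vsp"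
    and ops :: "'o \<Rightarrow> ('f, 'a) tensor \<Rightarrow> ('f, 'a) tensor"
    and V :: "(('a \<Rightarrow> 'f) \<Rightarrow> ('a \<Rightarrow> 'f)) set"
    and B B' :: "('f, 'u::ab_group_add) bialg"
    and \<psi> :: "'u \<Rightarrow> ('a \<Rightarrow> 'f) \<Rightarrow> ('a \<Rightarrow> 'f)"
    and \<psi>' :: "'u \<Rightarrow> 'a \<Rightarrow> 'a"
  assumes "omega_algebra \<Omega> s t A ops"
    and "fin_dim A"
    and "unital_subalgebra_End (dual A) V"
    and "universal_acting_bialgebra \<Omega> t s (dual A) (dual_ops s t A ops) V B \<psi>"
    and "universal_acting_bialgebra \<Omega> s t A ops (dual_operator A ` V) B' \<psi>'"
  shows "\<exists>\<phi>. bialgebra_iso B (bialg_op B') \<phi>"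
proof -
  note \<Omega> = assms(1) and fin = assms(2) and U = assms(4) and U' = assms(5)
  have V: "V \<subseteq> End (dual A)" using assms(3) by (simp add: unital_subalgebra_End_def)
  have A: "vspace A" using \<Omega> by (simp add: omega_algebra_def)
  note D = vspace_dual[OF A] and \<Omega>D = omega_algebra_dual[OF \<Omega> fin]
  have act: "action \<Omega> t s B (dual A) (dual_ops s t A ops) \<psi>" and cosupp: "cosupp B (dual A) \<psi> \<subseteq> V"
    and act': "action \<Omega> s t B' A ops \<psi>'" and cosupp': "cosupp B' A \<psi>' \<subseteq> dual_operator A ` V"
    using U U' unfolding universal_acting_bialgebra_def by blast+
  have B: "bialgebra B" and M: "measuring \<Omega> t s B (dual A) (dual_ops s t A ops) \<psi>"
    and B': "bialgebra B'" and M': "measuring \<Omega> s t B' A ops \<psi>'"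
    using act act' unfolding action_def by blast+
  have Bc: "coalgebra B" and mul: "bilinear_on B B B (mul B)" and one: "unity B \<in> vec B"
    and B'c: "coalgebra B'" and mul': "bilinear_on B' B' B' (mul B')" and one': "unity B' \<in> vec B'"
    using B B' unfolding bialgebra_def by blast+
  have \<psi>: "bilinear_on B (dual A) (dual A) \<psi>" and \<psi>': "bilinear_on B' A A \<psi>'"
    using M M' by (simp_all add: measuring_def)
  note Bv = coalgebraD(1)[OF Bc] and B'v = coalgebraD(1)[OF B'c]
  note M_A = measuring_from_dual[OF \<Omega> fin M cosupp] and M'_D = measuring_to_dual[OF \<Omega> fin V M' cosupp']

  \<comment> \<open>\<open>B\<close> measures \<open>A\<close> through dual operators and
    \<open>B'\<close> measures \<open>dual A\<close> through transposes; each universal property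
    yields one of two coalgebra maps, tied to the actions by \<open>pair\<close> and
    \<open>pair'\<close>.\<close>
  obtain \<phi> where \<phi>: "coalgebra_hom B B' \<phi>"
    and "\<forall>b\<in>vec B. \<forall>a\<in>vec A. \<psi>' (\<phi> b) a = dual_operator A (extend0 (dual A) (\<psi> b)) a"
    using universal_measuring(1)[OF \<Omega> U' M_A(1,2)] by blast
  then have pair: "g (\<psi>' (\<phi> b) a) = \<psi> b g a" if "b \<in> vec B" "g \<in> vec (dual A)" "a \<in> vec A" for b g a
    using M_A(3)[OF that] that by simp
  obtain \<phi>' where \<phi>': "coalgebra_hom B' B \<phi>'"
    and "\<forall>b\<in>vec B'. \<forall>g\<in>vec (dual A). \<psi> (\<phi>' b) g = transpose A (\<psi>' b) g"
    using universal_measuring(1)[OF \<Omega>D U M'_D(1,2)] by blast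
  then have pair': "\<psi> (\<phi>' b) g a = g (\<psi>' b a)" if "b \<in> vec B'" "g \<in> vec (dual A)" "a \<in> vec A" for b g a
    using M'_D(3)[OF that(3)] that by simp
  note \<phi>_lin = coalgebra_homD(2)[OF \<phi>] and \<phi>_in = coalgebra_homD(3)[OF \<phi>] and \<phi>'_in = coalgebra_homD(3)[OF \<phi>']
  note \<psi>_in = bilinear_onD(3)[OF \<psi>] and \<psi>'_in = bilinear_onD(3)[OF \<psi>']
  note mul_in = bilinear_onD(3)[OF mul] and mul'_in = bilinear_onD(3)[OF mul']

  \<comment> \<open>This composite and the one in the other order respect the respective universal
    measurings, so uniqueness makes them identities.\<close>
  have "(\<lambda>x. \<phi>' (\<phi> x)) = extend0 B (\<lambda>x. x)"
  proof (rule universal_measuring(2)[OF \<Omega>D U M cosupp])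
    show "coalgebra_hom B B (\<lambda>x. \<phi>' (\<phi> x))" by (rule coalgebra_hom_comp[OF Bc B'v Bv \<phi> \<phi>'])
    show "coalgebra_hom B B (extend0 B (\<lambda>x. x))" by (rule coalgebra_hom_same[OF Bc]) simp_all
    fix b g assume b: "b \<in> vec B" and g: "g \<in> vec (dual A)"
    show "\<psi> (\<phi>' (\<phi> b)) g = \<psi> b g"
    proof (rule Hom_eqI)
      show "\<psi> (\<phi>' (\<phi> b)) g \<in> Hom A ground" "\<psi> b g \<in> Hom A ground"
        using \<psi>_in[OF _ g] \<phi>_in \<phi>'_in b by (simp_all add: vec_dual)
      show "\<psi> (\<phi>' (\<phi> b)) g a = \<psi> b g a" if "a \<in> vec A" for a
        using pair'[OF \<phi>_in[OF b] g that] pair[OF b g that] by simp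
    qed
  qed (simp add: extend0_def)
  then have inv: "\<phi>' (\<phi> b) = b" if "b \<in> vec B" for b
    using that by (auto simp: extend0_def dest: fun_cong[of _ _ b])
  have "(\<lambda>x. \<phi> (\<phi>' x)) = extend0 B' (\<lambda>x. x)"
  proof (rule universal_measuring(2)[OF \<Omega> U' M' cosupp'])
    show "coalgebra_hom B' B' (\<lambda>x. \<phi> (\<phi>' x))" by (rule coalgebra_hom_comp[OF B'c Bv B'v \<phi>' \<phi>])
    show "coalgebra_hom B' B' (extend0 B' (\<lambda>x. x))" by (rule coalgebra_hom_same[OF B'c]) simp_all
    fix b a assume b: "b \<in> vec B'" and a: "a \<in> vec A"
    show "\<psi>' (\<phi> (\<phi>' b)) a = \<psi>' b a"
    proof (rule dual_separates[OF A fin])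
      show "\<psi>' (\<phi> (\<phi>' b)) a \<in> vec A" "\<psi>' b a \<in> vec A"
        using \<psi>'_in[OF _ a] \<phi>_in \<phi>'_in b by simp_all
      show "g (\<psi>' (\<phi> (\<phi>' b)) a) = g (\<psi>' b a)" if "g \<in> vec (dual A)" for g
        using pair[OF \<phi>'_in[OF b] that a] pair'[OF b that a] by simp
    qed
  qed (simp add: extend0_def)
  then have inv': "\<phi> (\<phi>' b) = b" if "b \<in> vec B'" for b
    using that by (auto simp: extend0_def dest: fun_cong[of _ _ b])
  have bij: "bij_betw \<phi> (vec B) (vec B')"
    by (rule bij_betw_byWitness[where f' = \<phi>']) (use inv inv' \<phi>_in \<phi>'_in in auto)

  \<comment> \<open>The defects of \<phi> as a unital antihomomorphism. Once all of them vanish,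
    \<phi> is multiplicative and unital into \<open>bialg_op B'\<close>.\<close>
  define S where "S = (\<lambda>(x, y). \<phi> (mul B x y) - mul B' (\<phi> y) (\<phi> x)) ` (vec B \<times> vec B) \<union>
    {\<phi> (unity B) - unity B'}"
  have S_mul: "\<phi> (mul B x y) - mul B' (\<phi> y) (\<phi> x) \<in> S" if "x \<in> vec B" "y \<in> vec B" for x y
    using that by (auto simp: S_def)
  have S_one: "\<phi> (unity B) - unity B' \<in> S" by (simp add: S_def)
  have S_cases: "Q z" if "z \<in> S"
    and "\<And>x y. x \<in> vec B \<Longrightarrow> y \<in> vec B \<Longrightarrow> Q (\<phi> (mul B x y) - mul B' (\<phi> y) (\<phi> x))"
    and "Q (\<phi> (unity B) - unity B')" for z Q
    using that by (auto simp: S_def)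
  have S0: "z = 0" if z: "z \<in> S" for z
  proof (rule universal_coideal_trivial[OF \<Omega> U' _ _ _ _ z])
    show "S \<subseteq> vec B'"
      using \<phi>_in mul_in mul'_in one one' by (auto simp: S_def intro!: vspace_closed(3)[OF B'v])
  next
    fix z assume "z \<in> S"
    then show "counit B' z = 0"
    proof (rule S_cases)
      fix x y assume xy: "x \<in> vec B" "y \<in> vec B"
      \<comment> \<open>The counits are multiplicative with values in a field, so they cannot see
        the reversal of the factors.\<close>
      have "counit B' (\<phi> (mul B x y)) = counit B' (mul B' (\<phi> y) (\<phi> x))"
        using B B' xy \<phi>_in mul_in coalgebra_homD(5)[OF \<phi>] by (simp add: bialgebra_def mult.commute)
      then show "counit B' (\<phi> (mul B x y) - mul B' (\<phi> y) (\<phi> x)) = 0"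
        using linear_on_diff[OF coalgebraD(3)[OF B'c] B'v \<phi>_in[OF mul_in[OF xy]]
            mul'_in[OF \<phi>_in[OF xy(2)] \<phi>_in[OF xy(1)]]] by simp
    next
      show "counit B' (\<phi> (unity B) - unity B') = 0"
        using linear_on_diff[OF coalgebraD(3)[OF B'c] B'v \<phi>_in[OF one] one'] B B'
          coalgebra_homD(5)[OF \<phi> one] by (simp add: bialgebra_def)
    qed
  next
    fix z a assume "z \<in> S" and a: "a \<in> vec A"
    from this(1) show "\<psi>' z a = 0"
    proof (rule S_cases)
      fix x y assume xy: "x \<in> vec B" "y \<in> vec B"
      note p = \<phi>_in[OF mul_in[OF xy]] and q = mul'_in[OF \<phi>_in[OF xy(2)] \<phi>_in[OF xy(1)]]
      have "\<psi>' (\<phi> (mul B x y)) a = \<psi>' (mul B' (\<phi> y) (\<phi> x)) a"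
      proof (rule dual_separates[OF A fin \<psi>'_in[OF p a] \<psi>'_in[OF q a]])
        fix g assume g: "g \<in> vec (dual A)"
        \<comment> \<open>Moving first \<open>x\<close> and then \<open>y\<close> from the
          functional to the vector reverses their order: \<phi>(x) acts on \<open>a\<close>
          first.\<close>
        have "g (\<psi>' (\<phi> (mul B x y)) a) = \<psi> x (\<psi> y g) a"
          using pair[OF mul_in[OF xy] g a] act xy g by (simp add: action_def)
        also have "\<dots> = g (\<psi>' (\<phi> y) (\<psi>' (\<phi> x) a))"
          using pair[OF xy(1) \<psi>_in[OF xy(2) g] a] pair[OF xy(2) g \<psi>'_in[OF \<phi>_in[OF xy(1)] a]] by simp
        also have "\<dots> = g (\<psi>' (mul B' (\<phi> y) (\<phi> x)) a)"
          using act' xy \<phi>_in a by (simp add: action_def)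
        finally show "g (\<psi>' (\<phi> (mul B x y)) a) = g (\<psi>' (mul B' (\<phi> y) (\<phi> x)) a)" .
      qed
      then show "\<psi>' (\<phi> (mul B x y) - mul B' (\<phi> y) (\<phi> x)) a = 0"
        using linear_on_diff[OF bilinear_onD(2)[OF \<psi>' a] B'v p q] by simp
    next
      have "\<psi>' (\<phi> (unity B)) a = a"
      proof (rule dual_separates[OF A fin \<psi>'_in[OF \<phi>_in[OF one] a] a])
        show "g (\<psi>' (\<phi> (unity B)) a) = g a" if g: "g \<in> vec (dual A)" for g
          using pair[OF one g a] act g by (simp add: action_def)
      qed
      moreover have "\<psi>' (unity B') a = a" using act' a by (simp add: action_def)
      ultimately show "\<psi>' (\<phi> (unity B) - unity B') a = 0"
        using linear_on_diff[OF bilinear_onD(2)[OF \<psi>' a] B'v \<phi>_in[OF one] one'] by simp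
    qed
  next
    fix W :: "('f, 'u) vsp" and \<pi> z
    assume W: "vspace W" and \<pi>: "linear_on B' W \<pi>" and kills: "\<And>z. z \<in> S \<Longrightarrow> \<pi> z = 0" and "z \<in> S"
    \<comment> \<open>Seen through a map \<pi> that kills \<open>S\<close>, \<phi> is already an
      antihomomorphism. The coideal property follows from this relation and the one for the
      unit.\<close>
    have \<pi>_mul: "\<pi> (\<phi> (mul B x y)) = \<pi> (mul B' (\<phi> y) (\<phi> x))" if xy: "x \<in> vec B" "y \<in> vec B" for x y
      using linear_on_diff[OF \<pi> B'v \<phi>_in[OF mul_in[OF xy]] mul'_in[OF \<phi>_in[OF xy(2)] \<phi>_in[OF xy(1)]]]
        kills[OF S_mul[OF xy]] by simp
    have \<pi>_one: "\<pi> (\<phi> (unity B)) = \<pi> (unity B')"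
      using linear_on_diff[OF \<pi> B'v \<phi>_in[OF one] one'] kills[OF S_one] by simp
    note lin = linear_on_comp[OF coalgebraD(2)[OF B'c] tmap_linear[OF B'v \<pi>]]
    have \<pi>\<phi>: "linear_on B W (\<lambda>x. \<pi> (\<phi> x))" by (rule linear_on_comp[OF \<phi>_lin \<pi>])
    have \<phi>_comul: "tmap 2 B' W \<pi> (comul B' (\<phi> b)) = tmap 2 B W (\<lambda>x. \<pi> (\<phi> x)) (comul B b)"
      if "b \<in> vec B" for b
      using coalgebra_homD(4)[OF \<phi> that] tmap_tmap[OF Bv B'v \<phi>_lin \<pi> coalgebraD(4)[OF Bc that]] by simp
    from \<open>z \<in> S\<close> show "tmap 2 B' W \<pi> (comul B' z) = 0"
    proof (rule S_cases)
      fix x y assume xy: "x \<in> vec B" "y \<in> vec B"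
      note p = \<phi>_in[OF mul_in[OF xy]] and q = mul'_in[OF \<phi>_in[OF xy(2)] \<phi>_in[OF xy(1)]]
      let ?T = "tpow 2 W"
      have bp: "bilinear_on C C ?T (\<lambda>x1 x2. pure 2 W [f x1, g x2])"
        if "linear_on C W f" "linear_on C W g" for C :: "('f, 'u) bialg" and f g
        by (rule bilinear_on_comp[OF bilinear_pure[OF W] that])
      \<comment> \<open>Start from the reversed product: expand by multiplicativity in
        \<open>B'\<close>, then pull both Sweedler sums back along \<phi>.\<close>
      have "tmap 2 B' W \<pi> (comul B' (mul B' (\<phi> y) (\<phi> x))) =
          sweedler B' ?T (\<lambda>u1 u2. sweedler B' ?T (\<lambda>v1 v2.
            pure 2 W [\<pi> (mul B' u1 v1), \<pi> (mul B' u2 v2)]) (\<phi> x)) (\<phi> y)"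
        by (rule tmap_comul_mul[OF B' W \<pi> \<phi>_in[OF xy(2)] \<phi>_in[OF xy(1)]])
      also have "\<dots> = sweedler B ?T (\<lambda>y1 y2. sweedler B' ?T (\<lambda>v1 v2.
            pure 2 W [\<pi> (mul B' (\<phi> y1) v1), \<pi> (mul B' (\<phi> y2) v2)]) (\<phi> x)) y"
        by (rule sweedler_hom[OF Bc B'v vspace_tpow \<phi> sweedler_bilinear_param[OF B'v B'c vspace_tpow
              bp bp \<phi>_in[OF xy(1)]] xy(2)])
          (rule linear_on_comp[OF bilinear_onD(1)[OF mul'] \<pi>] linear_on_comp[OF bilinear_onD(2)[OF mul'] \<pi>],
            assumption)+
      also have "\<dots> = sweedler B ?T (\<lambda>y1 y2. sweedler B ?T (\<lambda>x1 x2.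
            pure 2 W [\<pi> (mul B' (\<phi> y1) (\<phi> x1)), \<pi> (mul B' (\<phi> y2) (\<phi> x2))]) x) y"
      proof (rule fun_cong[OF sweedler_cong])
        fix y1 y2 assume y12: "y1 \<in> vec B" "y2 \<in> vec B"
        show "sweedler B' ?T (\<lambda>v1 v2. pure 2 W [\<pi> (mul B' (\<phi> y1) v1), \<pi> (mul B' (\<phi> y2) v2)]) (\<phi> x) =
            sweedler B ?T (\<lambda>x1 x2. pure 2 W [\<pi> (mul B' (\<phi> y1) (\<phi> x1)), \<pi> (mul B' (\<phi> y2) (\<phi> x2))]) x"
          by (rule sweedler_hom[OF Bc B'v vspace_tpow \<phi> bp xy(1)])
            (rule linear_on_comp[OF bilinear_onD(1)[OF mul' \<phi>_in[OF y12(1)]] \<pi>]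
              linear_on_comp[OF bilinear_onD(1)[OF mul' \<phi>_in[OF y12(2)]] \<pi>])+
      qed
      \<comment> \<open>The reversal happens inside each tensor factor, so the indices 1 and 2 stay
        in place. Only the nesting of the two sums then differs from the expansion for
        \<open>mul B x y\<close>, and \<open>sweedler_swap\<close> corrects that.\<close>
      also have "\<dots> = sweedler B ?T (\<lambda>y1 y2. sweedler B ?T (\<lambda>x1 x2.
            pure 2 W [\<pi> (\<phi> (mul B x1 y1)), \<pi> (\<phi> (mul B x2 y2))]) x) y"
        by (intro fun_cong[OF sweedler_cong]) (simp add: \<pi>_mul)
      also have "\<dots> = sweedler B ?T (\<lambda>x1 x2. sweedler B ?T (\<lambda>y1 y2.
            pure 2 W [\<pi> (\<phi> (mul B x1 y1)), \<pi> (\<phi> (mul B x2 y2))]) y) x"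
        by (rule sweedler_swap[OF Bc Bc vspace_tpow bp bp xy(2,1)])
          (rule linear_on_comp[OF bilinear_onD(1)[OF mul] \<pi>\<phi>] linear_on_comp[OF bilinear_onD(2)[OF mul] \<pi>\<phi>],
            assumption)+
      also have "\<dots> = tmap 2 B W (\<lambda>x. \<pi> (\<phi> x)) (comul B (mul B x y))"
        by (rule tmap_comul_mul[OF B W \<pi>\<phi> xy, symmetric])
      also have "\<dots> = tmap 2 B' W \<pi> (comul B' (\<phi> (mul B x y)))"
        by (rule \<phi>_comul[OF mul_in[OF xy], symmetric])
      finally show "tmap 2 B' W \<pi> (comul B' (\<phi> (mul B x y) - mul B' (\<phi> y) (\<phi> x))) = 0"
        using linear_on_diff[OF lin B'v p q] by simp
    next
      \<comment> \<open>Units are grouplike, so both tensors are squares of vectors that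
        \<open>\<pi>_one\<close> identifies.\<close>
      have c1: "comul B (unity B) = pure 2 B [unity B, unity B]"
        and c1': "comul B' (unity B') = pure 2 B' [unity B', unity B']"
        using B B' by (simp_all add: bialgebra_def)
      have "tmap 2 B' W \<pi> (comul B' (\<phi> (unity B))) = pure 2 W [\<pi> (\<phi> (unity B)), \<pi> (\<phi> (unity B))]"
        using \<phi>_comul[OF one] c1 tmap_pure[OF Bv \<pi>\<phi>, of "[unity B, unity B]" 2] one by (simp add: tuples_2)
      moreover have "tmap 2 B' W \<pi> (comul B' (unity B')) = pure 2 W [\<pi> (unity B'), \<pi> (unity B')]"
        using c1' tmap_pure[OF B'v \<pi>, of "[unity B', unity B']" 2] one' by (simp add: tuples_2)
      ultimately show "tmap 2 B' W \<pi> (comul B' (\<phi> (unity B) - unity B')) = 0"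
        using linear_on_diff[OF lin B'v \<phi>_in[OF one] one'] \<pi>_one by simp
    qed
  qed
  have op: "vec (bialg_op B') = vec B'" "smul (bialg_op B') = smul B'" "comul (bialg_op B') = comul B'"
    "counit (bialg_op B') = counit B'" "mul (bialg_op B') = (\<lambda>x y. mul B' y x)"
    "unity (bialg_op B') = unity B'"
    by (simp_all add: bialg_op_def)
  \<comment> \<open>\<open>bialg_op\<close> changes the multiplication alone, so \<phi> followed by
    the identity of \<open>B'\<close>, viewed as a map into the opposite, is a coalgebra map and
    equals \<phi> as a function.\<close>
  have "vspace (bialg_op B')" using B'v by (simp add: vspace_def op)
  from coalgebra_hom_comp[OF Bc B'v this \<phi> coalgebra_hom_same[OF B'c op(1-4)]]
  have "coalgebra_hom B (bialg_op B') (\<lambda>x. extend0 B' (\<lambda>x. x) (\<phi> x))" .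
  moreover have "extend0 B' (\<lambda>x. x) (\<phi> x) = \<phi> x" for x
    using \<phi>_in HomD(2)[OF coalgebra_homD(1)[OF \<phi>]] by (cases "x \<in> vec B") (auto simp: extend0_def)
  ultimately have hom: "coalgebra_hom B (bialg_op B') \<phi>" by simp
  have "\<phi> (mul B x y) = mul B' (\<phi> y) (\<phi> x)" if "x \<in> vec B" "y \<in> vec B" for x y
    using S0[OF S_mul[OF that]] by simp
  moreover have "\<phi> (unity B) = unity B'" using S0[OF S_one] by simp
  ultimately have "bialgebra_iso B (bialg_op B') \<phi>"
    using hom bij by (simp add: bialgebra_iso_def op)
  then show ?thesis by blast
qed

end
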